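(* If the class $C(m_n)$ is not quasianalytic, then there exists a Riemannian $C(m_n)$-manifold $M$ with boundary such that (1) the geodesic billiard on $M$ is convex with $\mathbf k\equiv0$; (2) for some $T>0$ and some $l$ the set $\Pi^a_{T,l}$ has positive measure; (3) there are nonperiodic billiard trajectories; moreover, $S^*M\setminus\Pi$ is a set of positive measure.
   Context: **Carleman classes.** $\{m_n\}_{n\ge1}$ is a nondecreasing sequence of positive numbers such that (1) $m_n$ grows faster than any power of $n$; (2) $m_{n+1}/m_n\le n\,C^n$ for some constant $C>0$; (3) the sequence $\ln(m_n/n!)$ is convex in $n$. For a bounded domain $D\subset\mathbb R^N$, $C(m_n,D)$ is the set of $u\in C^\infty(D)$ for which there is a constant $C>0$ (depending on $u$) with $\sup_{D}|\partial^\alpha u|\le C^{|\alpha|}m_{|\alpha|}$ for all $|\alpha|\ge1$. A function $u$ belongs to $C(m_n)$ if $u\in C(m_n,D)$ for every relatively compact open subset $D$ of its domain of definition. The class is closed under composition; a $C(m_n)$-manifold (possibly with boundary) is a smooth manifold with an atlas whose transition maps are of class $C(m_n)$ (up to the boundary); a Riemannian $C(m_n)$-manifold is a $C(m_n)$-manifold with a Riemannian metric whose coefficients in such charts are of class $C(m_n)$. The class $C(m_n)$ is quasianalytic if every $u\in C(m_n)$ (on a connected domain) having a zero of infinite order is identically zero. **Geodesic billiard.** Let $d=\dim M$, $h(x,\xi)=|\xi|_x$ (Riemannian length of the covector $\xi\in T^*_xM$), $T'M=\{(x,\xi)\in T^*M:\xi\neq0\}$, $S^*M=\{(x,\xi)\in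 T'M:h(x,\xi)=1\}$. Hamiltonian trajectories solve $\dot x^*=h_\xi(x^*,\xi^* )$, $\dot\xi^*=-h_x(x^*,\xi^* )$ with initial point $(y,\eta)$ at $t=0$. Near $\partial M$ use coordinates $x=(x',x_d)$ with $\partial M=\{x_d=0\}$ and $x_d>0$ in the interior, and dual coordinates $\xi=(\xi',\xi_d)$. If a trajectory started at $(y,\eta)\in T'(M\setminus\partial M)$ hits $\partial M$ at time $\tau$ transversally, i.e. with $h_{\xi_d}(x^*(\tau-0),\xi^*(\tau-0))<0$, it is continued by the Hamiltonian trajectory from the reflected point, i.e. the point with the same $x^*$, the same $\xi'$, the same value of $h$, and $h_{\xi_d}>0$ (angle of incidence equals angle of reflection). Trajectories obtained by consecutive transversal reflections are billiard trajectories, again denoted $(x^*(t;y,\eta),\xi^*(t;y,\eta))$; the shifts along them form the geodesic billiard. The simple reflection condition: for every $(x',\xi')\in T'\partial M$ the function $\xi_d\mapsto h(x',0,\xi',\xi_d)$ has exactly one local minimum $\xi_d^{st}(x',\xi')$. The strong simple reflection condition requires in addition $h_{\xi_d\xi_d}(x',0,\xi',\xi_d^{st})\neq0$. The Hamiltonian curvature is $\mathbf k(x',\xi')=\{h_{\xi_d},h\}|_{x_d=0,\ \xi_d=\xi_d^{st}(x',\xi')}$, $(x',\xi')\in T'\partial M$, with $\{f,g\}=f_\xi\cdot g_x-f_x\cdot g_\xi$ (so that for $h=|\xi|$ on a Euclidean domain $\mathbf k\ge0$ is ordinary convexity). The billiard is convex if the strong simple reflection condition holds and $\mathbf k\ge0$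 on $T'\partial M$. Measure on $S^*M$ is the natural one induced by the canonical measure $dx\,d\xi$ on $T^*M$. **Periodicity.** For $T>0$, a trajectory and its starting point $(y_0,\eta_0)\in T'(M\setminus\partial M)$ are $T$-periodic if $(x^*(T;y_0,\eta_0),\xi^*(T;y_0,\eta_0))=(y_0,\eta_0)$; periodic if $T$-periodic for some $T>0$; absolutely $T$-periodic if (in local coordinates) the function $(y,\eta)\mapsto|x^*(T;y,\eta)-y|^2+|\xi^*(T;y,\eta)-\eta|^2$ has a zero of infinite order at $(y_0,\eta_0)$; absolutely $(T,l)$-periodic if absolutely $T$-periodic and the trajectory hits the boundary exactly $l$ times for $t\in(0,T)$. $\Pi$ and $\Pi^a_{T,l}$ are the sets of periodic and of absolutely $(T,l)$-periodic points lying in $S^*(M\setminus\partial M)$. *)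

theory Defs
  imports "HOL-Analysis.Analysis"
begin

section \<open>Smooth functions and Carleman classes\<close>

text \<open>
  \<open>\<real>\<^sup>n\<close> is the library's \<^const>\<open>Euclidean_space\<close>: sequences \<open>nat \<Rightarrow> real\<close> that vanish from
  index \<open>n\<close> on. This keeps the dimension a term, so that it may be existentially quantified.
  Coordinates are numbered from 0; the distinguished coordinate \<open>x\<^sub>d\<close> at the boundary is
  coordinate \<open>d - 1\<close>.
\<close>

abbreviation rspace :: "nat \<Rightarrow> (nat \<Rightarrow> real) set" where
  "rspace n \<equiv> topspace (Euclidean_space n)"

definition halfspace :: "nat \<Rightarrow> (nat \<Rightarrow> real) set" where
  "halfspace d = {x \<in> rspace d. x (d - 1) \<ge> 0}"

text \<open>
  Partial derivatives are taken within \<open>S\<close>. At points of \<open>S\<close> on the boundary hyperplane of a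
  half-space they are one-sided, so for \<open>S\<close> open in \<^term>\<open>halfspace d\<close> smoothness and all estimates
  are up to the boundary; for \<open>S\<close> open in \<open>\<real>\<^sup>d\<close> the notions are the usual ones.
\<close>

definition pd :: "(nat \<Rightarrow> real) set \<Rightarrow> nat \<Rightarrow> ((nat \<Rightarrow> real) \<Rightarrow> real) \<Rightarrow> (nat \<Rightarrow> real) \<Rightarrow> real" where
  "pd S i u x = vector_derivative (\<lambda>t. u (x(i := t))) (at (x i) within {t. x(i := t) \<in> S})"

definition pds :: "(nat \<Rightarrow> real) set \<Rightarrow> nat list \<Rightarrow> ((nat \<Rightarrow> real) \<Rightarrow> real) \<Rightarrow> (nat \<Rightarrow> real) \<Rightarrow> real" where
  "pds S is u = foldr (pd S) is u"

definition smooth :: "nat \<Rightarrow> (nat \<Rightarrow> real) set \<Rightarrow> ((nat \<Rightarrow> real) \<Rightarrow> real) \<Rightarrow> bool" where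
  "smooth d S u \<longleftrightarrow> (\<forall>is. set is \<subseteq> {..<d} \<longrightarrow>
     continuous_on S (pds S is u) \<and>
     (\<forall>x\<in>S. \<forall>i<d. (\<lambda>t. pds S is u (x(i := t)))
        differentiable (at (x i) within {t. x(i := t) \<in> S})))"

text \<open>Zero of infinite order: the function and all its partial derivatives vanish at the point.\<close>

definition flat_zero :: "nat \<Rightarrow> (nat \<Rightarrow> real) set \<Rightarrow> ((nat \<Rightarrow> real) \<Rightarrow> real) \<Rightarrow> (nat \<Rightarrow> real) \<Rightarrow> bool" where
  "flat_zero d S u x \<longleftrightarrow> smooth d S u \<and> x \<in> S \<and> (\<forall>is. set is \<subseteq> {..<d} \<longrightarrow> pds S is u x = 0)"

definition carleman_weight :: "(nat \<Rightarrow> real) \<Rightarrow> bool" where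
  "carleman_weight m \<longleftrightarrow>
     (\<forall>n\<ge>1. 0 < m n \<and> m n \<le> m (Suc n)) \<and>
     (\<forall>k. filterlim (\<lambda>n. m n / real n ^ k) at_top sequentially) \<and>
     (\<exists>C>0. \<forall>n\<ge>1. m (Suc n) / m n \<le> real n * C ^ n) \<and>
     (\<forall>n\<ge>1. 2 * ln (m (n + 1) / fact (n + 1)) \<le> ln (m n / fact n) + ln (m (n + 2) / fact (n + 2)))"

text \<open>
  The class \<open>C(m\<^sub>n, D)\<close>. A list of length \<open>k\<close> stands for a multi-index of order \<open>k\<close> (for smooth
  functions the order of differentiation is irrelevant).
\<close>

definition carleman_on :: "(nat \<Rightarrow> real) \<Rightarrow> nat \<Rightarrow> (nat \<Rightarrow> real) set \<Rightarrow> ((nat \<Rightarrow> real) \<Rightarrow> real) \<Rightarrow> bool" where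
  "carleman_on m d D u \<longleftrightarrow> smooth d D u \<and>
     (\<exists>C>0. \<forall>is. set is \<subseteq> {..<d} \<and> length is \<ge> 1 \<longrightarrow>
        (\<forall>x\<in>D. \<bar>pds D is u x\<bar> \<le> C ^ length is * m (length is)))"

definition carleman :: "(nat \<Rightarrow> real) \<Rightarrow> nat \<Rightarrow> (nat \<Rightarrow> real) set \<Rightarrow> ((nat \<Rightarrow> real) \<Rightarrow> real) \<Rightarrow> bool" where
  "carleman m d V u \<longleftrightarrow>
     (\<forall>D K. openin (top_of_set V) D \<and> D \<subseteq> K \<and> K \<subseteq> V \<and> compact K \<longrightarrow> carleman_on m d D u)"

definition quasianalytic :: "(nat \<Rightarrow> real) \<Rightarrow> bool" where
  "quasianalytic m \<longleftrightarrow>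
     (\<forall>N\<ge>1. \<forall>V u. openin (Euclidean_space N) V \<and> connected V \<and> carleman m N V u \<and>
        (\<exists>x. flat_zero N V u x) \<longrightarrow> (\<forall>x\<in>V. u x = 0))"

section \<open>Riemannian manifolds of Carleman class, with boundary\<close>

text \<open>A chart is a domain together with a coordinate map into a half-space.\<close>

type_synonym 'p chart = "'p set \<times> ('p \<Rightarrow> nat \<Rightarrow> real)"

text \<open>\<open>gmet M c i j\<close> is the coefficient \<open>g\<^sub>i\<^sub>j\<close> of the metric in the chart \<open>c\<close>, a function of the
  coordinates.\<close>

record 'p rmanifold =
  mdim :: nat
  mtop :: "'p topology"
  atlas :: "'p chart set"
  gmet :: "'p chart \<Rightarrow> nat \<Rightarrow> nat \<Rightarrow> (nat \<Rightarrow> real) \<Rightarrow> real"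

text \<open>Transition map from the coordinates of \<open>c\<close> to those of \<open>c'\<close>, its domain, and the entry
  \<open>\<partial>x'\<^sub>i / \<partial>x\<^sub>k\<close> of its Jacobian.\<close>

definition trans_dom :: "'p chart \<Rightarrow> 'p chart \<Rightarrow> (nat \<Rightarrow> real) set" where
  "trans_dom c c' = snd c ` (fst c \<inter> fst c')"

definition trans_map :: "'p chart \<Rightarrow> 'p chart \<Rightarrow> (nat \<Rightarrow> real) \<Rightarrow> nat \<Rightarrow> real" where
  "trans_map c c' x = snd c' (inv_into (fst c) (snd c) x)"

definition jac :: "'p chart \<Rightarrow> 'p chart \<Rightarrow> (nat \<Rightarrow> real) \<Rightarrow> nat \<Rightarrow> nat \<Rightarrow> real" where
  "jac c c' x i k = pd (trans_dom c c') k (\<lambda>y. trans_map c c' y i) x"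

text \<open>Manifolds are Hausdorff, second countable and connected.\<close>

definition carleman_manifold :: "(nat \<Rightarrow> real) \<Rightarrow> 'p rmanifold \<Rightarrow> bool" where
  "carleman_manifold m M \<longleftrightarrow>
     mdim M \<ge> 1 \<and>
     Hausdorff_space (mtop M) \<and> second_countable (mtop M) \<and> connected_space (mtop M) \<and>
     topspace (mtop M) = (\<Union>c\<in>atlas M. fst c) \<and>
     (\<forall>c\<in>atlas M.
        openin (mtop M) (fst c) \<and>
        openin (top_of_set (halfspace (mdim M))) (snd c ` fst c) \<and>
        homeomorphic_map (subtopology (mtop M) (fst c)) (top_of_set (snd c ` fst c)) (snd c)) \<and>
     (\<forall>c\<in>atlas M. \<forall>c'\<in>atlas M. \<forall>i<mdim M.
        carleman m (mdim M) (trans_dom c c') (\<lambda>x. trans_map c c' x i))"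

definition carleman_metric :: "(nat \<Rightarrow> real) \<Rightarrow> 'p rmanifold \<Rightarrow> bool" where
  "carleman_metric m M \<longleftrightarrow>
     (\<forall>c\<in>atlas M. \<forall>i<mdim M. \<forall>j<mdim M. carleman m (mdim M) (snd c ` fst c) (gmet M c i j)) \<and>
     (\<forall>c\<in>atlas M. \<forall>x\<in>snd c ` fst c.
        (\<forall>i<mdim M. \<forall>j<mdim M. gmet M c i j x = gmet M c j i x) \<and>
        (\<forall>v. (\<exists>i<mdim M. v i \<noteq> 0) \<longrightarrow> (\<Sum>i<mdim M. \<Sum>j<mdim M. gmet M c i j x * v i * v j) > 0)) \<and>
     (\<forall>c\<in>atlas M. \<forall>c'\<in>atlas M. \<forall>x\<in>trans_dom c c'. \<forall>k<mdim M. \<forall>l<mdim M.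
        gmet M c k l x =
          (\<Sum>i<mdim M. \<Sum>j<mdim M. gmet M c' i j (trans_map c c' x) * jac c c' x i k * jac c c' x j l))"

definition riemannian_carleman_manifold :: "(nat \<Rightarrow> real) \<Rightarrow> 'p rmanifold \<Rightarrow> bool" where
  "riemannian_carleman_manifold m M \<longleftrightarrow> carleman_manifold m M \<and> carleman_metric m M"

definition mboundary :: "'p rmanifold \<Rightarrow> 'p set" where
  "mboundary M = {p. \<exists>c\<in>atlas M. p \<in> fst c \<and> snd c p (mdim M - 1) = 0}"

section \<open>The cotangent bundle and the Hamiltonian\<close>

text \<open>
  A covector at \<open>p\<close> is a family of component vectors, one for each chart around \<open>p\<close>, obeying the
  covariant transformation law; for the other charts the components are 0, so that equal covectors
  are equal as functions.
\<close>

type_synonym 'p copoint = "'p \<times> ('p chart \<Rightarrow> nat \<Rightarrow> real)"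

definition covector_at :: "'p rmanifold \<Rightarrow> 'p \<Rightarrow> ('p chart \<Rightarrow> nat \<Rightarrow> real) \<Rightarrow> bool" where
  "covector_at M p w \<longleftrightarrow>
     (\<forall>c. w c \<in> rspace (mdim M)) \<and>
     (\<forall>c. \<not> (c \<in> atlas M \<and> p \<in> fst c) \<longrightarrow> w c = (\<lambda>_. 0)) \<and>
     (\<forall>c\<in>atlas M. \<forall>c'\<in>atlas M. p \<in> fst c \<inter> fst c' \<longrightarrow>
        (\<forall>k<mdim M. w c k = (\<Sum>i<mdim M. w c' i * jac c c' (snd c p) i k)))"

text \<open>\<open>T'M\<close>: the cotangent bundle without the zero section.\<close>

definition cotan' :: "'p rmanifold \<Rightarrow> 'p copoint set" where
  "cotan' M = {(p, w). p \<in> topspace (mtop M) \<and> covector_at M p w \<and> (\<exists>c. w c \<noteq> (\<lambda>_. 0))}"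

text \<open>
  Local coordinates \<open>\<zeta> = (x, \<xi>) \<in> \<real>\<^sup>2\<^sup>d\<close> on the cotangent bundle: \<open>x\<^sub>i = \<zeta> i\<close> and \<open>\<xi>\<^sub>i = \<zeta> (d + i)\<close> for
  \<open>i < d\<close>. In particular \<open>x\<^sub>d\<close> and \<open>\<xi>\<^sub>d\<close> have the indices \<open>d - 1\<close> and \<open>2 * d - 1\<close>.
\<close>

definition coord :: "'p rmanifold \<Rightarrow> 'p chart \<Rightarrow> 'p copoint \<Rightarrow> nat \<Rightarrow> real" where
  "coord M c z i =
     (if i < mdim M then snd c (fst z) i
      else if i < 2 * mdim M then snd z c (i - mdim M) else 0)"

definition base :: "nat \<Rightarrow> (nat \<Rightarrow> real) \<Rightarrow> nat \<Rightarrow> real" where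
  "base d \<zeta> = (\<lambda>i. if i < d then \<zeta> i else 0)"

definition phase :: "'p rmanifold \<Rightarrow> 'p chart \<Rightarrow> (nat \<Rightarrow> real) set" where
  "phase M c = {\<zeta> \<in> rspace (2 * mdim M). base (mdim M) \<zeta> \<in> snd c ` fst c \<and>
     (\<exists>i<mdim M. \<zeta> (mdim M + i) \<noteq> 0)}"

text \<open>\<open>inv_coeffs d a\<close> is the inverse of the \<open>d \<times> d\<close> matrix \<open>a\<close>; only indices below \<open>d\<close> matter.\<close>

definition inv_coeffs :: "nat \<Rightarrow> (nat \<Rightarrow> nat \<Rightarrow> real) \<Rightarrow> nat \<Rightarrow> nat \<Rightarrow> real" where
  "inv_coeffs d a = (SOME b. \<forall>i<d. \<forall>k<d. (\<Sum>j<d. a i j * b j k) = (if i = k then 1 else 0))"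

definition ham :: "'p rmanifold \<Rightarrow> 'p chart \<Rightarrow> (nat \<Rightarrow> real) \<Rightarrow> real" where
  "ham M c \<zeta> = sqrt (\<Sum>i<mdim M. \<Sum>j<mdim M.
     inv_coeffs (mdim M) (\<lambda>k l. gmet M c k l (base (mdim M) \<zeta>)) i j *
       \<zeta> (mdim M + i) * \<zeta> (mdim M + j))"

definition ham_x :: "'p rmanifold \<Rightarrow> 'p chart \<Rightarrow> nat \<Rightarrow> (nat \<Rightarrow> real) \<Rightarrow> real" where
  "ham_x M c i = pd (phase M c) i (ham M c)"

definition ham_xi :: "'p rmanifold \<Rightarrow> 'p chart \<Rightarrow> nat \<Rightarrow> (nat \<Rightarrow> real) \<Rightarrow> real" where
  "ham_xi M c i = pd (phase M c) (mdim M + i) (ham M c)"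

definition cosphere :: "'p rmanifold \<Rightarrow> 'p copoint set" where
  "cosphere M = {z \<in> cotan' M. \<forall>c\<in>atlas M. fst z \<in> fst c \<longrightarrow> ham M c (coord M c z) = 1}"

section \<open>The geodesic billiard\<close>

definition ham_traj :: "'p rmanifold \<Rightarrow> (real \<Rightarrow> 'p copoint) \<Rightarrow> real set \<Rightarrow> bool" where
  "ham_traj M \<gamma> I \<longleftrightarrow>
     (\<forall>t\<in>I. \<gamma> t \<in> cotan' M) \<and>
     continuous_map (top_of_set I) (mtop M) (\<lambda>t. fst (\<gamma> t)) \<and>
     (\<forall>t\<in>I. \<forall>c\<in>atlas M. fst (\<gamma> t) \<in> fst c \<longrightarrow> (\<forall>i<mdim M.
        ((\<lambda>s. coord M c (\<gamma> s) i) has_real_derivative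
           ham_xi M c i (coord M c (\<gamma> t))) (at t within I) \<and>
        ((\<lambda>s. coord M c (\<gamma> s) (mdim M + i)) has_real_derivative
           - ham_x M c i (coord M c (\<gamma> t))) (at t within I)))"

text \<open>\<open>reflects M z z'\<close>: a trajectory hits the boundary transversally with end point \<open>z\<close>, and \<open>z'\<close> is
  the reflected point (same \<open>x\<close>, \<open>\<xi>'\<close> and \<open>h\<close>).\<close>

definition reflects :: "'p rmanifold \<Rightarrow> 'p copoint \<Rightarrow> 'p copoint \<Rightarrow> bool" where
  "reflects M z z' \<longleftrightarrow>
     z \<in> cotan' M \<and> z' \<in> cotan' M \<and> fst z \<in> mboundary M \<and> fst z' = fst z \<and>
     (\<forall>c\<in>atlas M. fst z \<in> fst c \<longrightarrow>
        ham_xi M c (mdim M - 1) (coord M c z) < 0 \<and>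
        (\<forall>i<2 * mdim M - 1. coord M c z' i = coord M c z i) \<and>
        ham M c (coord M c z') = ham M c (coord M c z) \<and>
        ham_xi M c (mdim M - 1) (coord M c z') > 0)"

text \<open>
  A billiard trajectory for times in \<open>[0, T]\<close>, started over the interior. It is right-continuous: at a
  hitting time its value is the reflected point, while \<open>\<delta>\<close> below is its continuation from the left.
  The conditions force hitting times to be isolated, hence finite in number on \<open>[0, T]\<close>.
\<close>

definition billiard :: "'p rmanifold \<Rightarrow> (real \<Rightarrow> 'p copoint) \<Rightarrow> real \<Rightarrow> bool" where
  "billiard M \<gamma> T \<longleftrightarrow>
     \<gamma> 0 \<in> cotan' M \<and> fst (\<gamma> 0) \<notin> mboundary M \<and>
     (\<forall>t\<in>{0..<T}. \<exists>\<epsilon>>0. ham_traj M \<gamma> {t..t+\<epsilon>} \<and> (\<forall>s\<in>{t<..t+\<epsilon>}. fst (\<gamma> s) \<notin> mboundary M)) \<and>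
     (\<forall>t\<in>{0<..T}. \<exists>\<epsilon>>0. \<epsilon> \<le> t \<and> (\<exists>\<delta>. ham_traj M \<delta> {t-\<epsilon>..t} \<and>
        (\<forall>s\<in>{t-\<epsilon>..<t}. \<delta> s = \<gamma> s) \<and> (\<forall>s\<in>{t-\<epsilon><..<t}. fst (\<gamma> s) \<notin> mboundary M) \<and>
        (\<delta> t = \<gamma> t \<and> fst (\<gamma> t) \<notin> mboundary M \<or> reflects M (\<delta> t) (\<gamma> t))))"

definition reaches :: "'p rmanifold \<Rightarrow> real \<Rightarrow> 'p copoint \<Rightarrow> 'p copoint \<Rightarrow> bool" where
  "reaches M T z w \<longleftrightarrow> (\<exists>\<gamma>. billiard M \<gamma> T \<and> \<gamma> 0 = z \<and> \<gamma> T = w)"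

definition shift :: "'p rmanifold \<Rightarrow> real \<Rightarrow> 'p copoint \<Rightarrow> 'p copoint" where
  "shift M T z = (THE w. reaches M T z w)"

text \<open>Points \<open>\<zeta>\<close> of \<open>T'\<partial>M\<close> in the chart \<open>c\<close>; the coordinate \<open>\<xi>\<^sub>d\<close> of \<open>\<zeta>\<close> is arbitrary and irrelevant.\<close>

definition bdry_phase :: "'p rmanifold \<Rightarrow> 'p chart \<Rightarrow> (nat \<Rightarrow> real) set" where
  "bdry_phase M c = {\<zeta> \<in> phase M c. \<zeta> (mdim M - 1) = 0 \<and> (\<exists>i<mdim M - 1. \<zeta> (mdim M + i) \<noteq> 0)}"

definition local_min :: "(real \<Rightarrow> real) \<Rightarrow> real \<Rightarrow> bool" where
  "local_min f s \<longleftrightarrow> (\<exists>\<epsilon>>0. \<forall>t. \<bar>t - s\<bar> < \<epsilon> \<longrightarrow> f s \<le> f t)"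

definition simple_reflection :: "'p rmanifold \<Rightarrow> bool" where
  "simple_reflection M \<longleftrightarrow>
     (\<forall>c\<in>atlas M. \<forall>\<zeta>\<in>bdry_phase M c. \<exists>!s. local_min (\<lambda>t. ham M c (\<zeta>(2 * mdim M - 1 := t))) s)"

text \<open>The point \<open>(x', 0, \<xi>', \<xi>\<^sub>d\<^sup>s\<^sup>t(x', \<xi>'))\<close>.\<close>

definition st_point :: "'p rmanifold \<Rightarrow> 'p chart \<Rightarrow> (nat \<Rightarrow> real) \<Rightarrow> nat \<Rightarrow> real" where
  "st_point M c \<zeta> = \<zeta>(2 * mdim M - 1 :=
     (THE s. local_min (\<lambda>t. ham M c (\<zeta>(2 * mdim M - 1 := t))) s))"

definition strong_simple_reflection :: "'p rmanifold \<Rightarrow> bool" where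
  "strong_simple_reflection M \<longleftrightarrow> simple_reflection M \<and>
     (\<forall>c\<in>atlas M. \<forall>\<zeta>\<in>bdry_phase M c.
        pds (phase M c) [2 * mdim M - 1, 2 * mdim M - 1] (ham M c) (st_point M c \<zeta>) \<noteq> 0)"

definition poisson :: "nat \<Rightarrow> (nat \<Rightarrow> real) set \<Rightarrow>
    ((nat \<Rightarrow> real) \<Rightarrow> real) \<Rightarrow> ((nat \<Rightarrow> real) \<Rightarrow> real) \<Rightarrow> (nat \<Rightarrow> real) \<Rightarrow> real" where
  "poisson d W f g \<zeta> =
     (\<Sum>i<d. pd W (d + i) f \<zeta> * pd W i g \<zeta> - pd W i f \<zeta> * pd W (d + i) g \<zeta>)"

definition ham_curvature :: "'p rmanifold \<Rightarrow> 'p chart \<Rightarrow> (nat \<Rightarrow> real) \<Rightarrow> real" where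
  "ham_curvature M c \<zeta> =
     poisson (mdim M) (phase M c) (ham_xi M c (mdim M - 1)) (ham M c) (st_point M c \<zeta>)"

definition convex_billiard :: "'p rmanifold \<Rightarrow> bool" where
  "convex_billiard M \<longleftrightarrow> strong_simple_reflection M \<and>
     (\<forall>c\<in>atlas M. \<forall>\<zeta>\<in>bdry_phase M c. ham_curvature M c \<zeta> \<ge> 0)"

section \<open>Periodicity\<close>

definition T_periodic :: "'p rmanifold \<Rightarrow> real \<Rightarrow> 'p copoint \<Rightarrow> bool" where
  "T_periodic M T z \<longleftrightarrow> T > 0 \<and> reaches M T z z"

definition periodic :: "'p rmanifold \<Rightarrow> 'p copoint \<Rightarrow> bool" where
  "periodic M z \<longleftrightarrow> (\<exists>T. T_periodic M T z)"

definition coord_inv :: "'p rmanifold \<Rightarrow> 'p chart \<Rightarrow> (nat \<Rightarrow> real) \<Rightarrow> 'p copoint" where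
  "coord_inv M c = inv_into {z \<in> cotan' M. fst z \<in> fst c} (coord M c)"

text \<open>\<open>W\<close> is a coordinate neighbourhood of the starting point on which the shift by time \<open>T\<close> is
  defined and stays in the domain of the chart.\<close>

definition abs_periodic :: "'p rmanifold \<Rightarrow> real \<Rightarrow> 'p copoint \<Rightarrow> bool" where
  "abs_periodic M T z \<longleftrightarrow> T_periodic M T z \<and>
     (\<exists>c\<in>atlas M. \<exists>W. fst z \<in> fst c \<and>
        openin (Euclidean_space (2 * mdim M)) W \<and>
        W \<subseteq> coord M c ` {y \<in> cotan' M. fst y \<in> fst c - mboundary M} \<and>
        (\<forall>\<zeta>\<in>W. \<exists>w. reaches M T (coord_inv M c \<zeta>) w \<and> fst w \<in> fst c) \<and>
        flat_zero (2 * mdim M) W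
          (\<lambda>\<zeta>. \<Sum>i<2 * mdim M. (coord M c (shift M T (coord_inv M c \<zeta>)) i - \<zeta> i)\<^sup>2)
          (coord M c z))"

definition hits :: "'p rmanifold \<Rightarrow> real \<Rightarrow> nat \<Rightarrow> 'p copoint \<Rightarrow> bool" where
  "hits M T l z \<longleftrightarrow> (\<exists>\<gamma>. billiard M \<gamma> T \<and> \<gamma> 0 = z \<and>
     finite {t\<in>{0<..<T}. fst (\<gamma> t) \<in> mboundary M} \<and>
     card {t\<in>{0<..<T}. fst (\<gamma> t) \<in> mboundary M} = l)"

text \<open>The sets \<open>\<Pi>\<close> and \<open>\<Pi>\<^sup>a\<^sub>T\<^sub>,\<^sub>l\<close>.\<close>

definition Per :: "'p rmanifold \<Rightarrow> 'p copoint set" where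
  "Per M = {z \<in> cosphere M. fst z \<notin> mboundary M \<and> periodic M z}"

definition AbsPer :: "'p rmanifold \<Rightarrow> real \<Rightarrow> nat \<Rightarrow> 'p copoint set" where
  "AbsPer M T l = {z \<in> cosphere M. fst z \<notin> mboundary M \<and> abs_periodic M T z \<and> hits M T l z}"

section \<open>The natural measure on the cosphere bundle\<close>

text \<open>Lebesgue measure of \<open>\<real>\<^sup>n\<close>, carried to the sequences vanishing from index \<open>n\<close> on.\<close>

definition leb :: "nat \<Rightarrow> (nat \<Rightarrow> real) measure" where
  "leb n = distr (Pi\<^sub>M {..<n} (\<lambda>_. lborel)) borel (\<lambda>f i. if i < n then f i else 0)"

text \<open>Coordinates of the truncated cone \<open>{(x, r\<xi>). (x, \<xi>) \<in> A, 0 < r \<le> 1}\<close>.\<close>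

definition cone :: "'p rmanifold \<Rightarrow> 'p chart \<Rightarrow> 'p copoint set \<Rightarrow> (nat \<Rightarrow> real) set" where
  "cone M c A = (\<lambda>(r, z) i. if i < mdim M then coord M c z i else r * coord M c z i) ` ({0<..1} \<times> A)"

text \<open>
  The measure \<open>\<sigma>\<close> on \<open>S\<^sup>*M\<close> induced by \<open>dx d\<xi>\<close> through \<open>dx d\<xi> = h\<^sup>d\<^sup>-\<^sup>1 dh d\<sigma>\<close>. Integrating over \<open>0 < h \<le> 1\<close>, the
  cone over \<open>A\<close> has \<open>dx d\<xi>\<close>-measure \<open>\<sigma>(A)/d\<close>. The defining property determines \<open>\<sigma>\<close>, as \<open>M\<close> is
  covered by countably many charts.
\<close>

definition natural_measure :: "'p rmanifold \<Rightarrow> 'p copoint measure \<Rightarrow> bool" where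
  "natural_measure M \<sigma> \<longleftrightarrow>
     space \<sigma> = cosphere M \<and>
     sets \<sigma> = {A. A \<subseteq> cosphere M \<and>
        (\<forall>c\<in>atlas M. coord M c ` {z \<in> A. fst z \<in> fst c} \<in> sets borel)} \<and>
     (\<forall>c\<in>atlas M. \<forall>A\<in>sets \<sigma>. (\<forall>z\<in>A. fst z \<in> fst c) \<longrightarrow>
        emeasure \<sigma> A = of_nat (mdim M) * emeasure (leb (2 * mdim M)) (cone M c A))"

end

theory Submission
  imports Defs
begin

text \<open>
  The example is a surface of curvature \<open>1\<close> with geodesic boundary: the universal cover of a closed
  hemisphere from which one interior point \<open>p\<close>, not the pole, has been removed. On the closed
  hemisphere every billiard trajectory that is not the equator itself runs along a great half circle,
  is reflected at the equator, returns to its starting point along the mirror image of the other half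
  of that great circle, and closes up after time \<open>2\<pi>\<close> and two reflections. On the cover such a loop lifts to
  a closed trajectory if it does not wind around \<open>p\<close>, and to a trajectory that advances forever from
  sheet to sheet if it does. Both cases occur on nonempty open sets of initial covectors. In the
  first case all neighbouring trajectories close as well, so the shift by \<open>2\<pi>\<close> is locally the
  identity and the points are absolutely periodic; in the second case there are complete nonperiodic
  trajectories. The boundary is a geodesic, so the Hamiltonian curvature vanishes. The metric is
  real analytic, and the convexity of \<open>ln (m\<^sub>n / n!)\<close> places functions with analytic bounds in the class \<open>C(m\<^sub>n)\<close>.

  The cover is a closed half-plane \<open>y \<ge> 0\<close> with the conformal metric \<open>(dx\<^sup>2 + dy\<^sup>2) / F\<^sup>2\<close>, where
  \<open>F = a cosh y - b cos x\<close> and \<open>a\<^sup>2 = b\<^sup>2 + 1\<close>. The point of the hemisphere below \<open>(x, y)\<close> is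
  \<open>(r, v, s) = (a cos x - b cosh y, sin x, sinh y) / F\<close>, so \<open>(r, v)\<close> is its projection to the equatorial
  disc, and \<open>(a r + b, v) = (cos x, sin x) / F\<close>. Hence \<open>p\<close> is the point \<open>(r, v) = (- b / a, 0)\<close>, at
  \<open>y = \<infinity>\<close>, and \<open>x\<close> is a polar angle around \<open>p\<close> once the \<open>r\<close>-axis is stretched by the factor \<open>a\<close>.

  Along the flow the position in \<open>\<real>\<^sup>3\<close> obeys \<open>X'' = - X\<close>. A reflection changes neither \<open>r\<close> and \<open>v\<close> nor
  their derivatives, so these obey the same linear equation along the whole billiard trajectory
  (\<open>billiard_observables\<close>). This yields uniqueness (\<open>billiard_unique\<close>), and it shows that the
  projection to the disc traces an ellipse about the centre. The sign of the function \<open>clearance\<close> tells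
  whether \<open>p\<close> is outside this ellipse, on it or inside it: outside, \<open>x\<close> returns to its initial value and
  the trajectory closes (\<open>orbit_closes\<close>); inside, \<open>x\<close> is strictly monotone (\<open>not_periodic_winding\<close>); if \<open>p\<close>
  is on the ellipse, a trajectory that closed up would pass through \<open>p\<close> (\<open>not_periodic_puncture\<close>).
  So the sets of periodic and of absolutely \<open>(2\<pi>, 2)\<close>-periodic points are both equal to
  \<open>{clearance > 0}\<close> over the interior, which is measurable, and nonempty open sets have positive measure.
\<close>

section \<open>Partial derivatives within half-spaces\<close>

text \<open>
  At a point of the boundary hyperplane only one side is available for differentiation in the last
  coordinate. The sets on which derivatives are taken in this theory are all open to the side of
  increasing coordinates; that alone makes the derivatives within these sets unique.
\<close>

definition upward :: "nat \<Rightarrow> (nat \<Rightarrow> real) set \<Rightarrow> bool" where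
  "upward d S \<longleftrightarrow> (\<forall>x\<in>S. \<forall>i<d. \<exists>e>0. \<forall>t. x i < t \<and> t < x i + e \<longrightarrow> x(i := t) \<in> S)"

lemma upward_nontrivial:
  assumes "upward d S" "x \<in> S" "i < d"
  shows "at (x i) within {t. x(i := t) \<in> S} \<noteq> bot"
proof -
  obtain e where e: "e > 0" "\<And>t. x i < t \<Longrightarrow> t < x i + e \<Longrightarrow> x(i := t) \<in> S"
    using assms unfolding upward_def by metis
  have "at (x i) within {x i<..<x i + e} \<noteq> bot"
    using e(1) by (simp add: trivial_limit_within islimpt_greaterThanLessThan1)
  moreover have "at (x i) within {x i<..<x i + e} \<le> at (x i) within {t. x(i := t) \<in> S}"
    by (rule at_le) (use e(2) in auto)
  ultimately show ?thesis by (metis bot.extremum_uniqueI)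
qed

lemma pd_eqI:
  assumes "upward d S" "x \<in> S" "i < d"
    and "((\<lambda>t. u (x(i := t))) has_real_derivative D) (at (x i) within {t. x(i := t) \<in> S})"
  shows "pd S i u x = D"
  unfolding pd_def
  by (rule vector_derivative_within)
     (use upward_nontrivial[OF assms(1-3)] assms(4) in
       \<open>auto simp: has_real_derivative_iff_has_vector_derivative\<close>)

lemma pd_cong:
  assumes "x \<in> S" "\<And>y. y \<in> S \<Longrightarrow> u y = v y"
  shows "pd S i u x = pd S i v x"
proof -
  have "((\<lambda>t. u (x(i := t))) has_vector_derivative D) (at (x i) within {t. x(i := t) \<in> S}) \<longleftrightarrow>
        ((\<lambda>t. v (x(i := t))) has_vector_derivative D) (at (x i) within {t. x(i := t) \<in> S})" for D
    by (intro iffI; erule has_vector_derivative_transform[rotated 2]) (use assms in auto)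
  then show ?thesis unfolding pd_def vector_derivative_def by simp
qed

lemma continuous_on_upd: "continuous_on S (\<lambda>t. (x :: nat \<Rightarrow> real)(i := t))"
proof (rule continuous_on_coordinatewise_then_product)
  fix j show "continuous_on S (\<lambda>t. (x(i := t)) j)"
    by (cases "j = i") (auto intro: continuous_intros)
qed

lemma upward_Int_open:
  assumes T: "open T" and S: "\<And>x i t. x \<in> S \<Longrightarrow> i < d \<Longrightarrow> x i < t \<Longrightarrow> x(i := t) \<in> S"
  shows "upward d (S \<inter> T)"
  unfolding upward_def
proof (intro ballI allI impI)
  fix x i assume x: "x \<in> S \<inter> T" and i: "i < d"
  have "open ((\<lambda>t. x(i := t)) -` T)"
    using T continuous_on_upd by (rule open_vimage)
  moreover have "x i \<in> (\<lambda>t. x(i := t)) -` T" using x by auto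
  ultimately obtain e where e: "e > 0" "ball (x i) e \<subseteq> (\<lambda>t. x(i := t)) -` T"
    by (meson openE)
  have "x(i := t) \<in> S \<inter> T" if "x i < t" "t < x i + e" for t
  proof -
    have "t \<in> ball (x i) e" using that by (auto simp: dist_real_def)
    then show ?thesis using e(2) S[of x i t] x i that(1) by auto
  qed
  then show "\<exists>e>0. \<forall>t. x i < t \<and> t < x i + e \<longrightarrow> x(i := t) \<in> S \<inter> T" using e(1) by blast
qed

lemma upward_openin_halfspace:
  assumes "openin (top_of_set (halfspace d)) D"
  shows "upward d D"
proof -
  obtain T where T: "open T" "D = halfspace d \<inter> T"
    using assms by (auto simp: openin_open)
  show ?thesis unfolding T(2)
    by (rule upward_Int_open[OF T(1)]) (auto simp: halfspace_def topspace_Euclidean_space)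
qed

lemma upward_openin_Euclidean:
  assumes "openin (Euclidean_space d) D"
  shows "upward d D"
proof -
  obtain T where T: "open T" "D = rspace d \<inter> T"
    using assms
    by (auto simp: Euclidean_space_def openin_subtopology euclidean_product_topology)
  show ?thesis unfolding T(2)
    by (rule upward_Int_open[OF T(1)]) (auto simp: topspace_Euclidean_space)
qed

text \<open>
  Near the periodic points found below the shift is the identity, so this is the only kind of zero of
  infinite order that occurs.
\<close>

lemma flat_zero_vanishing:
  assumes W: "openin (Euclidean_space n) W" and x: "x \<in> W" and u: "\<And>y. y \<in> W \<Longrightarrow> u y = 0"
  shows "flat_zero n W u x"
proof -
  have up: "upward n W" using W by (rule upward_openin_Euclidean)
  have z: "set is \<subseteq> {..<n} \<Longrightarrow> \<forall>y\<in>W. pds W is u y = 0" for "is"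
  proof (induction "is")
    case Nil
    then show ?case using u by (simp add: pds_def)
  next
    case (Cons i "is")
    show ?case
    proof
      fix y assume y: "y \<in> W"
      have "pd W i (pds W is u) y = pd W i (\<lambda>_. 0) y"
        by (rule pd_cong) (use y Cons in auto)
      also have "\<dots> = 0" by (rule pd_eqI[OF up y]) (use Cons in auto)
      finally show "pds W (i # is) u y = 0" by (simp add: pds_def)
    qed
  qed
  have "smooth n W u"
    unfolding smooth_def
  proof (intro allI impI conjI ballI)
    fix "is" assume s: "set is \<subseteq> {..<n}"
    show "continuous_on W (pds W is u)"
      by (rule continuous_on_cong[THEN iffD1, OF refl _ continuous_on_const[of W 0]]) (use z s in auto)
    fix y i assume y: "y \<in> W" "i < n"
    have "((\<lambda>t. pds W is u (y(i := t))) has_real_derivative 0) (at (y i) within {t. y(i := t) \<in> W})"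
      by (rule has_field_derivative_transform_within[where f = "\<lambda>_. 0" and d = 1])
         (use z[OF s] y in auto)
    then show "(\<lambda>t. pds W is u (y(i := t))) differentiable (at (y i) within {t. y(i := t) \<in> W})"
      using real_differentiable_def by blast
  qed
  then show ?thesis using x z by (auto simp: flat_zero_def)
qed

section \<open>Symbolic differentiation and Carleman bounds\<close>

text \<open>
  The coefficients \<open>a\<close> and \<open>b\<close> of the metric: \<open>a\<^sup>2 - b\<^sup>2 = 1\<close> normalises the curvature to \<open>1\<close>, and
  \<open>b > 0\<close> keeps the removed point away from the pole.
\<close>

definition ca :: real where "ca = 5 / 4"
definition cb :: real where "cb = 3 / 4"

lemma ca_cb: "ca\<^sup>2 = cb\<^sup>2 + 1" "0 < cb" "cb < ca" "0 < ca"
  by (auto simp: ca_def cb_def power2_eq_square)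

text \<open>
  The metric is \<open>(dx\<^sup>2 + dy\<^sup>2) / conf\<^sup>2\<close>. The argument may be a point of the surface or of its cotangent
  bundle, since only the coordinates \<open>0\<close> and \<open>1\<close> are read.
\<close>

definition conf :: "(nat \<Rightarrow> real) \<Rightarrow> real" where
  "conf \<zeta> = ca * cosh (\<zeta> 1) - cb * cos (\<zeta> 0)"

lemma conf_pos: "conf \<zeta> > 0"
proof -
  have "cb * cos (\<zeta> 0) \<le> cb * 1" using ca_cb by (intro mult_left_mono) auto
  also have "\<dots> < ca * 1" using ca_cb by simp
  also have "\<dots> \<le> ca * cosh (\<zeta> 1)" using ca_cb cosh_real_ge_1 by (intro mult_left_mono) auto
  finally show ?thesis by (simp add: conf_def)
qed

text \<open>
  These functions generate an algebra that is closed under both partial derivatives and contains the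
  coordinates and the metric coefficients. Differentiating symbolic polynomials in the generators
  reduces the bounds on derivatives of all orders to counting terms.
\<close>

datatype gen = GX | GY | GCosh | GSinh | GCos | GSin | GInv

fun gev :: "gen \<Rightarrow> (nat \<Rightarrow> real) \<Rightarrow> real" where
  "gev GX x = x 0"
| "gev GY x = x 1"
| "gev GCosh x = cosh (x 1)"
| "gev GSinh x = sinh (x 1)"
| "gev GCos x = cos (x 0)"
| "gev GSin x = sin (x 0)"
| "gev GInv x = inverse (conf x)"

type_synonym gpoly = "(real \<times> gen list) list"

fun gder :: "nat \<Rightarrow> gen \<Rightarrow> gpoly" where
  "gder i GX = (if i = 0 then [(1, [])] else [])"
| "gder i GY = (if i = 0 then [] else [(1, [])])"
| "gder i GCosh = (if i = 0 then [] else [(1, [GSinh])])"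
| "gder i GSinh = (if i = 0 then [] else [(1, [GCosh])])"
| "gder i GCos = (if i = 0 then [(-1, [GSin])] else [])"
| "gder i GSin = (if i = 0 then [(1, [GCos])] else [])"
| "gder i GInv = (if i = 0 then [(-cb, [GInv, GInv, GSin])] else [(-ca, [GInv, GInv, GSinh])])"

fun mder :: "nat \<Rightarrow> gen list \<Rightarrow> gpoly" where
  "mder i [] = []"
| "mder i (g # gs) =
     map (\<lambda>(c, hs). (c, hs @ gs)) (gder i g) @ map (\<lambda>(c, hs). (c, g # hs)) (mder i gs)"

fun pder :: "nat \<Rightarrow> gpoly \<Rightarrow> gpoly" where
  "pder i [] = []"
| "pder i ((c, gs) # p) = map (\<lambda>(d, hs). (c * d, hs)) (mder i gs) @ pder i p"

definition mev :: "gen list \<Rightarrow> (nat \<Rightarrow> real) \<Rightarrow> real" where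
  "mev gs x = prod_list (map (\<lambda>g. gev g x) gs)"

definition pev :: "gpoly \<Rightarrow> (nat \<Rightarrow> real) \<Rightarrow> real" where
  "pev p x = sum_list (map (\<lambda>(c, gs). c * mev gs x) p)"

definition weight :: "gpoly \<Rightarrow> real" where
  "weight p = sum_list (map (\<lambda>(c, gs). \<bar>c\<bar>) p)"

definition deg_le :: "nat \<Rightarrow> gpoly \<Rightarrow> bool" where
  "deg_le n p \<longleftrightarrow> (\<forall>(c, gs)\<in>set p. length gs \<le> n)"

lemma mev_simps [simp]: "mev [] x = 1" "mev (g # gs) x = gev g x * mev gs x"
    "mev (gs @ hs) x = mev gs x * mev hs x"
  by (auto simp: mev_def)

lemma pev_simps [simp]: "pev [] x = 0" "pev ((c, gs) # p) x = c * mev gs x + pev p x"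
    "pev (p @ q) x = pev p x + pev q x"
  by (auto simp: pev_def)

lemma pev_map_append: "pev (map (\<lambda>(c, hs). (c, hs @ gs)) p) x = pev p x * mev gs x"
  by (induction p) (auto simp: algebra_simps)

lemma pev_map_Cons: "pev (map (\<lambda>(c, hs). (c, g # hs)) p) x = gev g x * pev p x"
  by (induction p) (auto simp: algebra_simps)

lemma pev_map_scale: "pev (map (\<lambda>(d, hs). (c * d, hs)) p) x = c * pev p x"
  by (induction p) (auto simp: algebra_simps)

lemma gev_deriv:
  assumes "i < 2"
  shows "((\<lambda>t. gev g (x(i := t))) has_real_derivative pev (gder i g) x) (at (x i))"
proof -
  consider "i = 0" | "i = 1" using assms by linarith
  then show ?thesis
  proof cases
    case 1
    have "((\<lambda>t. conf (x(0 := t))) has_real_derivative cb * sin (x 0)) (at (x 0))"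
      by (auto simp: conf_def intro!: derivative_eq_intros)
    from DERIV_inverse_fun[OF this] conf_pos[of x] show ?thesis
      using 1 by (cases g) (auto intro!: derivative_eq_intros simp: mult_ac power2_eq_square)
  next
    case 2
    have "((\<lambda>t. conf (x(1 := t))) has_real_derivative ca * sinh (x 1)) (at (x 1))"
      by (auto simp: conf_def intro!: derivative_eq_intros)
    from DERIV_inverse_fun[OF this] conf_pos[of x] show ?thesis
      using 2 by (cases g) (auto intro!: derivative_eq_intros simp: mult_ac power2_eq_square)
  qed
qed

lemma mev_deriv:
  assumes "i < 2"
  shows "((\<lambda>t. mev gs (x(i := t))) has_real_derivative pev (mder i gs) x) (at (x i))"
proof (induction gs)
  case (Cons g gs)
  show ?case
    using DERIV_mult[OF gev_deriv[OF assms, of g x] Cons]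
    by (simp add: pev_map_append pev_map_Cons mult.commute add.commute del: fun_upd_apply)
qed auto

lemma pev_deriv:
  assumes "i < 2"
  shows "((\<lambda>t. pev p (x(i := t))) has_real_derivative pev (pder i p) x) (at (x i))"
proof (induction p)
  case (Cons a p)
  obtain c gs where a: "a = (c, gs)" by (cases a)
  show ?case
    using DERIV_add[OF DERIV_cmult[OF mev_deriv[OF assms, of gs x], of c] Cons]
    by (simp add: a pev_map_scale del: fun_upd_apply)
qed auto

lemma gev_cont: "continuous_on S (gev g)"
proof -
  have c: "continuous_on S (\<lambda>x::nat\<Rightarrow>real. x i)" for i
    by (rule continuous_on_subset[OF continuous_on_product_coordinates]) auto
  have "\<forall>x\<in>S. conf x \<noteq> 0" using conf_pos by (metis less_irrefl)
  then show ?thesis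
    by (cases g) (auto intro!: continuous_intros c simp: conf_def)
qed

lemma pev_cont: "continuous_on S (pev p)"
proof -
  have "continuous_on S (mev gs)" for gs
    by (induction gs) (auto intro!: continuous_intros gev_cont)
  then show ?thesis
    by (induction p) (auto intro!: continuous_intros)
qed

lemma pds_pev:
  assumes "upward 2 S" "set is \<subseteq> {..<2}" "x \<in> S"
  shows "pds S is (pev p) x = pev (foldr pder is p) x"
  using assms(2,3)
proof (induction "is" arbitrary: x)
  case (Cons i "is")
  have "pd S i (pds S is (pev p)) x = pd S i (pev (foldr pder is p)) x"
    by (rule pd_cong) (use Cons in auto)
  also have "\<dots> = pev (pder i (foldr pder is p)) x"
    by (rule pd_eqI[OF assms(1)])
       (use Cons in \<open>auto intro!: has_field_derivative_at_within pev_deriv\<close>)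
  finally show ?case by (simp add: pds_def)
qed (simp add: pds_def)

lemma smooth_pev:
  assumes "upward 2 S"
  shows "smooth 2 S (pev p)"
  unfolding smooth_def
proof (intro allI impI conjI ballI)
  fix "is" :: "nat list" assume s: "set is \<subseteq> {..<2}"
  show "continuous_on S (pds S is (pev p))"
    by (rule continuous_on_cong[THEN iffD1, OF refl _ pev_cont]) (use pds_pev[OF assms s] in auto)
  fix y i assume y: "y \<in> S" "i < (2::nat)"
  have "((\<lambda>t. pds S is (pev p) (y(i := t))) has_real_derivative pev (pder i (foldr pder is p)) y)
      (at (y i) within {t. y(i := t) \<in> S})"
    by (rule has_field_derivative_transform_within[where d = 1, OF
          has_field_derivative_at_within[OF pev_deriv[of i "foldr pder is p" y]]])
       (use pds_pev[OF assms s] y in auto)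
  then show "(\<lambda>t. pds S is (pev p) (y(i := t))) differentiable (at (y i) within {t. y(i := t) \<in> S})"
    using real_differentiable_def by blast
qed

lemma weight_simps [simp]: "weight [] = 0" "weight ((c, gs) # p) = \<bar>c\<bar> + weight p"
    "weight (p @ q) = weight p + weight q"
  by (auto simp: weight_def)

lemma weight_nonneg: "weight p \<ge> 0"
  by (induction p) auto

lemma weight_map: "weight (map (\<lambda>(c, hs). (c, f hs)) p) = weight p"
  by (induction p) auto

lemma weight_map_scale: "weight (map (\<lambda>(d, hs). (c * d, hs)) p) = \<bar>c\<bar> * weight p"
  by (induction p) (auto simp: algebra_simps abs_mult)

text \<open>
  The derivative of a generator is zero or a single monomial with a coefficient of at most \<open>2\<close> in
  absolute value; the product rule adds these up over the factors.
\<close>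

lemma weight_mder: "weight (mder i gs) \<le> 2 * length gs"
proof (induction gs)
  case (Cons g gs)
  have "weight (gder i g) \<le> 2"
    by (cases g) (auto simp: ca_def cb_def)
  then show ?case using Cons by (simp add: weight_map)
qed simp

lemma deg_le_mder: "deg_le (length gs + 2) (mder i gs)"
proof (induction gs)
  case (Cons g gs)
  have "deg_le 3 (gder i g)"
    by (cases g) (auto simp: deg_le_def)
  then show ?case using Cons by (fastforce simp: deg_le_def)
qed (simp add: deg_le_def)

lemma deg_le_pder: "deg_le n p \<Longrightarrow> deg_le (n + 2) (pder i p)"
proof (induction p)
  case (Cons a p)
  obtain c gs where a: "a = (c, gs)" by (cases a)
  show ?case using Cons deg_le_mder[of gs i] by (fastforce simp: a deg_le_def)
qed (simp add: deg_le_def)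

lemma weight_pder: "deg_le n p \<Longrightarrow> weight (pder i p) \<le> 2 * n * weight p"
proof (induction p)
  case (Cons a p)
  obtain c gs where a: "a = (c, gs)" by (cases a)
  have "weight (mder i gs) \<le> 2 * length gs" by (rule weight_mder)
  also have "\<dots> \<le> 2 * n" using Cons.prems by (simp add: a deg_le_def)
  finally have "\<bar>c\<bar> * weight (mder i gs) \<le> \<bar>c\<bar> * (2 * n)" by (intro mult_left_mono) auto
  moreover have "deg_le n p" using Cons.prems by (simp add: deg_le_def)
  moreover have "weight (pder i (a # p)) = \<bar>c\<bar> * weight (mder i gs) + weight (pder i p)"
    by (simp add: a weight_map_scale)
  ultimately show ?case using Cons.IH by (simp add: a algebra_simps)
qed simp

text \<open>
  A derivative raises the degree by at most \<open>2\<close> and multiplies the weight by at most twice the degree.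
  Starting from degree \<open>2\<close>, the \<open>j\<close>-th differentiation contributes the factor \<open>4 j\<close>, and the product of
  these factors is the bound \<open>4\<^sup>k k!\<close> typical of analytic functions.
\<close>

lemma iterated_pder_bound:
  assumes "deg_le 2 p"
  shows "deg_le (2 * length is + 2) (foldr pder is p) \<and>
         weight (foldr pder is p) \<le> weight p * 4 ^ length is * fact (length is)"
proof (induction "is")
  case (Cons i "is")
  let ?q = "foldr pder is p" and ?k = "length is"
  have d: "deg_le (2 * ?k + 2) ?q" using Cons by simp
  have "weight (pder i ?q) \<le> 2 * real (2 * ?k + 2) * weight ?q" by (rule weight_pder[OF d])
  also have "\<dots> \<le> 2 * real (2 * ?k + 2) * (weight p * 4 ^ ?k * fact ?k)"
    using Cons by (intro mult_left_mono) auto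
  also have "\<dots> = weight p * 4 ^ Suc ?k * fact (Suc ?k)" by (simp add: algebra_simps)
  finally show ?case using deg_le_pder[OF d, of i] by (simp add: algebra_simps)
qed (use assms in \<open>auto simp: numeral_2_eq_2\<close>)

lemma pev_bound:
  assumes K: "K \<ge> 1" "\<And>g. \<bar>gev g x\<bar> \<le> K" and "deg_le n p"
  shows "\<bar>pev p x\<bar> \<le> weight p * K ^ n"
  using assms(3)
proof (induction p)
  case (Cons a p)
  obtain c gs where a: "a = (c, gs)" by (cases a)
  have "\<bar>mev gs x\<bar> \<le> K ^ length gs"
  proof (induction gs)
    case (Cons g gs)
    then show ?case using K by (auto simp: abs_mult intro!: mult_mono)
  qed simp
  also have "\<dots> \<le> K ^ n" using K Cons.prems by (intro power_increasing) (auto simp: a deg_le_def)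
  finally have "\<bar>c * mev gs x\<bar> \<le> \<bar>c\<bar> * K ^ n" by (simp add: abs_mult mult_left_mono)
  moreover have "deg_le n p" using Cons.prems by (simp add: deg_le_def)
  ultimately show ?case using Cons.IH by (simp add: a algebra_simps)
qed simp

text \<open>
  A convex sequence lies above an affine one; applied to \<open>ln (m\<^sub>n / n!)\<close> this says that \<open>m\<^sub>n\<close> is at least
  \<open>n!\<close> up to a geometric factor.
\<close>

lemma factorial_le_weight:
  assumes "carleman_weight m"
  obtains Q where "Q \<ge> 1" "\<And>n. n \<ge> 1 \<Longrightarrow> fact n \<le> Q ^ n * m n"
proof -
  define l where "l n = ln (m n / fact n)" for n
  have mp: "m n > 0" if "n \<ge> 1" for n using assms that by (auto simp: carleman_weight_def)
  have cv: "l (n + 2) - l (n + 1) \<ge> l (n + 1) - l n" if "n \<ge> 1" for n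
    using assms that by (force simp: carleman_weight_def l_def)
  define s where "s = l 2 - l 1"
  have inc: "n \<ge> 1 \<Longrightarrow> l (n + 1) - l n \<ge> s" for n
  proof (induction n rule: nat_induct_at_least)
    case base then show ?case by (simp add: s_def numeral_2_eq_2)
  next
    case (Suc n) then show ?case using cv[of n] by (simp add: numeral_2_eq_2)
  qed
  define c where "c = \<bar>l 1\<bar> + \<bar>s\<bar>"
  have low: "n \<ge> 1 \<Longrightarrow> l n \<ge> - c * real n" for n
  proof (induction n rule: nat_induct_at_least)
    case base then show ?case by (simp add: c_def)
  next
    case (Suc n) then show ?case using inc[of n] by (simp add: c_def algebra_simps)
  qed
  have "fact n \<le> exp c ^ n * m n" if n: "n \<ge> 1" for n
  proof -
    have "exp (- c * real n) \<le> exp (l n)" using low[OF n] by simp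
    also have "\<dots> = m n / fact n" using mp[OF n] by (simp add: l_def)
    finally have "fact n * exp (- c * real n) \<le> m n" by (simp add: field_simps)
    then have "fact n * exp (- c * real n) * exp (c * real n) \<le> m n * exp (c * real n)"
      by (intro mult_right_mono) auto
    then show ?thesis by (simp add: mult.assoc flip: exp_add exp_of_nat_mult) (simp add: mult.commute)
  qed
  moreover have "exp c \<ge> 1" by (simp add: c_def)
  ultimately show ?thesis using that by blast
qed

lemma carleman_pev:
  assumes m: "carleman_weight m" and p: "deg_le 2 p"
    and V: "openin (top_of_set (halfspace 2)) V"
  shows "carleman m 2 V (pev p)"
  unfolding carleman_def carleman_on_def
proof (intro allI impI conjI)
  fix D K assume DK: "openin (top_of_set V) D \<and> D \<subseteq> K \<and> K \<subseteq> V \<and> compact K"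
  have "openin (top_of_set (halfspace 2)) D"
    using DK V openin_trans by blast
  then have up: "upward 2 D" by (rule upward_openin_halfspace)
  show "smooth 2 D (pev p)" by (rule smooth_pev[OF up])
  have "\<exists>B. \<forall>x\<in>K. \<bar>gev g x\<bar> \<le> B" for g
    using compact_imp_bounded[OF compact_continuous_image[OF gev_cont, of K g]] DK
    by (auto simp: bounded_iff)
  then obtain B where B: "\<And>g x. x \<in> K \<Longrightarrow> \<bar>gev g x\<bar> \<le> B g" by metis
  define L where "L = 1 + \<bar>B GX\<bar> + \<bar>B GY\<bar> + \<bar>B GCosh\<bar> + \<bar>B GSinh\<bar> + \<bar>B GCos\<bar> + \<bar>B GSin\<bar> + \<bar>B GInv\<bar>"
  have L1: "L \<ge> 1" by (simp add: L_def)
  have L: "\<bar>gev g x\<bar> \<le> L" if "x \<in> K" for g x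
    using B[OF that, of g] by (cases g) (auto simp: L_def)
  obtain Q where Q: "Q \<ge> 1" "\<And>n. n \<ge> 1 \<Longrightarrow> fact n \<le> Q ^ n * m n"
    using factorial_le_weight[OF m] by blast
  define A where "A = 1 + weight p * L\<^sup>2"
  have A1: "A \<ge> 1" by (simp add: A_def weight_nonneg)
  show "\<exists>C>0. \<forall>is. set is \<subseteq> {..<2} \<and> length is \<ge> 1 \<longrightarrow>
        (\<forall>x\<in>D. \<bar>pds D is (pev p) x\<bar> \<le> C ^ length is * m (length is))"
  proof (intro exI[of _ "A * (4 * L\<^sup>2) * Q"] conjI allI impI ballI)
    show "0 < A * (4 * L\<^sup>2) * Q" using A1 L1 Q by (auto intro!: mult_pos_pos)
    fix "is" :: "nat list" and x assume s: "set is \<subseteq> {..<2} \<and> 1 \<le> length is" and x: "x \<in> D"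
    let ?k = "length is"
    have "\<bar>pds D is (pev p) x\<bar> = \<bar>pev (foldr pder is p) x\<bar>"
      using pds_pev[OF up _ x] s by simp
    also have "\<dots> \<le> weight (foldr pder is p) * L ^ (2 * ?k + 2)"
      by (rule pev_bound) (use L1 L x DK iterated_pder_bound[OF p] in auto)
    also have "\<dots> \<le> (weight p * 4 ^ ?k * fact ?k) * L ^ (2 * ?k + 2)"
      using iterated_pder_bound[OF p, of "is"] L1 by (intro mult_right_mono) auto
    also have "\<dots> = (weight p * L\<^sup>2) * (4 * L\<^sup>2) ^ ?k * fact ?k"
      by (simp add: power_add power_mult power_mult_distrib power2_eq_square)
    also have "\<dots> \<le> A ^ ?k * (4 * L\<^sup>2) ^ ?k * (Q ^ ?k * m ?k)"
    proof (intro mult_mono)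
      have "weight p * L\<^sup>2 \<le> A" by (simp add: A_def)
      also have "\<dots> \<le> A ^ ?k" using A1 s by (intro self_le_power) auto
      finally show "weight p * L\<^sup>2 \<le> A ^ ?k" .
    qed (use Q s A1 L1 in auto)
    also have "\<dots> = (A * (4 * L\<^sup>2) * Q) ^ ?k * m ?k" by (simp add: power_mult_distrib)
    finally show "\<bar>pds D is (pev p) x\<bar> \<le> (A * (4 * L\<^sup>2) * Q) ^ ?k * m ?k" .
  qed
qed

lemma pds_cong:
  assumes "set is \<subseteq> {..<d}" "\<And>y. y \<in> S \<Longrightarrow> u y = v y" "x \<in> S"
  shows "pds S is u x = pds S is v x"
  using assms(3)
proof (induction "is" arbitrary: x)
  case (Cons i "is")
  have "pd S i (pds S is u) x = pd S i (pds S is v) x"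
    by (rule pd_cong) (use Cons in auto)
  then show ?case by (simp add: pds_def)
qed (simp add: pds_def assms)

lemma smooth_cong:
  assumes "smooth d S u" "\<And>y. y \<in> S \<Longrightarrow> u y = v y"
  shows "smooth d S v"
  unfolding smooth_def
proof (intro allI impI conjI ballI)
  fix "is" :: "nat list" assume s: "set is \<subseteq> {..<d}"
  have eq: "pds S is u x = pds S is v x" if "x \<in> S" for x
    by (rule pds_cong[OF s assms(2) that])
  show "continuous_on S (pds S is v)"
    using assms(1) s eq unfolding smooth_def by (metis continuous_on_cong)
  fix x i assume x: "x \<in> S" "i < d"
  then obtain D where D: "((\<lambda>t. pds S is u (x(i := t))) has_real_derivative D)
      (at (x i) within {t. x(i := t) \<in> S})"
    using assms(1) s unfolding smooth_def real_differentiable_def by blast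
  have "((\<lambda>t. pds S is v (x(i := t))) has_real_derivative D) (at (x i) within {t. x(i := t) \<in> S})"
    by (rule has_field_derivative_transform_within[OF D, of 1]) (use eq x in auto)
  then show "(\<lambda>t. pds S is v (x(i := t))) differentiable (at (x i) within {t. x(i := t) \<in> S})"
    using real_differentiable_def by blast
qed

lemma carleman_cong:
  assumes u: "carleman m d V u" and eq: "\<And>y. y \<in> V \<Longrightarrow> u y = v y"
  shows "carleman m d V v"
  unfolding carleman_def
proof (intro allI impI)
  fix D K assume DK: "openin (top_of_set V) D \<and> D \<subseteq> K \<and> K \<subseteq> V \<and> compact K"
  then have c: "carleman_on m d D u" using u unfolding carleman_def by blast
  have eqD: "\<And>y. y \<in> D \<Longrightarrow> u y = v y" using DK eq by blast
  have "pds D is v x = pds D is u x" if "set is \<subseteq> {..<d}" "x \<in> D" for "is" x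
    using pds_cong[OF that(1) eqD that(2)] by simp
  then show "carleman_on m d D v"
    using c smooth_cong[of d D u v] eqD unfolding carleman_on_def by (metis (no_types, lifting))
qed

section \<open>The surface\<close>

text \<open>
  The closed half-plane is its own coordinate domain. With a single chart, transition maps and the
  transformation law of covectors are trivial, and all of the geometry sits in the metric.
\<close>

definition chart0 :: "(nat \<Rightarrow> real) chart" where
  "chart0 = (halfspace 2, \<lambda>p. p)"

definition hemi_cover :: "(nat \<Rightarrow> real) rmanifold" where
  "hemi_cover = \<lparr>mdim = 2, mtop = top_of_set (halfspace 2), atlas = {chart0},
     gmet = (\<lambda>c i j x. if i = j then (inverse (conf x))\<^sup>2 else 0)\<rparr>"

lemma hemi_cover_simps [simp]:
  "mdim hemi_cover = 2" "mtop hemi_cover = top_of_set (halfspace 2)" "atlas hemi_cover = {chart0}"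
  "gmet hemi_cover c i j x = (if i = j then (inverse (conf x))\<^sup>2 else 0)"
  "fst chart0 = halfspace 2" "snd chart0 = (\<lambda>p. p)"
  by (auto simp: hemi_cover_def chart0_def)

lemma halfspace2: "halfspace 2 = {x. (\<forall>i\<ge>2. x i = 0) \<and> x 1 \<ge> 0}"
  by (auto simp: halfspace_def topspace_Euclidean_space)

lemma trans_dom0: "trans_dom chart0 chart0 = halfspace 2"
  by (simp add: trans_dom_def)

lemma trans_map0: "x \<in> halfspace 2 \<Longrightarrow> trans_map chart0 chart0 x = x"
  using inv_into_f_f[of "\<lambda>p. p" "halfspace 2" x] by (simp add: trans_map_def)

lemma less_2: "i < (2::nat) \<Longrightarrow> i = 0 \<or> i = 1" by linarith

lemma sum_2: "(\<Sum>i<(2::nat). f i) = f 0 + f 1"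
  by (simp add: numeral_2_eq_2)

lemma all_2: "(\<forall>i<(2::nat). P i) \<longleftrightarrow> P 0 \<and> P 1" using less_2 by auto

lemma ex_2: "(\<exists>i<(2::nat). P i) \<longleftrightarrow> P 0 \<or> P 1"
  using all_2[of "\<lambda>i. \<not> P i"] by blast

lemma upward_halfspace: "upward 2 (halfspace 2)"
  by (rule upward_openin_halfspace) simp

lemma jac0:
  assumes "x \<in> halfspace 2" "i < 2" "k < 2"
  shows "jac chart0 chart0 x i k = (if i = k then 1 else 0)"
proof -
  have "pd (halfspace 2) k (\<lambda>y. trans_map chart0 chart0 y i) x = pd (halfspace 2) k (\<lambda>y. y i) x"
    by (rule pd_cong) (use assms in \<open>auto simp: trans_map0\<close>)
  also have "\<dots> = (if i = k then 1 else 0)"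
    by (rule pd_eqI[OF upward_halfspace assms(1,3)]) (auto intro!: derivative_eq_intros)
  finally show ?thesis by (simp add: jac_def trans_dom0)
qed

lemma second_countable_euclidean:
  "second_countable (euclidean :: 'a::second_countable_topology topology)"
proof -
  obtain B :: "'a set set" where B: "countable B" "\<And>C. C \<in> B \<Longrightarrow> open C"
    "\<And>S. open S \<Longrightarrow> \<exists>U. U \<subseteq> B \<and> S = \<Union>U"
    by (metis univ_second_countable)
  have "\<exists>V\<in>B. x \<in> V \<and> V \<subseteq> U" if "open U" "x \<in> U" for U x
    using B(3)[OF that(1)] that(2) by blast
  then show ?thesis unfolding second_countable_def using B(1,2) by auto
qed

lemma connected_halfspace: "connected (halfspace 2)"
proof -
  let ?f = "\<lambda>p::real \<times> real. \<lambda>i::nat. if i = 0 then fst p else if i = 1 then snd p else 0"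
  have "continuous_on (UNIV \<times> {0..}) ?f"
  proof (rule continuous_on_coordinatewise_then_product)
    fix i show "continuous_on (UNIV \<times> {0..}) (\<lambda>p. ?f p i)"
      by (cases "i = 0"; cases "i = 1") (auto intro!: continuous_intros)
  qed
  moreover have "connected (UNIV \<times> {0..} :: (real \<times> real) set)"
    by (intro convex_connected convex_Times) auto
  ultimately have "connected (?f ` (UNIV \<times> {0..}))" by (rule connected_continuous_image)
  moreover have "?f ` (UNIV \<times> {0..}) = halfspace 2"
  proof (intro set_eqI iffI)
    fix x assume x: "x \<in> halfspace 2"
    have "x = ?f (x 0, x 1)" using x by (auto simp: halfspace2 fun_eq_iff)
    then show "x \<in> ?f ` (UNIV \<times> {0..})" using x by (intro image_eqI) (auto simp: halfspace2)
  qed (auto simp: halfspace2)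
  ultimately show ?thesis by simp
qed

lemma riemannian_hemi_cover:
  assumes m: "carleman_weight m"
  shows "riemannian_carleman_manifold m hemi_cover"
proof -
  have coordf: "carleman m 2 (halfspace 2) (\<lambda>x. trans_map chart0 chart0 x i)" if "i < 2" for i
  proof (rule carleman_cong)
    show "carleman m 2 (halfspace 2) (pev [(1, [if i = 0 then GX else GY])])"
      by (rule carleman_pev[OF m]) (auto simp: deg_le_def)
  qed (use less_2[OF that] in \<open>auto simp: trans_map0\<close>)
  have met: "carleman m 2 (halfspace 2) (gmet hemi_cover chart0 i j)" for i j
  proof (rule carleman_cong)
    show "carleman m 2 (halfspace 2) (pev (if i = j then [(1, [GInv, GInv])] else []))"
      by (rule carleman_pev[OF m]) (auto simp: deg_le_def)
  qed (auto simp: power2_eq_square)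
  have "carleman_manifold m hemi_cover"
    unfolding carleman_manifold_def
    using coordf connected_halfspace
    by (auto simp: trans_dom0 Hausdorff_space_subtopology second_countable_subtopology
        second_countable_euclidean connected_space_subtopology homeomorphic_map_id[unfolded id_def]
        openin_subtopology_self subtopology_subtopology)
  moreover have "carleman_metric m hemi_cover"
    unfolding carleman_metric_def
  proof (intro conjI ballI)
    fix c x assume c: "c \<in> atlas hemi_cover"
    show "\<forall>v. (\<exists>i<mdim hemi_cover. v i \<noteq> 0) \<longrightarrow>
           0 < (\<Sum>i<mdim hemi_cover. \<Sum>j<mdim hemi_cover. gmet hemi_cover c i j x * v i * v j)"
    proof (intro allI impI)
      fix v :: "nat \<Rightarrow> real" assume "\<exists>i<mdim hemi_cover. v i \<noteq> 0"
      then have "(v 0)\<^sup>2 + (v 1)\<^sup>2 > 0" by (auto simp: ex_2 sum_power2_gt_zero_iff)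
      then have "(inverse (conf x))\<^sup>2 * ((v 0)\<^sup>2 + (v 1)\<^sup>2) > 0"
        using conf_pos[of x] by (intro mult_pos_pos) auto
      then show "0 < (\<Sum>i<mdim hemi_cover. \<Sum>j<mdim hemi_cover. gmet hemi_cover c i j x * v i * v j)"
        by (simp add: sum_2 power2_eq_square algebra_simps)
    qed
  qed (use met in \<open>auto simp: trans_dom0 jac0 trans_map0 sum_2 all_2\<close>)
  ultimately show ?thesis by (simp add: riemannian_carleman_manifold_def)
qed

lemma mboundary_hemi_cover: "mboundary hemi_cover = {p \<in> halfspace 2. p 1 = 0}"
  by (auto simp: mboundary_def)

section \<open>Covectors and the Hamiltonian\<close>

text \<open>
  From here on \<open>\<zeta> = (x, y, \<xi>\<^sub>x, \<xi>\<^sub>y)\<close>, with indices \<open>0\<close> to \<open>3\<close>, are the coordinates of a covector.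
\<close>

definition nrm :: "(nat \<Rightarrow> real) \<Rightarrow> real" where
  "nrm \<zeta> = sqrt ((\<zeta> 2)\<^sup>2 + (\<zeta> 3)\<^sup>2)"

definition Ph :: "(nat \<Rightarrow> real) set" where
  "Ph = {\<zeta> \<in> rspace 4. \<zeta> 1 \<ge> 0 \<and> (\<zeta> 2 \<noteq> 0 \<or> \<zeta> 3 \<noteq> 0)}"

lemmas nat2 = numeral_2_eq_2[symmetric]

lemma base_halfspace: "base 2 \<zeta> \<in> halfspace 2 \<longleftrightarrow> \<zeta> 1 \<ge> 0"
  by (auto simp: base_def halfspace2)

lemma phase_hemi_cover: "phase hemi_cover chart0 = Ph"
  by (auto simp: phase_def Ph_def base_halfspace ex_2 nat2)

text \<open>
  The inverse of the coordinate map on the cotangent bundle.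
\<close>

definition lift :: "(nat \<Rightarrow> real) \<Rightarrow> (nat \<Rightarrow> real) copoint" where
  "lift \<zeta> = (base 2 \<zeta>, \<lambda>c. if c = chart0 then (\<lambda>i. if i < 2 then \<zeta> (2 + i) else 0) else (\<lambda>_. 0))"

lemma fst_lift: "fst (lift \<zeta>) = base 2 \<zeta>" by (simp add: lift_def)

lemma coord_lift: "\<zeta> \<in> rspace 4 \<Longrightarrow> coord hemi_cover chart0 (lift \<zeta>) = \<zeta>"
  by (auto simp: coord_def lift_def base_def topspace_Euclidean_space fun_eq_iff simp flip: add_2_eq_Suc)

lemma covector_hemi_cover: "p \<in> halfspace 2 \<Longrightarrow>
    covector_at hemi_cover p w \<longleftrightarrow> (w chart0 \<in> rspace 2 \<and> (\<forall>c. c \<noteq> chart0 \<longrightarrow> w c = (\<lambda>_. 0)))"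
  by (auto simp: covector_at_def all_2 sum_2 jac0 topspace_Euclidean_space simp del: split_paired_All)
     metis

lemma lift_cotan: "\<zeta> \<in> Ph \<Longrightarrow> lift \<zeta> \<in> cotan' hemi_cover"
proof -
  assume z: "\<zeta> \<in> Ph"
  have b: "base 2 \<zeta> \<in> halfspace 2" using z by (simp add: Ph_def base_halfspace)
  have "snd (lift \<zeta>) chart0 \<noteq> (\<lambda>_. 0)"
  proof
    assume "snd (lift \<zeta>) chart0 = (\<lambda>_. 0)"
    from fun_cong[OF this, of 0] fun_cong[OF this, of 1] z show False
      by (simp add: lift_def Ph_def eval_nat_numeral)
  qed
  moreover have "covector_at hemi_cover (base 2 \<zeta>) (snd (lift \<zeta>))"
    using b by (auto simp: covector_hemi_cover lift_def topspace_Euclidean_space)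
  ultimately show ?thesis using b unfolding cotan'_def
    by (auto simp: fst_lift prod.case_eq_if intro: exI[of _ chart0] simp del: split_paired_Ex)
qed

lemma coord_Ph: "z \<in> cotan' hemi_cover \<Longrightarrow> coord hemi_cover chart0 z \<in> Ph"
proof -
  assume z: "z \<in> cotan' hemi_cover"
  then have p: "fst z \<in> halfspace 2" and w: "covector_at hemi_cover (fst z) (snd z)"
    and n: "\<exists>c. snd z c \<noteq> (\<lambda>_. 0)" by (auto simp: cotan'_def)
  have r: "snd z chart0 \<in> rspace 2" and "\<forall>c. c \<noteq> chart0 \<longrightarrow> snd z c = (\<lambda>_. 0)"
    using w covector_hemi_cover[OF p] by auto
  then have n: "snd z chart0 \<noteq> (\<lambda>_. 0)" using n by metis
  have "snd z chart0 0 \<noteq> 0 \<or> snd z chart0 1 \<noteq> 0"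
  proof (rule ccontr)
    assume "\<not> ?thesis"
    then have "snd z chart0 i = 0" for i
      using r by (cases "i = 0"; cases "i = 1") (auto simp: topspace_Euclidean_space)
    then show False using n by auto
  qed
  then show ?thesis using p by (auto simp: Ph_def coord_def halfspace2 topspace_Euclidean_space)
qed

lemma lift_coord: "z \<in> cotan' hemi_cover \<Longrightarrow> lift (coord hemi_cover chart0 z) = z"
proof -
  assume z: "z \<in> cotan' hemi_cover"
  obtain p w where pw: "z = (p, w)" by (cases z)
  have p: "p \<in> halfspace 2" and w: "covector_at hemi_cover p w" using z pw by (auto simp: cotan'_def)
  have r: "w chart0 \<in> rspace 2" and o: "\<And>c. c \<noteq> chart0 \<Longrightarrow> w c = (\<lambda>_. 0)"
    using w covector_hemi_cover[OF p] by auto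
  have "base 2 (coord hemi_cover chart0 z) = p"
    using p by (auto simp: base_def coord_def pw halfspace2 fun_eq_iff)
  moreover have "snd (lift (coord hemi_cover chart0 z)) = w"
  proof
    fix c show "snd (lift (coord hemi_cover chart0 z)) c = w c"
      using r o[of c] by (auto simp: coord_def lift_def pw fun_eq_iff topspace_Euclidean_space)
  qed
  ultimately show ?thesis by (simp add: pw prod_eq_iff fst_lift)
qed

lemma lift_boundary: "\<zeta> \<in> Ph \<Longrightarrow> fst (lift \<zeta>) \<in> mboundary hemi_cover \<longleftrightarrow> \<zeta> 1 = 0"
  by (auto simp: mboundary_hemi_cover lift_def base_def halfspace2 Ph_def)

lemma conf_base: "conf (base 2 \<zeta>) = conf \<zeta>" by (simp add: conf_def base_def)

lemma ham_hemi_cover: "ham hemi_cover chart0 = (\<lambda>\<zeta>. conf \<zeta> * nrm \<zeta>)"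
proof
  fix \<zeta>
  define a where "a k l = gmet hemi_cover chart0 k l (base (mdim hemi_cover) \<zeta>)" for k l
  define b where "b = inv_coeffs 2 a"
  define q where "q = (inverse (conf \<zeta>))\<^sup>2"
  have q: "q * (conf \<zeta>)\<^sup>2 = 1" using conf_pos[of \<zeta>] by (simp add: q_def field_simps)
  have a: "a k l = (if k = l then q else 0)" for k l
    by (simp add: a_def q_def conf_base)
  let ?P = "\<lambda>b. \<forall>i<2. \<forall>k<2. (\<Sum>j<(2::nat). a i j * b j k) = (if i = k then 1 else 0)"
  have "?P (\<lambda>j k. if j = k then (conf \<zeta>)\<^sup>2 else 0)"
    using q by (simp add: all_2 sum_2 a)
  then have "?P b" unfolding b_def inv_coeffs_def by (rule someI[of ?P])
  then have "q * b 0 0 = 1" "q * b 0 1 = 0" "q * b 1 0 = 0" "q * b 1 1 = 1"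
    by (simp_all add: all_2 sum_2 a)
  then have b: "b 0 0 = (conf \<zeta>)\<^sup>2" "b 0 1 = 0" "b 1 0 = 0" "b 1 1 = (conf \<zeta>)\<^sup>2"
    using q by (algebra, auto, algebra)
  have "ham hemi_cover chart0 \<zeta> = sqrt (\<Sum>i<2. \<Sum>j<2. b i j * \<zeta> (2 + i) * \<zeta> (2 + j))"
    unfolding ham_def b_def a_def by simp
  also have "\<dots> = sqrt ((conf \<zeta>)\<^sup>2 * ((\<zeta> 2)\<^sup>2 + (\<zeta> 3)\<^sup>2))"
    using b by (simp add: sum_2 power2_eq_square distrib_left mult.assoc nat2)
  finally show "ham hemi_cover chart0 \<zeta> = conf \<zeta> * nrm \<zeta>"
    using conf_pos[of \<zeta>] by (simp add: real_sqrt_mult nrm_def)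
qed

lemma nrm_pos: "\<zeta> \<in> Ph \<Longrightarrow> nrm \<zeta> > 0"
  by (auto simp: Ph_def nrm_def sum_power2_gt_zero_iff)

lemma nrm_pos': "\<zeta> 2 \<noteq> 0 \<or> \<zeta> 3 \<noteq> 0 \<Longrightarrow> nrm \<zeta> > 0"
  by (auto simp: nrm_def sum_power2_gt_zero_iff)

lemma nrm_sq: "(nrm \<zeta>)\<^sup>2 = (\<zeta> 2)\<^sup>2 + (\<zeta> 3)\<^sup>2"
  by (simp add: nrm_def)

lemma upward_Ph: "upward 4 Ph"
  unfolding upward_def
proof (intro ballI allI impI)
  fix x i assume x: "x \<in> Ph" and i: "i < (4::nat)"
  let ?e = "if x i = 0 then 1 else \<bar>x i\<bar>"
  have "\<forall>t. x i < t \<and> t < x i + ?e \<longrightarrow> x(i := t) \<in> Ph"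
    using x i by (auto simp: Ph_def topspace_Euclidean_space split: if_splits)
  then show "\<exists>e>0. \<forall>t. x i < t \<and> t < x i + e \<longrightarrow> x(i := t) \<in> Ph"
    by (intro exI[of _ ?e]) auto
qed

lemma nrm_deriv:
  assumes "nrm \<zeta> > 0" "i = 2 \<or> i = 3"
  shows "((\<lambda>t. nrm (\<zeta>(i := t))) has_real_derivative \<zeta> i / nrm \<zeta>) (at (\<zeta> i))"
proof -
  have pos: "(\<zeta> 2)\<^sup>2 + (\<zeta> 3)\<^sup>2 > 0" using assms(1) by (simp add: nrm_def)
  have sq: "((\<lambda>t. (nrm (\<zeta>(i := t)))\<^sup>2) has_real_derivative 2 * \<zeta> i) (at (\<zeta> i))"
    using assms(2) by (auto simp: nrm_sq intro!: derivative_eq_intros)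
  have "((\<lambda>t. sqrt ((nrm (\<zeta>(i := t)))\<^sup>2)) has_real_derivative
      inverse (sqrt ((nrm (\<zeta>(i := \<zeta> i)))\<^sup>2)) / 2 * (2 * \<zeta> i)) (at (\<zeta> i))"
    by (rule DERIV_chain2[OF DERIV_real_sqrt sq]) (use assms(1) in \<open>simp add: fun_upd_triv\<close>)
  moreover have "sqrt ((nrm \<xi>)\<^sup>2) = nrm \<xi>" for \<xi> by (simp add: nrm_def)
  moreover have "inverse (nrm \<zeta>) / 2 * (2 * \<zeta> i) = \<zeta> i / nrm \<zeta>"
    by (simp add: divide_simps)
  ultimately show ?thesis by (simp del: fun_upd_apply add: fun_upd_triv)
qed

lemma conf_deriv:
  "((\<lambda>t. conf (\<zeta>(0 := t))) has_real_derivative cb * sin (\<zeta> 0)) (at (\<zeta> 0))"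
  "((\<lambda>t. conf (\<zeta>(1 := t))) has_real_derivative ca * sinh (\<zeta> 1)) (at (\<zeta> 1))"
  by (auto simp: conf_def intro!: derivative_eq_intros)

lemma ham_deriv:
  assumes z: "\<zeta> \<in> Ph"
  shows "ham_xi hemi_cover chart0 0 \<zeta> = conf \<zeta> * \<zeta> 2 / nrm \<zeta>"
    and "ham_xi hemi_cover chart0 1 \<zeta> = conf \<zeta> * \<zeta> 3 / nrm \<zeta>"
    and "ham_x hemi_cover chart0 0 \<zeta> = cb * sin (\<zeta> 0) * nrm \<zeta>"
    and "ham_x hemi_cover chart0 1 \<zeta> = ca * sinh (\<zeta> 1) * nrm \<zeta>"
proof -
  note n = nrm_pos[OF z]
  have xi: "pd Ph i (\<lambda>\<zeta>. conf \<zeta> * nrm \<zeta>) \<zeta> = conf \<zeta> * \<zeta> i / nrm \<zeta>" if "i = 2 \<or> i = 3" for i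
  proof (rule pd_eqI[OF upward_Ph z])
    have "conf (\<zeta>(i := t)) = conf \<zeta>" for t using that by (auto simp: conf_def)
    note eq = this
    show "((\<lambda>t. conf (\<zeta>(i := t)) * nrm (\<zeta>(i := t))) has_real_derivative conf \<zeta> * \<zeta> i / nrm \<zeta>)
        (at (\<zeta> i) within {t. \<zeta>(i := t) \<in> Ph})"
      by (rule has_field_derivative_at_within)
         (use DERIV_cmult[OF nrm_deriv[OF n that], of "conf \<zeta>"] eq in \<open>simp del: fun_upd_apply\<close>)
  qed (use that in auto)
  show "ham_xi hemi_cover chart0 0 \<zeta> = conf \<zeta> * \<zeta> 2 / nrm \<zeta>"
    using xi[of 2] by (simp add: ham_xi_def ham_hemi_cover phase_hemi_cover nat2)
  show "ham_xi hemi_cover chart0 1 \<zeta> = conf \<zeta> * \<zeta> 3 / nrm \<zeta>"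
    using xi[of 3] by (simp add: ham_xi_def ham_hemi_cover phase_hemi_cover)
  have x: "pd Ph i (\<lambda>\<zeta>. conf \<zeta> * nrm \<zeta>) \<zeta> = D * nrm \<zeta>"
    if "i = 0 \<or> i = 1" "((\<lambda>t. conf (\<zeta>(i := t))) has_real_derivative D) (at (\<zeta> i))" for i D
  proof (rule pd_eqI[OF upward_Ph z])
    have "nrm (\<zeta>(i := t)) = nrm \<zeta>" for t using that by (auto simp: nrm_def)
    note eq = this
    show "((\<lambda>t. conf (\<zeta>(i := t)) * nrm (\<zeta>(i := t))) has_real_derivative D * nrm \<zeta>)
        (at (\<zeta> i) within {t. \<zeta>(i := t) \<in> Ph})"
      by (rule has_field_derivative_at_within)
         (use DERIV_cmult_right[OF that(2), of "nrm \<zeta>"] eq in \<open>simp add: mult.commute del: fun_upd_apply\<close>)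
  qed (use that in auto)
  show "ham_x hemi_cover chart0 0 \<zeta> = cb * sin (\<zeta> 0) * nrm \<zeta>"
    using x[OF _ conf_deriv(1)] by (simp add: ham_x_def ham_hemi_cover phase_hemi_cover)
  show "ham_x hemi_cover chart0 1 \<zeta> = ca * sinh (\<zeta> 1) * nrm \<zeta>"
    using x[OF _ conf_deriv(2)] by (simp add: ham_x_def ham_hemi_cover phase_hemi_cover)
qed

lemma bdry_phase_hemi_cover: "bdry_phase hemi_cover chart0 = {\<zeta> \<in> Ph. \<zeta> 1 = 0 \<and> \<zeta> 2 \<noteq> 0}"
  by (auto simp: bdry_phase_def phase_hemi_cover nat2)

section \<open>Convexity of the billiard\<close>

text \<open>
  The metric is conformal, so on a fibre the Hamiltonian is a constant times \<open>\<surd>(\<xi>\<^sub>x\<^sup>2 + t\<^sup>2)\<close>, which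
  increases strictly with \<open>\<bar>t\<bar>\<close>. The stationary point is therefore the covector tangent to the boundary.
\<close>

lemma local_min_ham:
  assumes "\<zeta> 2 \<noteq> 0"
  shows "local_min (\<lambda>t. ham hemi_cover chart0 (\<zeta>(3 := t))) s \<longleftrightarrow> s = 0"
proof
  have less: "ham hemi_cover chart0 (\<zeta>(3 := t)) < ham hemi_cover chart0 (\<zeta>(3 := s))" if "\<bar>t\<bar> < \<bar>s\<bar>" for s t
  proof -
    have "t\<^sup>2 < s\<^sup>2" using that by (metis abs_ge_zero power2_abs power_strict_mono zero_less_numeral)
    then have "nrm (\<zeta>(3 := t)) < nrm (\<zeta>(3 := s))" by (simp add: nrm_def)
    moreover have "conf (\<zeta>(3 := t)) = conf (\<zeta>(3 := s))" by (simp add: conf_def)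
    ultimately show ?thesis using conf_pos[of "\<zeta>(3 := s)"] by (simp add: ham_hemi_cover)
  qed
  assume "local_min (\<lambda>t. ham hemi_cover chart0 (\<zeta>(3 := t))) s"
  then obtain e where e: "e > 0"
    "\<And>t. \<bar>t - s\<bar> < e \<Longrightarrow> ham hemi_cover chart0 (\<zeta>(3 := s)) \<le> ham hemi_cover chart0 (\<zeta>(3 := t))"
    unfolding local_min_def by blast
  show "s = 0"
  proof (rule ccontr)
    assume s: "s \<noteq> 0"
    define q where "q = min (1/2) (e / (2 * \<bar>s\<bar>))"
    have q: "0 < q" "q < 1" "q * \<bar>s\<bar> < e"
      using s e(1) by (auto simp: q_def min_def field_simps)
    define t where "t = (1 - q) * s"
    have "\<bar>t - s\<bar> < e" using q by (simp add: t_def algebra_simps abs_mult)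
    moreover have "\<bar>t\<bar> < \<bar>s\<bar>" using q s by (simp add: t_def abs_mult)
    ultimately show False using e(2) less by (meson not_le)
  qed
next
  assume s: "s = 0"
  have "ham hemi_cover chart0 (\<zeta>(3 := 0)) \<le> ham hemi_cover chart0 (\<zeta>(3 := t))" for t
  proof -
    have "nrm (\<zeta>(3 := 0)) \<le> nrm (\<zeta>(3 := t))" by (simp add: nrm_def)
    moreover have "conf (\<zeta>(3 := 0)) = conf (\<zeta>(3 := t))" by (simp add: conf_def)
    ultimately show ?thesis using conf_pos[of "\<zeta>(3 := t)"] by (simp add: ham_hemi_cover)
  qed
  then show "local_min (\<lambda>t. ham hemi_cover chart0 (\<zeta>(3 := t))) s"
    unfolding local_min_def s by (intro exI[of _ 1]) auto
qed

lemma ham_xi_deriv: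
  assumes z: "\<zeta> \<in> Ph" and "\<zeta> 1 = 0" "\<zeta> 3 = 0"
  shows "pd Ph 0 (ham_xi hemi_cover chart0 1) \<zeta> = 0"
    and "pd Ph 1 (ham_xi hemi_cover chart0 1) \<zeta> = 0"
    and "pd Ph 3 (ham_xi hemi_cover chart0 1) \<zeta> = conf \<zeta> / nrm \<zeta>"
    and "pd Ph 2 (ham_xi hemi_cover chart0 1) \<zeta> = 0"
proof -
  have eq: "pd Ph i (ham_xi hemi_cover chart0 1) \<zeta> = pd Ph i (\<lambda>\<zeta>. conf \<zeta> * \<zeta> 3 / nrm \<zeta>) \<zeta>" for i
    by (rule pd_cong[OF z]) (rule ham_deriv(2))
  have z2: "\<zeta> 2 \<noteq> 0" using z assms(3) by (auto simp: Ph_def)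
  show "pd Ph 0 (ham_xi hemi_cover chart0 1) \<zeta> = 0"
    unfolding eq
    by (rule pd_eqI[OF upward_Ph z]) (use z2 assms in \<open>auto simp: nrm_def\<close>)
  show "pd Ph 1 (ham_xi hemi_cover chart0 1) \<zeta> = 0"
    unfolding eq
    by (rule pd_eqI[OF upward_Ph z]) (use z2 assms in \<open>auto simp: nrm_def\<close>)
  show "pd Ph 2 (ham_xi hemi_cover chart0 1) \<zeta> = 0"
    unfolding eq
    by (rule pd_eqI[OF upward_Ph z]) (use z2 assms in \<open>auto simp: nrm_def\<close>)
  show "pd Ph 3 (ham_xi hemi_cover chart0 1) \<zeta> = conf \<zeta> / nrm \<zeta>"
    unfolding eq
  proof (rule pd_eqI[OF upward_Ph z])
    have c: "conf (\<zeta>(3 := t)) = conf \<zeta>" for t by (simp add: conf_def)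
    have "((\<lambda>t. t / nrm (\<zeta>(3 := t))) has_real_derivative
        (1 * nrm \<zeta> - \<zeta> 3 * (\<zeta> 3 / nrm \<zeta>)) / (nrm \<zeta> * nrm \<zeta>)) (at (\<zeta> 3))"
      using DERIV_divide[OF DERIV_ident nrm_deriv[OF nrm_pos[OF z], of 3]] nrm_pos[OF z]
      by (simp del: fun_upd_apply add: fun_upd_triv)
    note D = DERIV_cmult[OF this, of "conf \<zeta>"]
    show "((\<lambda>t. conf (\<zeta>(3 := t)) * (\<zeta>(3 := t)) 3 / nrm (\<zeta>(3 := t))) has_real_derivative
        conf \<zeta> / nrm \<zeta>) (at (\<zeta> 3) within {t. \<zeta>(3 := t) \<in> Ph})"
      by (rule has_field_derivative_at_within)
         (use D assms nrm_pos[OF z] c in \<open>simp del: fun_upd_apply add: fun_upd_same\<close>)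
  qed auto
qed

text \<open>
  The formula for \<open>conf\<close> is even in \<open>y\<close>. Hence its \<open>y\<close>-derivative vanishes on the boundary, where
  \<open>\<partial>h / \<partial>y\<close> is the only factor in the Poisson bracket that meets the nonzero derivative
  \<open>\<partial>\<^sup>2h / \<partial>\<xi>\<^sub>y\<^sup>2\<close>; all other terms contain \<open>\<xi>\<^sub>y = 0\<close>.
\<close>

lemma convex_hemi_cover:
  "convex_billiard hemi_cover \<and> (\<forall>c\<in>atlas hemi_cover. \<forall>\<zeta>\<in>bdry_phase hemi_cover c. ham_curvature hemi_cover c \<zeta> = 0)"
proof -
  have st: "st_point hemi_cover chart0 \<zeta> = \<zeta>(3 := 0)" if "\<zeta> \<in> bdry_phase hemi_cover chart0" for \<zeta>
    using that by (simp add: st_point_def bdry_phase_hemi_cover local_min_ham)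
  have stP: "\<zeta>(3 := 0) \<in> Ph" if "\<zeta> \<in> bdry_phase hemi_cover chart0" for \<zeta>
    using that by (auto simp: bdry_phase_hemi_cover Ph_def topspace_Euclidean_space)
  have curv: "ham_curvature hemi_cover chart0 \<zeta> = 0" if b: "\<zeta> \<in> bdry_phase hemi_cover chart0" for \<zeta>
  proof -
    let ?s = "\<zeta>(3 := 0)"
    have s: "?s 1 = 0" "?s 3 = 0" using b by (auto simp: bdry_phase_hemi_cover)
    note d = ham_xi_deriv[OF stP[OF b] s]
    note h = ham_deriv[OF stP[OF b], unfolded ham_xi_def ham_x_def phase_hemi_cover]
    have "pd Ph 1 (ham hemi_cover chart0) ?s = 0" using h(4) s by simp
    then show ?thesis
      using d s by (simp add: ham_curvature_def poisson_def phase_hemi_cover st[OF b] sum_2 nat2 del: fun_upd_apply)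
  qed
  have "simple_reflection hemi_cover"
    by (auto simp: simple_reflection_def bdry_phase_hemi_cover local_min_ham)
  moreover have "pds (phase hemi_cover chart0) [2 * mdim hemi_cover - 1, 2 * mdim hemi_cover - 1] (ham hemi_cover chart0)
      (st_point hemi_cover chart0 \<zeta>) \<noteq> 0" if b: "\<zeta> \<in> bdry_phase hemi_cover chart0" for \<zeta>
  proof -
    let ?s = "\<zeta>(3 := 0)"
    have s: "?s 1 = 0" "?s 3 = 0" using b by (auto simp: bdry_phase_hemi_cover)
    have "pds (phase hemi_cover chart0) [2 * mdim hemi_cover - 1, 2 * mdim hemi_cover - 1] (ham hemi_cover chart0) ?s =
        pd Ph 3 (ham_xi hemi_cover chart0 1) ?s"
      by (simp add: pds_def phase_hemi_cover ham_xi_def)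
    also have "\<dots> = conf ?s / nrm ?s" by (rule ham_xi_deriv(3)[OF stP[OF b] s])
    finally show ?thesis
      using conf_pos[of ?s] nrm_pos[OF stP[OF b]] by (simp add: st[OF b])
  qed
  ultimately show ?thesis
    using curv by (simp add: convex_billiard_def strong_simple_reflection_def)
qed

section \<open>The flow as motion on the unit sphere\<close>

definition hm :: "(nat \<Rightarrow> real) \<Rightarrow> real" where
  "hm \<zeta> = conf \<zeta> * nrm \<zeta>"

text \<open>
  \<open>(Xr, Xv, Xs)\<close> is the point of the unit sphere in \<open>\<real>\<^sup>3\<close> that lies below \<open>(x, y)\<close>, and the boundary is
  mapped to the equator \<open>Xs = 0\<close>. The functions \<open>Pr\<close>, \<open>Pv\<close> and \<open>Ps\<close> are the components of the unit
  velocity with which this point moves along the Hamiltonian flow.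
\<close>

definition Xr :: "(nat \<Rightarrow> real) \<Rightarrow> real" where
  "Xr \<zeta> = (ca * cos (\<zeta> 0) - cb * cosh (\<zeta> 1)) / conf \<zeta>"

definition Xv :: "(nat \<Rightarrow> real) \<Rightarrow> real" where
  "Xv \<zeta> = sin (\<zeta> 0) / conf \<zeta>"

definition Xs :: "(nat \<Rightarrow> real) \<Rightarrow> real" where
  "Xs \<zeta> = sinh (\<zeta> 1) / conf \<zeta>"

definition Pr :: "(nat \<Rightarrow> real) \<Rightarrow> real" where
  "Pr \<zeta> = - (sin (\<zeta> 0) * cosh (\<zeta> 1) * \<zeta> 2 + cos (\<zeta> 0) * sinh (\<zeta> 1) * \<zeta> 3) / hm \<zeta>"

definition Pv :: "(nat \<Rightarrow> real) \<Rightarrow> real" where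
  "Pv \<zeta> = ((ca * cosh (\<zeta> 1) * cos (\<zeta> 0) - cb) * \<zeta> 2 - ca * sin (\<zeta> 0) * sinh (\<zeta> 1) * \<zeta> 3) / hm \<zeta>"

definition Ps :: "(nat \<Rightarrow> real) \<Rightarrow> real" where
  "Ps \<zeta> = ((ca - cb * cos (\<zeta> 0) * cosh (\<zeta> 1)) * \<zeta> 3 - cb * sinh (\<zeta> 1) * sin (\<zeta> 0) * \<zeta> 2) / hm \<zeta>"

text \<open>
  The rate of change of the polar angle of the plane vector \<open>(ca * r + cb, v)\<close> when \<open>(r, v)\<close> moves with
  velocity \<open>(p, q)\<close>. That vector points from the removed point to \<open>(r, v)\<close>, stretched by \<open>ca\<close> in the first
  direction.
\<close>

definition angvel :: "real \<Rightarrow> real \<Rightarrow> real \<Rightarrow> real \<Rightarrow> real" where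
  "angvel r v p q = ((ca * r + cb) * q - ca * v * p) / ((ca * r + cb)\<^sup>2 + v\<^sup>2)"

lemma hm_pos: "\<zeta> \<in> Ph \<Longrightarrow> hm \<zeta> > 0"
  using conf_pos nrm_pos by (simp add: hm_def)

lemma trig_rels:
  fixes \<zeta> :: "nat \<Rightarrow> real"
  shows "(sin (\<zeta> 0))\<^sup>2 + (cos (\<zeta> 0))\<^sup>2 = 1" "(cosh (\<zeta> 1))\<^sup>2 = (sinh (\<zeta> 1))\<^sup>2 + 1"
    "conf \<zeta> = ca * cosh (\<zeta> 1) - cb * cos (\<zeta> 0)" "(nrm \<zeta>)\<^sup>2 = (\<zeta> 2)\<^sup>2 + (\<zeta> 3)\<^sup>2"
  using cosh_square_eq[of "\<zeta> 1"] by (auto simp: conf_def nrm_sq ca_cb)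

text \<open>
  With \<open>uv_sq\<close> below: \<open>x\<close> is the polar angle and \<open>1 / conf\<close> the length of the vector from the removed
  point.
\<close>

lemma u_eq: "ca * Xr \<zeta> + cb = cos (\<zeta> 0) / conf \<zeta>"
proof -
  have "ca * (ca * cos (\<zeta> 0) - cb * cosh (\<zeta> 1)) + cb * conf \<zeta> = cos (\<zeta> 0)"
    using trig_rels[of \<zeta>] ca_cb(1) by algebra
  then show ?thesis using conf_pos[of \<zeta>] by (simp add: Xr_def field_simps)
qed

lemma k_eq: "ca + cb * Xr \<zeta> = cosh (\<zeta> 1) / conf \<zeta>"
proof -
  have "ca * conf \<zeta> + cb * (ca * cos (\<zeta> 0) - cb * cosh (\<zeta> 1)) = cosh (\<zeta> 1)"
    using trig_rels[of \<zeta>] ca_cb(1) by algebra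
  then show ?thesis using conf_pos[of \<zeta>] by (simp add: Xr_def field_simps)
qed

lemma uv_sq: "(ca * Xr \<zeta> + cb)\<^sup>2 + (Xv \<zeta>)\<^sup>2 = 1 / (conf \<zeta>)\<^sup>2"
proof -
  have "(ca * Xr \<zeta> + cb)\<^sup>2 + (Xv \<zeta>)\<^sup>2 = ((cos (\<zeta> 0))\<^sup>2 + (sin (\<zeta> 0))\<^sup>2) / (conf \<zeta>)\<^sup>2"
    unfolding u_eq Xv_def power_divide add_divide_distrib ..
  then show ?thesis by (simp only: sin_cos_squared_add2)
qed

lemma X_unit: "(Xr \<zeta>)\<^sup>2 + (Xv \<zeta>)\<^sup>2 + (Xs \<zeta>)\<^sup>2 = 1"
proof -
  have "(ca * cos (\<zeta> 0) - cb * cosh (\<zeta> 1))\<^sup>2 + (sin (\<zeta> 0))\<^sup>2 + (sinh (\<zeta> 1))\<^sup>2 = (conf \<zeta>)\<^sup>2"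
    using trig_rels[of \<zeta>] ca_cb(1) by algebra
  then show ?thesis using conf_pos[of \<zeta>]
    by (simp add: Xr_def Xv_def Xs_def power_divide flip: add_divide_distrib)
qed

lemma XP_orth: "Xr \<zeta> * Pr \<zeta> + Xv \<zeta> * Pv \<zeta> + Xs \<zeta> * Ps \<zeta> = 0"
proof -
  define S C Sh Ch a b where "S = sin (\<zeta> 0)" "C = cos (\<zeta> 0)" "Sh = sinh (\<zeta> 1)" "Ch = cosh (\<zeta> 1)"
    "a = \<zeta> 2" "b = \<zeta> 3"
  note d = this
  note T = trig_rels[of \<zeta>, folded d] ca_cb(1)
  have "- ((ca * C - cb * Ch) * (S * Ch * a + C * Sh * b)) + S * ((ca * Ch * C - cb) * a - ca * S * Sh * b)
      + Sh * ((ca - cb * C * Ch) * b - cb * Sh * S * a) = 0"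
    using T by algebra
  moreover define i j where "i = inverse (conf \<zeta>)" "j = inverse (hm \<zeta>)"
  ultimately show ?thesis
    unfolding Xr_def Pr_def Xv_def Pv_def Xs_def Ps_def d[symmetric] divide_inverse
    unfolding i_j_def[symmetric] by algebra
qed

lemma P_unit:
  assumes "\<zeta> \<in> Ph"
  shows "(Pr \<zeta>)\<^sup>2 + (Pv \<zeta>)\<^sup>2 + (Ps \<zeta>)\<^sup>2 = 1"
proof -
  define S C Sh Ch a b where "S = sin (\<zeta> 0)" "C = cos (\<zeta> 0)" "Sh = sinh (\<zeta> 1)" "Ch = cosh (\<zeta> 1)"
    "a = \<zeta> 2" "b = \<zeta> 3"
  note d = this
  note T = trig_rels[of \<zeta>, folded d] ca_cb(1)
  have "(S * Ch * a + C * Sh * b)\<^sup>2 + ((ca * Ch * C - cb) * a - ca * S * Sh * b)\<^sup>2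
      + ((ca - cb * C * Ch) * b - cb * Sh * S * a)\<^sup>2 = (conf \<zeta>)\<^sup>2 * (a\<^sup>2 + b\<^sup>2)"
    using T(1,2,3,5) by algebra
  also have "\<dots> = (hm \<zeta>)\<^sup>2" by (simp add: hm_def power_mult_distrib T(4))
  finally show ?thesis using hm_pos[OF assms]
    unfolding Pr_def Pv_def Ps_def d[symmetric] power_divide power2_minus
    by (simp flip: add_divide_distrib)
qed

text \<open>
  The covector is determined by the position and the velocity on the sphere together with the value of
  the Hamiltonian.
\<close>

lemma xi_recover:
  assumes "\<zeta> \<in> Ph"
  shows "(ca * Xr \<zeta> + cb) * Pv \<zeta> - ca * Xv \<zeta> * Pr \<zeta> = \<zeta> 2 / hm \<zeta>"
    and "(ca + cb * Xr \<zeta>) * Ps \<zeta> - cb * Xs \<zeta> * Pr \<zeta> = \<zeta> 3 / hm \<zeta>"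
proof -
  define S C Sh Ch a b where "S = sin (\<zeta> 0)" "C = cos (\<zeta> 0)" "Sh = sinh (\<zeta> 1)" "Ch = cosh (\<zeta> 1)"
    "a = \<zeta> 2" "b = \<zeta> 3"
  note d = this
  note T = trig_rels[of \<zeta>, folded d] ca_cb(1)
  define i j where "i = inverse (conf \<zeta>)" "j = inverse (hm \<zeta>)"
  note ij_def = this
  have i: "conf \<zeta> * i = 1" using conf_pos[of \<zeta>] by (simp add: ij_def)
  have "C * ((ca * Ch * C - cb) * a - ca * S * Sh * b) + ca * S * (S * Ch * a + C * Sh * b) = conf \<zeta> * a"
    using T(1,2,3,5) by algebra
  then show "(ca * Xr \<zeta> + cb) * Pv \<zeta> - ca * Xv \<zeta> * Pr \<zeta> = \<zeta> 2 / hm \<zeta>"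
    unfolding u_eq Pr_def Xv_def Pv_def d[symmetric] divide_inverse
    unfolding ij_def[symmetric] using i by algebra
  have "Ch * ((ca - cb * C * Ch) * b - cb * Sh * S * a) + cb * Sh * (S * Ch * a + C * Sh * b) = conf \<zeta> * b"
    using T(1,2,3,5) by algebra
  then show "(ca + cb * Xr \<zeta>) * Ps \<zeta> - cb * Xs \<zeta> * Pr \<zeta> = \<zeta> 3 / hm \<zeta>"
    unfolding k_eq Pr_def Xs_def Ps_def d[symmetric] divide_inverse
    unfolding ij_def[symmetric] using i by algebra
qed

lemma angvel_eq:
  assumes "\<zeta> \<in> Ph"
  shows "angvel (Xr \<zeta>) (Xv \<zeta>) (Pr \<zeta>) (Pv \<zeta>) = conf \<zeta> * \<zeta> 2 / nrm \<zeta>"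
  unfolding angvel_def uv_sq xi_recover(1)[OF assms]
  using conf_pos[of \<zeta>] by (simp add: hm_def power2_eq_square)

text \<open>
  Hamilton's equations at the time \<open>t\<close>, in coordinates.
\<close>

definition flow_at :: "(real \<Rightarrow> nat \<Rightarrow> real) \<Rightarrow> real \<Rightarrow> real set \<Rightarrow> bool" where
  "flow_at z t I \<longleftrightarrow> z t \<in> Ph \<and>
     ((\<lambda>s. z s 0) has_real_derivative conf (z t) * z t 2 / nrm (z t)) (at t within I) \<and>
     ((\<lambda>s. z s 1) has_real_derivative conf (z t) * z t 3 / nrm (z t)) (at t within I) \<and>
     ((\<lambda>s. z s 2) has_real_derivative - (cb * sin (z t 0) * nrm (z t))) (at t within I) \<and>
     ((\<lambda>s. z s 3) has_real_derivative - (ca * sinh (z t 1) * nrm (z t))) (at t within I)"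

text \<open>
  Geodesics of the unit sphere solve \<open>X'' = - X\<close> in the ambient space.
\<close>

lemma flow_observables:
  assumes "flow_at z t I"
  shows "((\<lambda>s. hm (z s)) has_real_derivative 0) (at t within I)"
    and "((\<lambda>s. Xr (z s)) has_real_derivative Pr (z t)) (at t within I)"
    and "((\<lambda>s. Xv (z s)) has_real_derivative Pv (z t)) (at t within I)"
    and "((\<lambda>s. Pr (z s)) has_real_derivative - Xr (z t)) (at t within I)"
    and "((\<lambda>s. Pv (z s)) has_real_derivative - Xv (z t)) (at t within I)"
proof -
  define S C Sh Ch a b K n where "S = sin (z t 0)" "C = cos (z t 0)" "Sh = sinh (z t 1)"
    "Ch = cosh (z t 1)" "a = z t 2" "b = z t 3" "K = conf (z t)" "n = nrm (z t)"
  note d = this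
  note T = trig_rels[of "z t", folded d] ca_cb(1)
  have ab: "\<not> (z t 2 = 0 \<and> z t 3 = 0)" using assms by (auto simp: flow_at_def Ph_def)
  define w where "w = cb * S * a + ca * Sh * b"
  define q where "q = 1 / n"
  have zP: "z t \<in> Ph" using assms by (simp add: flow_at_def)
  have n: "n > 0" using nrm_pos[OF zP] by (simp add: d)
  have K: "K > 0" using conf_pos by (simp add: d)
  have q: "q * n = 1" using n by (simp add: q_def)
  \<comment> \<open>The only combination of the covector with \<open>1 / n\<close> that occurs in the derivatives of \<open>Pr\<close> and \<open>Pv\<close>.\<close>
  have qn: "q * (a\<^sup>2 + b\<^sup>2) = n" using q T(4) by algebra
  have D0: "((\<lambda>s. z s 0) has_real_derivative K * a * q) (at t within I)"
    and D1: "((\<lambda>s. z s 1) has_real_derivative K * b * q) (at t within I)"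
    and D2: "((\<lambda>s. z s 2) has_real_derivative - (cb * S * n)) (at t within I)"
    and D3: "((\<lambda>s. z s 3) has_real_derivative - (ca * Sh * n)) (at t within I)"
    using assms by (simp_all add: flow_at_def d q_def)
  have DC: "((\<lambda>s. cos (z s 0)) has_real_derivative - S * (K * a * q)) (at t within I)"
    and DS: "((\<lambda>s. sin (z s 0)) has_real_derivative C * (K * a * q)) (at t within I)"
    and DCh: "((\<lambda>s. cosh (z s 1)) has_real_derivative Sh * (K * b * q)) (at t within I)"
    and DSh: "((\<lambda>s. sinh (z s 1)) has_real_derivative Ch * (K * b * q)) (at t within I)"
    unfolding d by (rule derivative_eq_intros D0[unfolded d] D1[unfolded d] refl | simp)+
  have DK: "((\<lambda>s. conf (z s)) has_real_derivative K * w * q) (at t within I)"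
    unfolding conf_def
    by (rule derivative_eq_intros DC DCh refl)+ (simp add: w_def algebra_simps)
  have "((\<lambda>s. (z s 2)\<^sup>2 + (z s 3)\<^sup>2) has_real_derivative - (2 * n * w)) (at t within I)"
    by (rule derivative_eq_intros D2 D3 refl)+ (simp add: w_def d algebra_simps)
  from DERIV_chain2[OF DERIV_real_sqrt this]
  have Dn: "((\<lambda>s. nrm (z s)) has_real_derivative - w) (at t within I)"
    using n ab by (auto simp: nrm_def d field_simps)
  show Dh: "((\<lambda>s. hm (z s)) has_real_derivative 0) (at t within I)"
    unfolding hm_def
    by (rule derivative_eq_intros DK Dn refl)+ (use q in \<open>simp add: d[symmetric] algebra_simps\<close>)
  have H: "hm (z t) = K * n" by (simp add: hm_def d)
  have Hp: "K * n > 0" using K n by simp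
  have quot: "((\<lambda>s. f (z s) / hm (z s)) has_real_derivative D / hm (z t)) (at t within I)"
    if "((\<lambda>s. f (z s)) has_real_derivative D) (at t within I)" for f D
    using DERIV_divide[OF that Dh] K n by (simp add: H)
  show "((\<lambda>s. Xr (z s)) has_real_derivative Pr (z t)) (at t within I)"
    unfolding Xr_def
  proof (rule DERIV_cong[OF DERIV_divide[OF DERIV_diff[OF DERIV_cmult[OF DC] DERIV_cmult[OF DCh]] DK]])
    have "((ca * (- S * (K * a * q)) - cb * (Sh * (K * b * q))) * K - (ca * C - cb * Ch) * (K * w * q)) * n
        = - (S * Ch * a + C * Sh * b) * K"
      using T(1,2,3,5) q w_def by algebra
    then show "((ca * (- S * (K * a * q)) - cb * (Sh * (K * b * q))) * conf (z t)
        - (ca * cos (z t 0) - cb * cosh (z t 1)) * (K * w * q)) / (conf (z t) * conf (z t)) = Pr (z t)"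
      unfolding Pr_def H d[symmetric] using K n
      by (simp add: frac_eq_eq)
  qed (use K in \<open>simp add: d\<close>)
  show "((\<lambda>s. Xv (z s)) has_real_derivative Pv (z t)) (at t within I)"
    unfolding Xv_def
  proof (rule DERIV_cong[OF DERIV_divide[OF DS DK]])
    have "(C * (K * a * q) * K - S * (K * w * q)) * n
        = ((ca * Ch * C - cb) * a - ca * S * Sh * b) * K"
      using T(1,2,3,5) q w_def by algebra
    then show "(C * (K * a * q) * conf (z t) - sin (z t 0) * (K * w * q)) / (conf (z t) * conf (z t)) = Pv (z t)"
      unfolding Pv_def H d[symmetric] using K n
      by (simp add: frac_eq_eq)
  qed (use K in \<open>simp add: d\<close>)
  have DPr: "((\<lambda>s. - (sin (z s 0) * cosh (z s 1) * z s 2 + cos (z s 0) * sinh (z s 1) * z s 3))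
      has_real_derivative - (n * (ca * C - cb * Ch))) (at t within I)"
    by (rule DERIV_cong[OF DERIV_minus[OF DERIV_add[OF DERIV_mult[OF DERIV_mult[OF DS DCh] D2]
          DERIV_mult[OF DERIV_mult[OF DC DSh] D3]]]], unfold d[symmetric]) (use T(1,2,3,5) qn in algebra)
  show "((\<lambda>s. Pr (z s)) has_real_derivative - Xr (z t)) (at t within I)"
    unfolding Pr_def
    by (rule DERIV_cong[OF quot[OF DPr]]) (use n in \<open>simp add: Xr_def H d[symmetric] del: One_nat_def\<close>)
  have DPv: "((\<lambda>s. (ca * cosh (z s 1) * cos (z s 0) - cb) * z s 2 - ca * sin (z s 0) * sinh (z s 1) * z s 3)
      has_real_derivative - (n * S)) (at t within I)"
    by (rule DERIV_cong[OF DERIV_diff[OF DERIV_mult[OF DERIV_diff[OF DERIV_mult[OF DERIV_cmult[OF DCh] DC]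
          DERIV_const] D2] DERIV_mult[OF DERIV_mult[OF DERIV_cmult[OF DS] DSh] D3]]], unfold d[symmetric])
       (use T(1,2,3,5) qn in algebra)
  show "((\<lambda>s. Pv (z s)) has_real_derivative - Xv (z t)) (at t within I)"
    unfolding Pv_def
    by (rule DERIV_cong[OF quot[OF DPv]]) (use n in \<open>simp add: Xv_def H d[symmetric] del: One_nat_def\<close>)
qed

section \<open>Uniqueness of billiard trajectories\<close>

abbreviation crd :: "(nat \<Rightarrow> real) copoint \<Rightarrow> nat \<Rightarrow> real" where
  "crd \<equiv> coord hemi_cover chart0"

lemma ham_traj_hemi_cover:
  "ham_traj hemi_cover \<gamma> I \<longleftrightarrow> (\<forall>t\<in>I. \<gamma> t \<in> cotan' hemi_cover) \<and>
     continuous_map (top_of_set I) (top_of_set (halfspace 2)) (\<lambda>t. fst (\<gamma> t)) \<and>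
     (\<forall>t\<in>I. flow_at (\<lambda>s. crd (\<gamma> s)) t I)"
proof -
  have p: "fst z \<in> halfspace 2" if "z \<in> cotan' hemi_cover" for z
    using that by (auto simp: cotan'_def)
  show ?thesis
    unfolding ham_traj_def flow_at_def
    by (auto simp: all_2 p ham_deriv coord_Ph nat2 simp del: One_nat_def)
qed

lemma scaled_sign:
  fixes c n x :: real
  assumes "c > 0" "n > 0"
  shows "c * x / n < 0 \<longleftrightarrow> x < 0" "c * x / n > 0 \<longleftrightarrow> x > 0"
  using assms by (auto simp: pos_divide_less_eq pos_less_divide_eq mult_less_0_iff zero_less_mult_iff)

lemma reflects_hemi_cover:
  assumes "reflects hemi_cover z z'"
  shows "crd z \<in> Ph" "crd z' \<in> Ph" "crd z 1 = 0" "crd z' 0 = crd z 0" "crd z' 1 = 0"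
    "crd z' 2 = crd z 2" "hm (crd z') = hm (crd z)" "crd z 3 < 0" "crd z' 3 > 0"
proof -
  have z: "z \<in> cotan' hemi_cover" "z' \<in> cotan' hemi_cover" "fst z \<in> mboundary hemi_cover" and
    c: "ham_xi hemi_cover chart0 1 (crd z) < 0" "ham hemi_cover chart0 (crd z') = ham hemi_cover chart0 (crd z)"
       "ham_xi hemi_cover chart0 1 (crd z') > 0" and i: "\<And>i. i < 3 \<Longrightarrow> crd z' i = crd z i"
    using assms by (auto simp: reflects_def mboundary_hemi_cover)
  show P: "crd z \<in> Ph" "crd z' \<in> Ph" using z coord_Ph by auto
  show z1: "crd z 1 = 0" using z(3) by (auto simp: mboundary_hemi_cover coord_def)
  show "crd z' 0 = crd z 0" "crd z' 2 = crd z 2" using i by auto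
  show "crd z' 1 = 0" using i[of 1] z1 by auto
  show "hm (crd z') = hm (crd z)" using c(2) by (simp add: ham_hemi_cover hm_def)
  show "crd z 3 < 0" "crd z' 3 > 0"
    using c(1,3) scaled_sign[OF conf_pos nrm_pos[OF P(1)]] scaled_sign[OF conf_pos nrm_pos[OF P(2)]]
    by (simp_all only: ham_deriv(2)[OF P(1)] ham_deriv(2)[OF P(2)])
qed

lemma billiard_forward:
  assumes "billiard M \<gamma> T" "0 \<le> t" "t < T"
  obtains e where "e > 0" "ham_traj M \<gamma> {t..t+e}"
proof -
  have "t \<in> {0..<T}" using assms by simp
  then have "\<exists>e>0. ham_traj M \<gamma> {t..t+e} \<and> (\<forall>s\<in>{t<..t+e}. fst (\<gamma> s) \<notin> mboundary M)"
    using assms(1) unfolding billiard_def by blast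
  then show ?thesis using that by blast
qed

lemma billiard_backward:
  assumes "billiard M \<gamma> T" "0 < t" "t \<le> T"
  obtains e \<delta> where "e > 0" "e \<le> t" "ham_traj M \<delta> {t-e..t}" "\<And>s. s \<in> {t-e..<t} \<Longrightarrow> \<delta> s = \<gamma> s"
    "\<delta> t = \<gamma> t \<and> fst (\<gamma> t) \<notin> mboundary M \<or> reflects M (\<delta> t) (\<gamma> t)"
proof -
  have "t \<in> {0<..T}" using assms by simp
  then have "\<exists>e>0. e \<le> t \<and> (\<exists>\<delta>. ham_traj M \<delta> {t-e..t} \<and>
        (\<forall>s\<in>{t-e..<t}. \<delta> s = \<gamma> s) \<and> (\<forall>s\<in>{t-e<..<t}. fst (\<gamma> s) \<notin> mboundary M) \<and>
        (\<delta> t = \<gamma> t \<and> fst (\<gamma> t) \<notin> mboundary M \<or> reflects M (\<delta> t) (\<gamma> t)))"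
    using assms(1) unfolding billiard_def by blast
  then show ?thesis using that by blast
qed

lemma billiard_Ph:
  assumes "billiard hemi_cover \<gamma> T" "t \<in> {0..T}"
  shows "crd (\<gamma> t) \<in> Ph"
proof (cases "t < T")
  case True
  then obtain e where "e > 0" "ham_traj hemi_cover \<gamma> {t..t+e}"
    using billiard_forward[OF assms(1), of t] assms(2) by auto
  then show ?thesis using coord_Ph by (auto simp: ham_traj_hemi_cover)
next
  case False
  show ?thesis
  proof (cases "t = 0")
    case True then show ?thesis using assms coord_Ph by (auto simp: billiard_def)
  next
    case f: False
    then have "0 < t" "t \<le> T" using assms(2) by auto
    then obtain e \<delta> where "e > 0" "e \<le> t" and e: "ham_traj hemi_cover \<delta> {t-e..t}" and
      "\<And>s. s \<in> {t-e..<t} \<Longrightarrow> \<delta> s = \<gamma> s" and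
      r: "\<delta> t = \<gamma> t \<and> fst (\<gamma> t) \<notin> mboundary hemi_cover \<or> reflects hemi_cover (\<delta> t) (\<gamma> t)"
      by (rule billiard_backward[OF assms(1)]) blast
    have "\<delta> t \<in> cotan' hemi_cover" using e \<open>e > 0\<close> by (auto simp: ham_traj_hemi_cover)
    then show ?thesis using r coord_Ph reflects_hemi_cover(2) by metis
  qed
qed

text \<open>
  Along a billiard trajectory \<open>g\<close> has a right derivative from the arc that begins at \<open>t\<close> and a left
  derivative from the arc that ends at \<open>t\<close>. If a reflection changes neither \<open>g\<close> nor its derivative \<open>G\<close>
  along the flow, the two agree also at the hitting times.
\<close>

lemma billiard_observable:
  fixes g G :: "(nat \<Rightarrow> real) \<Rightarrow> real"
  assumes b: "billiard hemi_cover \<gamma> T" and t: "t \<in> {0..T}" and T: "T > 0"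
    and flow: "\<And>z t I. flow_at z t I \<Longrightarrow> ((\<lambda>s. g (z s)) has_real_derivative G (z t)) (at t within I)"
    and refl: "\<And>z z'. reflects hemi_cover z z' \<Longrightarrow> g (crd z') = g (crd z) \<and> G (crd z') = G (crd z)"
  shows "((\<lambda>s. g (crd (\<gamma> s))) has_real_derivative G (crd (\<gamma> t))) (at t within {0..T})"
proof -
  let ?f = "\<lambda>s. g (crd (\<gamma> s))"
  let ?D = "G (crd (\<gamma> t))"
  have single: "(?f has_real_derivative ?D) (at t within {t})"
    by (simp add: has_field_derivative_iff at_within_eq_bot_iff[THEN iffD2])
  have right: "\<exists>e>0. (?f has_real_derivative ?D) (at t within {t..t+e} \<inter> {0..T})"
  proof (cases "t < T")
    case True
    then obtain e where e: "e > 0" "ham_traj hemi_cover \<gamma> {t..t+e}"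
      using billiard_forward[OF b, of t] t by auto
    then have "flow_at (\<lambda>s. crd (\<gamma> s)) t {t..t+e}" by (auto simp: ham_traj_hemi_cover)
    from DERIV_subset[OF flow[OF this], of "{t..t+e} \<inter> {0..T}"] e(1) show ?thesis by blast
  next
    case False
    then have "{t..t+1} \<inter> {0..T} = {t}" using t by auto
    then have "(?f has_real_derivative ?D) (at t within {t..t+1} \<inter> {0..T})" using single by (simp only:)
    then show ?thesis using zero_less_one by blast
  qed
  have left: "\<exists>e>0. (?f has_real_derivative ?D) (at t within {t-e..t} \<inter> {0..T})"
  proof (cases "t > 0")
    case True
    obtain e \<delta> where e: "e > 0" "e \<le> t" "ham_traj hemi_cover \<delta> {t-e..t}" and
      eq: "\<And>s. s \<in> {t-e..<t} \<Longrightarrow> \<delta> s = \<gamma> s" and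
      r: "\<delta> t = \<gamma> t \<and> fst (\<gamma> t) \<notin> mboundary hemi_cover \<or> reflects hemi_cover (\<delta> t) (\<gamma> t)"
      by (rule billiard_backward[OF b True]) (use t in auto)
    have gt: "g (crd (\<delta> t)) = g (crd (\<gamma> t)) \<and> G (crd (\<delta> t)) = ?D" using r refl by metis
    have "flow_at (\<lambda>s. crd (\<delta> s)) t {t-e..t}" using e by (auto simp: ham_traj_hemi_cover)
    from flow[OF this] have "((\<lambda>s. g (crd (\<delta> s))) has_real_derivative ?D) (at t within {t-e..t})"
      using gt by simp
    then have "(?f has_real_derivative ?D) (at t within {t-e..t})"
    proof (rule has_field_derivative_transform_within[where d = 1])
      fix s assume "s \<in> {t-e..t}"
      then show "g (crd (\<delta> s)) = g (crd (\<gamma> s))" using gt eq by (cases "s = t") auto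
    qed (use e in auto)
    from DERIV_subset[OF this, of "{t-e..t} \<inter> {0..T}"] e(1) show ?thesis by blast
  next
    case False
    then have "{t-1..t} \<inter> {0..T} = {t}" using t by auto
    then have "(?f has_real_derivative ?D) (at t within {t-1..t} \<inter> {0..T})" using single by (simp only:)
    then show ?thesis using zero_less_one by blast
  qed
  obtain e1 e2 where e: "e1 > 0" "e2 > 0"
    and d1: "(?f has_real_derivative ?D) (at t within {t-e1..t} \<inter> {0..T})"
    and d2: "(?f has_real_derivative ?D) (at t within {t..t+e2} \<inter> {0..T})"
    using left right by blast
  have "(?f has_real_derivative ?D) (at t within ({t-e1..t} \<inter> {0..T}) \<union> ({t..t+e2} \<inter> {0..T}))"
    using d1 d2 unfolding has_field_derivative_iff
    by (subst at_within_union) (rule filterlim_sup)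
  moreover have "at t within ({t-e1..t} \<inter> {0..T}) \<union> ({t..t+e2} \<inter> {0..T}) = at t within {0..T}"
    by (rule at_within_nhd[of _ "{t - e1<..<t + e2}"]) (use e in auto)
  ultimately show ?thesis by simp
qed

lemma zero_derivative_imp_initial:
  fixes f :: "real \<Rightarrow> real"
  assumes "\<And>t. t \<in> {0..T} \<Longrightarrow> (f has_real_derivative 0) (at t within {0..T})" "t \<in> {0..T}"
  shows "f t = f 0"
proof -
  have "\<exists>c. \<forall>s\<in>{0..T}. f s = c"
    by (rule has_field_derivative_zero_constant) (use assms(1) in auto)
  then show ?thesis using assms(2) by force
qed

lemma rotation_inverse:
  fixes a b x y t :: real
  assumes "a * cos t - b * sin t = x" "a * sin t + b * cos t = y"
  shows "a = x * cos t + y * sin t" "b = y * cos t - x * sin t"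
proof -
  define c s where "c = cos t" "s = sin t"
  have "s\<^sup>2 + c\<^sup>2 = 1" by (simp add: c_s_def)
  note h = this assms[folded c_s_def]
  show "a = x * cos t + y * sin t" unfolding c_s_def[symmetric] using h by algebra
  show "b = y * cos t - x * sin t" unfolding c_s_def[symmetric] using h by algebra
qed

lemma harmonic_solution:
  fixes f p :: "real \<Rightarrow> real"
  assumes f: "\<And>t. t \<in> {0..T} \<Longrightarrow> (f has_real_derivative p t) (at t within {0..T})"
    and p: "\<And>t. t \<in> {0..T} \<Longrightarrow> (p has_real_derivative - f t) (at t within {0..T})"
    and t: "t \<in> {0..T}"
  shows "f t = f 0 * cos t + p 0 * sin t" "p t = p 0 * cos t - f 0 * sin t"
proof -
  have "f t * cos t - p t * sin t = f 0 * cos 0 - p 0 * sin 0"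
    by (rule zero_derivative_imp_initial[where f = "\<lambda>s. f s * cos s - p s * sin s" and T = T, OF _ t])
       (auto intro!: derivative_eq_intros f p simp: algebra_simps)
  then have 1: "f t * cos t - p t * sin t = f 0" by simp
  have "f t * sin t + p t * cos t = f 0 * sin 0 + p 0 * cos 0"
    by (rule zero_derivative_imp_initial[where f = "\<lambda>s. f s * sin s + p s * cos s" and T = T, OF _ t])
       (auto intro!: derivative_eq_intros f p simp: algebra_simps)
  then have 2: "f t * sin t + p t * cos t = p 0" by simp
  show "f t = f 0 * cos t + p 0 * sin t" "p t = p 0 * cos t - f 0 * sin t"
    by (rule rotation_inverse[OF 1 2])+
qed

text \<open>
  On the boundary \<open>\<xi>\<^sub>y\<close> enters \<open>Pr\<close> and \<open>Pv\<close> only with the factor \<open>sinh y = 0\<close>, so a reflection is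
  invisible to all of the functions below, and the differential equations hold across it.
\<close>

lemma billiard_observables:
  assumes b: "billiard hemi_cover \<gamma> T" and T: "T > 0" and t: "t \<in> {0..T}"
  shows "hm (crd (\<gamma> t)) = hm (crd (\<gamma> 0))"
    and "Xr (crd (\<gamma> t)) = Xr (crd (\<gamma> 0)) * cos t + Pr (crd (\<gamma> 0)) * sin t"
    and "Pr (crd (\<gamma> t)) = Pr (crd (\<gamma> 0)) * cos t - Xr (crd (\<gamma> 0)) * sin t"
    and "Xv (crd (\<gamma> t)) = Xv (crd (\<gamma> 0)) * cos t + Pv (crd (\<gamma> 0)) * sin t"
    and "Pv (crd (\<gamma> t)) = Pv (crd (\<gamma> 0)) * cos t - Xv (crd (\<gamma> 0)) * sin t"
    and "((\<lambda>s. crd (\<gamma> s) 0) has_real_derivative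
           angvel (Xr (crd (\<gamma> t))) (Xv (crd (\<gamma> t))) (Pr (crd (\<gamma> t))) (Pv (crd (\<gamma> t)))) (at t within {0..T})"
proof -
  have R: "Xr (crd z') = Xr (crd z)" "Xv (crd z') = Xv (crd z)" "Pr (crd z') = Pr (crd z)"
      "Pv (crd z') = Pv (crd z)" if "reflects hemi_cover z z'" for z z'
  proof -
    note r = reflects_hemi_cover[OF that]
    have c: "conf (crd z') = conf (crd z)" using r by (simp add: conf_def)
    show "Xr (crd z') = Xr (crd z)" "Xv (crd z') = Xv (crd z)" "Pr (crd z') = Pr (crd z)"
      "Pv (crd z') = Pv (crd z)"
      by (simp_all only: Xr_def Xv_def Pr_def Pv_def r c sinh_0 mult_zero_left mult_zero_right)
  qed
  have Q: "hm (crd z') = hm (crd z) \<and> (0::real) = 0"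
    "Xr (crd z') = Xr (crd z) \<and> Pr (crd z') = Pr (crd z)"
    "Xv (crd z') = Xv (crd z) \<and> Pv (crd z') = Pv (crd z)"
    "Pr (crd z') = Pr (crd z) \<and> - Xr (crd z') = - Xr (crd z)"
    "Pv (crd z') = Pv (crd z) \<and> - Xv (crd z') = - Xv (crd z)" if "reflects hemi_cover z z'" for z z'
    using R[OF that] reflects_hemi_cover(7)[OF that] by simp_all
  note D = billiard_observable[OF b _ T]
  have "((\<lambda>s. hm (crd (\<gamma> s))) has_real_derivative 0) (at t within {0..T})" if "t \<in> {0..T}" for t
    by (rule D[OF that, of hm "\<lambda>_. 0"]) (erule flow_observables(1), erule Q(1))
  from zero_derivative_imp_initial[OF this t]
  show "hm (crd (\<gamma> t)) = hm (crd (\<gamma> 0))" .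
  have r: "((\<lambda>s. Xr (crd (\<gamma> s))) has_real_derivative Pr (crd (\<gamma> t))) (at t within {0..T})" if "t \<in> {0..T}" for t
    by (rule D[OF that, of Xr Pr]) (erule flow_observables(2), erule Q(2))
  have v: "((\<lambda>s. Xv (crd (\<gamma> s))) has_real_derivative Pv (crd (\<gamma> t))) (at t within {0..T})" if "t \<in> {0..T}" for t
    by (rule D[OF that, of Xv Pv]) (erule flow_observables(3), erule Q(3))
  have p: "((\<lambda>s. Pr (crd (\<gamma> s))) has_real_derivative - Xr (crd (\<gamma> t))) (at t within {0..T})" if "t \<in> {0..T}" for t
    by (rule D[OF that, of Pr "\<lambda>z. - Xr z"]) (erule flow_observables(4), erule Q(4))
  have q: "((\<lambda>s. Pv (crd (\<gamma> s))) has_real_derivative - Xv (crd (\<gamma> t))) (at t within {0..T})" if "t \<in> {0..T}" for t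
    by (rule D[OF that, of Pv "\<lambda>z. - Xv z"]) (erule flow_observables(5), erule Q(5))
  show "Xr (crd (\<gamma> t)) = Xr (crd (\<gamma> 0)) * cos t + Pr (crd (\<gamma> 0)) * sin t"
    by (rule harmonic_solution(1)[OF r p t])
  show "Pr (crd (\<gamma> t)) = Pr (crd (\<gamma> 0)) * cos t - Xr (crd (\<gamma> 0)) * sin t"
    by (rule harmonic_solution(2)[OF r p t])
  show "Xv (crd (\<gamma> t)) = Xv (crd (\<gamma> 0)) * cos t + Pv (crd (\<gamma> 0)) * sin t"
    by (rule harmonic_solution(1)[OF v q t])
  show "Pv (crd (\<gamma> t)) = Pv (crd (\<gamma> 0)) * cos t - Xv (crd (\<gamma> 0)) * sin t"
    by (rule harmonic_solution(2)[OF v q t])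
  show "((\<lambda>s. crd (\<gamma> s) 0) has_real_derivative
           angvel (Xr (crd (\<gamma> t))) (Xv (crd (\<gamma> t))) (Pr (crd (\<gamma> t))) (Pv (crd (\<gamma> t)))) (at t within {0..T})"
  proof (rule D[OF t, of "\<lambda>z. z 0" "\<lambda>z. angvel (Xr z) (Xv z) (Pr z) (Pv z)"])
    fix z t I assume f: "flow_at z t I"
    then have "z t \<in> Ph" by (simp add: flow_at_def)
    with f show "((\<lambda>s. z s 0) has_real_derivative angvel (Xr (z t)) (Xv (z t)) (Pr (z t)) (Pv (z t))) (at t within I)"
      by (simp add: flow_at_def angvel_eq)
  next
    fix z z' assume r: "reflects hemi_cover z z'"
    show "crd z' 0 = crd z 0 \<and> angvel (Xr (crd z')) (Xv (crd z')) (Pr (crd z')) (Pv (crd z')) =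
        angvel (Xr (crd z)) (Xv (crd z)) (Pr (crd z)) (Pv (crd z))"
      by (simp only: R[OF r] reflects_hemi_cover(4)[OF r])
  qed
qed

text \<open>
  The vector from the removed point gives \<open>conf\<close>, hence \<open>cosh y\<close>, hence \<open>y \<ge> 0\<close>. Then \<open>\<xi>\<^sub>x\<close> follows from
  \<open>xi_recover\<close>. Over the interior \<open>\<xi>\<^sub>y\<close> can be read off from \<open>Pr\<close> and \<open>Pv\<close>; on the boundary only
  \<open>\<bar>\<xi>\<^sub>y\<bar>\<close> is determined, and its sign is fixed by the convention that trajectories take the reflected value.
\<close>

lemma phase_point_determined:
  assumes P: "\<zeta> \<in> Ph" "\<zeta>' \<in> Ph" and eq: "\<zeta> 0 = \<zeta>' 0" "hm \<zeta> = hm \<zeta>'" "Xr \<zeta> = Xr \<zeta>'"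
      "Xv \<zeta> = Xv \<zeta>'" "Pr \<zeta> = Pr \<zeta>'" "Pv \<zeta> = Pv \<zeta>'"
    and b: "\<zeta> 1 = 0 \<Longrightarrow> \<zeta> 3 > 0" "\<zeta>' 1 = 0 \<Longrightarrow> \<zeta>' 3 > 0"
  shows "\<zeta> = \<zeta>'"
proof -
  have "1 / (conf \<zeta>)\<^sup>2 = 1 / (conf \<zeta>')\<^sup>2" by (simp only: uv_sq[symmetric] eq)
  then have "(conf \<zeta>)\<^sup>2 = (conf \<zeta>')\<^sup>2" by simp
  then have c: "conf \<zeta> = conf \<zeta>'"
    using conf_pos[of \<zeta>] conf_pos[of \<zeta>'] by (simp only: power2_eq_iff_nonneg less_imp_le)
  then have "cosh (\<zeta> 1) = cosh (\<zeta>' 1)" using eq(1) ca_cb by (simp add: conf_def)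
  then have y: "\<zeta> 1 = \<zeta>' 1" using P cosh_real_nonneg_le_iff[of "\<zeta> 1" "\<zeta>' 1"]
      cosh_real_nonneg_le_iff[of "\<zeta>' 1" "\<zeta> 1"] by (simp add: Ph_def)
  have n: "nrm \<zeta> = nrm \<zeta>'" using eq(2) c conf_pos[of \<zeta>'] by (simp add: hm_def)
  have "\<zeta> 2 / hm \<zeta> = \<zeta>' 2 / hm \<zeta>'"
    unfolding xi_recover(1)[OF P(1), symmetric] xi_recover(1)[OF P(2), symmetric] by (simp only: eq)
  then have a: "\<zeta> 2 = \<zeta>' 2" using eq(2) hm_pos[OF P(2)] by simp
  have d: "\<zeta> 3 = \<zeta>' 3"
  proof (cases "\<zeta> 1 = 0")
    case True
    have "(\<zeta> 3)\<^sup>2 = (\<zeta>' 3)\<^sup>2" using n a nrm_sq[of \<zeta>] nrm_sq[of \<zeta>'] by simp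
    then show ?thesis using b True y by (simp add: power2_eq_iff)
  next
    case False
    then have s: "sinh (\<zeta>' 1) \<noteq> 0" using y by simp
    have h: "hm \<zeta>' > 0" by (rule hm_pos[OF P(2)])
    have 1: "cos (\<zeta>' 0) * (sinh (\<zeta>' 1) * \<zeta> 3) = cos (\<zeta>' 0) * (sinh (\<zeta>' 1) * \<zeta>' 3)"
      using eq(5) h y by (simp add: Pr_def eq(1,2) a)
    have 2: "sin (\<zeta>' 0) * (sinh (\<zeta>' 1) * \<zeta> 3) = sin (\<zeta>' 0) * (sinh (\<zeta>' 1) * \<zeta>' 3)"
      using eq(6) h ca_cb(4) y by (simp add: Pv_def eq(1,2) a)
    have "sin (\<zeta>' 0) \<noteq> 0 \<or> cos (\<zeta>' 0) \<noteq> 0" using sin_cos_squared_add[of "\<zeta>' 0"] by force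
    then have "sinh (\<zeta>' 1) * \<zeta> 3 = sinh (\<zeta>' 1) * \<zeta>' 3" using 1 2 by auto
    then show ?thesis using s by simp
  qed
  have "\<zeta> i = \<zeta>' i" for i
  proof -
    consider "i = 0" | "i = 1" | "i = 2" | "i = 3" | "i \<ge> 4" by linarith
    then show ?thesis
      using eq(1) y a d P by cases (auto simp: Ph_def topspace_Euclidean_space)
  qed
  then show ?thesis by auto
qed

lemma billiard_unique:
  assumes b: "billiard hemi_cover \<gamma> T" "billiard hemi_cover \<gamma>' T" and T: "T > 0" and 0: "\<gamma> 0 = \<gamma>' 0"
  shows "\<gamma> T = \<gamma>' T"
proof -
  have "((\<lambda>s. crd (\<gamma> s) 0 - crd (\<gamma>' s) 0) has_real_derivative 0) (at t within {0..T})" if t: "t \<in> {0..T}" for t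
    using DERIV_diff[OF billiard_observables(6)[OF b(1) T t] billiard_observables(6)[OF b(2) T t]]
      billiard_observables(2-5)[OF b(1) T t] billiard_observables(2-5)[OF b(2) T t] 0 by simp
  from zero_derivative_imp_initial[OF this, of T] T 0
  have x: "crd (\<gamma> T) 0 = crd (\<gamma>' T) 0" by simp
  have tT: "T \<in> {0..T}" using T by auto
  have cot: "\<gamma> T \<in> cotan' hemi_cover \<and> (crd (\<gamma> T) 1 = 0 \<longrightarrow> crd (\<gamma> T) 3 > 0)" if b': "billiard hemi_cover \<gamma> T" for \<gamma>
  proof -
    obtain e \<delta> where e: "e > 0" "e \<le> T" "ham_traj hemi_cover \<delta> {T-e..T}" and
      "\<And>s. s \<in> {T-e..<T} \<Longrightarrow> \<delta> s = \<gamma> s" and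
      r: "\<delta> T = \<gamma> T \<and> fst (\<gamma> T) \<notin> mboundary hemi_cover \<or> reflects hemi_cover (\<delta> T) (\<gamma> T)"
      by (rule billiard_backward[OF b' T order_refl]) blast
    have d: "\<delta> T \<in> cotan' hemi_cover" using e by (auto simp: ham_traj_hemi_cover)
    from r show ?thesis
    proof
      assume "\<delta> T = \<gamma> T \<and> fst (\<gamma> T) \<notin> mboundary hemi_cover"
      then show ?thesis using d by (auto simp: mboundary_hemi_cover coord_def cotan'_def)
    next
      assume refl: "reflects hemi_cover (\<delta> T) (\<gamma> T)"
      then have "\<gamma> T \<in> cotan' hemi_cover" by (simp add: reflects_def)
      then show ?thesis using reflects_hemi_cover(9)[OF refl] by blast
    qed
  qed
  have "crd (\<gamma> T) = crd (\<gamma>' T)"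
  proof (rule phase_point_determined[OF billiard_Ph[OF b(1) tT] billiard_Ph[OF b(2) tT] x])
    note o = billiard_observables(1-5)[OF b(1) T tT] billiard_observables(1-5)[OF b(2) T tT]
    show "hm (crd (\<gamma> T)) = hm (crd (\<gamma>' T))" "Xr (crd (\<gamma> T)) = Xr (crd (\<gamma>' T))"
      "Xv (crd (\<gamma> T)) = Xv (crd (\<gamma>' T))" "Pr (crd (\<gamma> T)) = Pr (crd (\<gamma>' T))"
      "Pv (crd (\<gamma> T)) = Pv (crd (\<gamma>' T))"
      by (simp_all only: o 0)
  qed (use cot[OF b(1)] cot[OF b(2)] in blast)+
  then have "lift (crd (\<gamma> T)) = lift (crd (\<gamma>' T))" by (rule arg_cong)
  then show ?thesis using lift_coord cot[OF b(1)] cot[OF b(2)] by simp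
qed

section \<open>Construction of billiard trajectories\<close>

text \<open>
  A unit speed parametrisation of a great circle that starts at a point \<open>(r0, v0, s0)\<close> of the open
  hemisphere with velocity \<open>(pr, pv, ps)\<close>. Its projection to the equatorial plane misses the removed
  point, so that it can be lifted to the cover, and \<open>x0\<close> selects the sheet on which the lift starts.
  The whole circle is followed; where it runs through the lower hemisphere the billiard trajectory is
  its mirror image.
\<close>

locale great_circle =
  fixes r0 v0 s0 pr pv ps \<eta> x0 :: real
  assumes X_unit0: "r0\<^sup>2 + v0\<^sup>2 + s0\<^sup>2 = 1" and orth0: "r0 * pr + v0 * pv + s0 * ps = 0"
    and P_unit0: "pr\<^sup>2 + pv\<^sup>2 + ps\<^sup>2 = 1" and s0_pos: "s0 > 0" and eta_pos: "\<eta> > 0"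
    and avoids: "\<And>t. (ca * (r0 * cos t + pr * sin t) + cb)\<^sup>2 + (v0 * cos t + pv * sin t)\<^sup>2 \<noteq> 0"
    and angle0: "ca * r0 + cb = sqrt ((ca * r0 + cb)\<^sup>2 + v0\<^sup>2) * cos x0"
      "v0 = sqrt ((ca * r0 + cb)\<^sup>2 + v0\<^sup>2) * sin x0"
begin

definition "r t = r0 * cos t + pr * sin t"
definition "v t = v0 * cos t + pv * sin t"
definition "s t = s0 * cos t + ps * sin t"
definition "dr t = pr * cos t - r0 * sin t"
definition "dv t = pv * cos t - v0 * sin t"
definition "ds t = ps * cos t - s0 * sin t"
definition "u t = ca * r t + cb"
definition "k t = ca + cb * r t"
definition "rho t = sqrt ((u t)\<^sup>2 + (v t)\<^sup>2)"

lemma derivs: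
  "(r has_real_derivative dr t) (at t within A)" "(v has_real_derivative dv t) (at t within A)"
  "(s has_real_derivative ds t) (at t within A)" "(dr has_real_derivative - r t) (at t within A)"
  "(dv has_real_derivative - v t) (at t within A)" "(ds has_real_derivative - s t) (at t within A)"
  "(u has_real_derivative ca * dr t) (at t within A)" "(k has_real_derivative cb * dr t) (at t within A)"
  unfolding r_def[abs_def] v_def[abs_def] s_def[abs_def] dr_def[abs_def] dv_def[abs_def] ds_def[abs_def]
    u_def[abs_def] k_def[abs_def]
  by (auto intro!: derivative_eq_intros simp: algebra_simps)

lemma sphere: "(r t)\<^sup>2 + (v t)\<^sup>2 + (s t)\<^sup>2 = 1"
  "r t * dr t + v t * dv t + s t * ds t = 0"
  "(dr t)\<^sup>2 + (dv t)\<^sup>2 + (ds t)\<^sup>2 = 1"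
proof -
  define C S where "C = cos t" "S = sin t"
  note h = X_unit0 orth0 P_unit0 sin_cos_squared_add[of t, folded C_S_def]
  note d = r_def v_def s_def dr_def dv_def ds_def
  show "(r t)\<^sup>2 + (v t)\<^sup>2 + (s t)\<^sup>2 = 1" unfolding d C_S_def[symmetric] using h by algebra
  show "r t * dr t + v t * dv t + s t * ds t = 0" unfolding d C_S_def[symmetric] using h by algebra
  show "(dr t)\<^sup>2 + (dv t)\<^sup>2 + (ds t)\<^sup>2 = 1" unfolding d C_S_def[symmetric] using h by algebra
qed

lemma rho_pos: "rho t > 0"
proof -
  have "(u t)\<^sup>2 + (v t)\<^sup>2 \<noteq> 0" using avoids[of t] by (simp add: u_def r_def v_def)
  then have "(u t)\<^sup>2 + (v t)\<^sup>2 > 0" by (metis add_nonneg_nonneg less_eq_real_def zero_le_power2)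
  then show ?thesis by (simp add: rho_def)
qed

lemma rho_sq: "(rho t)\<^sup>2 = (u t)\<^sup>2 + (v t)\<^sup>2"
  by (simp add: rho_def)

lemma k_pos: "k t > 0"
proof -
  have "(r t)\<^sup>2 \<le> 1" using sphere(1)[of t] zero_le_power2[of "v t"] zero_le_power2[of "s t"] by linarith
  then have "\<bar>r t\<bar> \<le> 1" by (simp add: abs_square_le_1)
  then have "cb * r t \<ge> cb * (-1)" using ca_cb by (intro mult_left_mono) auto
  then show ?thesis using ca_cb by (simp add: k_def)
qed

lemma rho_hyp: "(rho t)\<^sup>2 = (k t)\<^sup>2 - (s t)\<^sup>2"
  unfolding rho_sq u_def k_def using sphere(1)[of t] ca_cb(1) by algebra

lemma uv_k: "ca * k t - cb * u t = 1"
  unfolding u_def k_def using ca_cb(1) by algebra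

lemma radial: "u t * (ca * dr t) + v t * dv t = k t * (cb * dr t) - s t * ds t"
  unfolding u_def k_def using sphere(2)[of t] ca_cb(1) by algebra

text \<open>
  The projection of the sphere to the coordinates \<open>(x, y)\<close> is conformal. In terms of \<open>(u, v)\<close> and
  \<open>(k, s)\<close>, which both have square \<open>rho\<^sup>2\<close> (the latter for the indefinite form \<open>k\<^sup>2 - s\<^sup>2\<close>), this is
  the sum of two Lagrange identities.
\<close>

lemma speed: "(u t * dv t - ca * v t * dr t)\<^sup>2 + (k t * ds t - cb * s t * dr t)\<^sup>2 = (rho t)\<^sup>2"
proof -
  have "(u t * dv t - ca * v t * dr t)\<^sup>2 =
      ((u t)\<^sup>2 + (v t)\<^sup>2) * ((ca * dr t)\<^sup>2 + (dv t)\<^sup>2) - (u t * (ca * dr t) + v t * dv t)\<^sup>2" by algebra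
  moreover have "(k t * ds t - cb * s t * dr t)\<^sup>2 =
      (k t * (cb * dr t) - s t * ds t)\<^sup>2 - ((k t)\<^sup>2 - (s t)\<^sup>2) * ((cb * dr t)\<^sup>2 - (ds t)\<^sup>2)" by algebra
  ultimately have "(u t * dv t - ca * v t * dr t)\<^sup>2 + (k t * ds t - cb * s t * dr t)\<^sup>2 =
      (rho t)\<^sup>2 * ((ca * dr t)\<^sup>2 + (dv t)\<^sup>2 - (cb * dr t)\<^sup>2 + (ds t)\<^sup>2)"
    using radial[of t] rho_hyp[of t] rho_sq[of t] by algebra
  also have "(ca * dr t)\<^sup>2 + (dv t)\<^sup>2 - (cb * dr t)\<^sup>2 + (ds t)\<^sup>2 = 1"
    using sphere(3)[of t] ca_cb(1) by algebra
  finally show ?thesis by simp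
qed

lemma rho_deriv:
  "(rho has_real_derivative (u t * (ca * dr t) + v t * dv t) / rho t) (at t within A)"
proof -
  have "((\<lambda>t. (u t)\<^sup>2 + (v t)\<^sup>2) has_real_derivative 2 * (u t * (ca * dr t) + v t * dv t)) (at t within A)"
    by (rule derivative_eq_intros derivs refl)+ simp
  note D = this
  have p: "(u t)\<^sup>2 + (v t)\<^sup>2 > 0" using rho_pos[of t] by (simp add: rho_def)
  have "inverse R / 2 * (2 * X) = X / R" for R X :: real by (simp add: field_simps)
  then show ?thesis
    unfolding rho_def[abs_def] by (intro DERIV_cong[OF DERIV_chain2[OF DERIV_real_sqrt[OF p] D]])
qed

text \<open>
  The coordinate \<open>x\<close> of the lift is a continuous polar angle of \<open>(u, v)\<close>, obtained by integrating its rate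
  of change.
\<close>

definition "om t = (u t * dv t - ca * v t * dr t) / (rho t)\<^sup>2"

definition th :: "real \<Rightarrow> real" where
  "th = (SOME f. f 0 = x0 \<and> (\<forall>t. (f has_real_derivative om t) (at t)))"

lemma th: "th 0 = x0" "(th has_real_derivative om t) (at t within A)"
proof -
  have "isCont om t" for t
  proof -
    have "isCont f t" if "(f has_real_derivative D) (at t within UNIV)" for f :: "real \<Rightarrow> real" and D
      using DERIV_isCont that by blast
    note c = this[OF derivs(2)] this[OF derivs(4)] this[OF derivs(5)] this[OF derivs(7)] this[OF rho_deriv]
    show ?thesis unfolding om_def[abs_def]
      by (intro continuous_intros c) (use rho_pos[of t] in auto)
  qed
  then obtain f where f: "\<And>t. (f has_vector_derivative om t) (at t)"
    using einterval_antiderivative[of "-\<infinity>" "\<infinity>" om] by auto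
  have "\<exists>f. f 0 = x0 \<and> (\<forall>t. (f has_real_derivative om t) (at t))"
    by (rule exI[of _ "\<lambda>t. x0 + (f t - f 0)"])
       (use f in \<open>auto simp flip: has_real_derivative_iff_has_vector_derivative intro!: derivative_eq_intros\<close>)
  then have "th 0 = x0 \<and> (\<forall>t. (th has_real_derivative om t) (at t))"
    unfolding th_def by (rule someI_ex)
  then have f: "th 0 = x0" "(th has_real_derivative om t) (at t)" by blast+
  show "th 0 = x0" by (rule f(1))
  show "(th has_real_derivative om t) (at t within A)" by (rule has_field_derivative_at_within[OF f(2)])
qed

lemma th_angle: "cos (th t) = u t / rho t" "sin (th t) = v t / rho t"
proof -
  let ?c = "\<lambda>t. u t / rho t" and ?s = "\<lambda>t. v t / rho t"
  have Dc: "(?c has_real_derivative - (?s t * om t)) (at t)" for t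
  proof (rule DERIV_cong[OF DERIV_divide[OF derivs(7) rho_deriv]])
    define R where "R = rho t"
    have R: "R > 0" "R\<^sup>2 = (u t)\<^sup>2 + (v t)\<^sup>2" using rho_pos rho_sq by (simp_all add: R_def)
    have "ca * dr t * R\<^sup>2 - u t * (u t * (ca * dr t) + v t * dv t) = - (v t * (u t * dv t - ca * v t * dr t))"
      using R(2) by algebra
    then show "(ca * dr t * rho t - u t * ((u t * (ca * dr t) + v t * dv t) / rho t)) / (rho t * rho t) =
        - (v t / rho t * om t)"
      unfolding om_def R_def[symmetric] using R(1)
      by (simp add: divide_simps) (simp add: algebra_simps power2_eq_square)
  qed (use rho_pos[of t] in auto)
  have Ds: "(?s has_real_derivative ?c t * om t) (at t)" for t
  proof (rule DERIV_cong[OF DERIV_divide[OF derivs(2) rho_deriv]])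
    define R where "R = rho t"
    have R: "R > 0" "R\<^sup>2 = (u t)\<^sup>2 + (v t)\<^sup>2" using rho_pos rho_sq by (simp_all add: R_def)
    have "dv t * R\<^sup>2 - v t * (u t * (ca * dr t) + v t * dv t) = u t * (u t * dv t - ca * v t * dr t)"
      using R(2) by algebra
    then show "(dv t * rho t - v t * ((u t * (ca * dr t) + v t * dv t) / rho t)) / (rho t * rho t) =
        u t / rho t * om t"
      unfolding om_def R_def[symmetric] using R(1)
      by (simp add: divide_simps) (simp add: algebra_simps power2_eq_square)
  qed (use rho_pos[of t] in auto)
  have D1: "((\<lambda>t. ?c t * cos (th t) + ?s t * sin (th t)) has_real_derivative 0) (at t)" for t
    by (rule derivative_eq_intros Dc Ds th(2) refl)+ (simp add: algebra_simps)
  have D2: "((\<lambda>t. ?s t * cos (th t) - ?c t * sin (th t)) has_real_derivative 0) (at t)" for t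
    by (rule derivative_eq_intros Dc Ds th(2) refl)+ (simp add: algebra_simps)
  have i: "?c 0 = cos x0" "?s 0 = sin x0"
  proof -
    have q: "rho 0 = sqrt ((ca * r0 + cb)\<^sup>2 + v0\<^sup>2)" by (simp add: u_def v_def r_def rho_def)
    have uv: "u 0 = ca * r0 + cb" "v 0 = v0" by (simp_all add: u_def v_def r_def)
    have "u 0 = rho 0 * cos x0" unfolding uv q by (rule angle0(1))
    moreover have "v 0 = rho 0 * sin x0" unfolding uv q by (rule angle0(2))
    ultimately show "?c 0 = cos x0" "?s 0 = sin x0" using rho_pos[of 0] by simp_all
  qed
  have e1: "?c t * cos (th t) + ?s t * sin (th t) = 1"
    using DERIV_isconst_all[of "\<lambda>t. ?c t * cos (th t) + ?s t * sin (th t)" t 0] D1 i th(1)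
    by (simp add: power2_eq_square[symmetric])
  have e2: "?s t * cos (th t) - ?c t * sin (th t) = 0"
    using DERIV_isconst_all[of "\<lambda>t. ?s t * cos (th t) - ?c t * sin (th t)" t 0] D2 i th(1) by simp
  have "sin (th t)^2 + cos (th t)^2 = 1" by simp
  then show "cos (th t) = u t / rho t" "sin (th t) = v t / rho t"
    subgoal using e1 e2 by algebra
    subgoal using e1 e2 sin_cos_squared_add[of "th t"] by algebra
    done
qed

text \<open>
  The coordinate \<open>y\<close> of the lift, continued to negative values below the equator.
\<close>

definition "yt t = arsinh (s t / rho t)"

lemma yt: "sinh (yt t) = s t / rho t" "cosh (yt t) = k t / rho t"
proof -
  show 1: "sinh (yt t) = s t / rho t" by (simp add: yt_def)
  have "(cosh (yt t))\<^sup>2 = (k t / rho t)\<^sup>2"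
    unfolding cosh_square_eq 1 using rho_hyp[of t] rho_pos[of t] by (simp add: power_divide field_simps)
  then show "cosh (yt t) = k t / rho t"
    using k_pos[of t] rho_pos[of t] by (simp add: power2_eq_iff_nonneg)
qed

lemma yt_deriv: "(yt has_real_derivative (k t * ds t - cb * s t * dr t) / (rho t)\<^sup>2) (at t within A)"
proof -
  define R where "R = rho t"
  have R: "R > 0" using rho_pos by (simp add: R_def)
  have "sqrt ((s t / R)\<^sup>2 + 1) = k t / R"
  proof -
    have "(s t / R)\<^sup>2 + 1 = (k t / R)\<^sup>2"
      using rho_hyp[of t] R by (simp add: power_divide field_simps R_def)
    then show ?thesis using k_pos[of t] R by simp
  qed
  then have D: "(yt has_real_derivative 1 / (k t / R) *
      ((ds t * R - s t * ((u t * (ca * dr t) + v t * dv t) / R)) / (R * R))) (at t within A)"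
    unfolding yt_def[abs_def]
    using DERIV_chain2[OF arsinh_real_has_field_derivative DERIV_divide[OF derivs(3) rho_deriv], of t A] R
    by (simp add: R_def)
  have R2: "R\<^sup>2 = (k t)\<^sup>2 - (s t)\<^sup>2" using rho_hyp by (simp add: R_def)
  have "ds t * R\<^sup>2 - s t * (u t * (ca * dr t) + v t * dv t) = k t * (k t * ds t - cb * s t * dr t)"
    using R2 radial[of t] by algebra
  note num = this
  have "1 / (K / R) * ((d * R - y * (W / R)) / (R * R)) = (d * R\<^sup>2 - y * W) / (K * R\<^sup>2)"
    if "K > 0" for K d y W :: real
    using R that by (simp add: divide_simps) (simp add: algebra_simps power2_eq_square)
  from this[OF k_pos] have "1 / (k t / R) * ((ds t * R - s t * ((u t * (ca * dr t) + v t * dv t) / R)) / (R * R)) =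
      (ds t * R\<^sup>2 - s t * (u t * (ca * dr t) + v t * dv t)) / (k t * R\<^sup>2)" .
  also have "\<dots> = (k t * ds t - cb * s t * dr t) / R\<^sup>2"
    unfolding num using k_pos[of t] by simp
  finally have "1 / (k t / R) * ((ds t * R - s t * ((u t * (ca * dr t) + v t * dv t) / R)) / (R * R)) =
      (k t * ds t - cb * s t * dr t) / R\<^sup>2" .
  then show ?thesis using D by (simp add: R_def)
qed

text \<open>
  The Hamiltonian trajectory in the whole \<open>(x, y)\<close>-plane for \<open>\<sigma> = 1\<close>, and its image under the isometry
  \<open>y \<mapsto> - y\<close> for \<open>\<sigma> = -1\<close>.
\<close>

definition unfolded :: "real \<Rightarrow> real \<Rightarrow> nat \<Rightarrow> real" where
  "unfolded \<sigma> t = (\<lambda>i. if i = 0 then th t else if i = 1 then \<sigma> * yt t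
     else if i = 2 then \<eta> * (u t * dv t - ca * v t * dr t)
     else if i = 3 then \<sigma> * (\<eta> * (k t * ds t - cb * s t * dr t)) else 0)"

lemma unfolded_simps: "unfolded \<sigma> t 0 = th t" "unfolded \<sigma> t 1 = \<sigma> * yt t"
  "unfolded \<sigma> t 2 = \<eta> * (u t * dv t - ca * v t * dr t)"
  "unfolded \<sigma> t 3 = \<sigma> * (\<eta> * (k t * ds t - cb * s t * dr t))"
  by (simp_all add: unfolded_def)

lemma unfolded_conf:
  assumes "\<sigma> = 1 \<or> \<sigma> = -1"
  shows "conf (unfolded \<sigma> t) = 1 / rho t" "nrm (unfolded \<sigma> t) = \<eta> * rho t" "sinh (unfolded \<sigma> t 1) = \<sigma> * (s t / rho t)"
proof -
  have "cosh (unfolded \<sigma> t 1) = k t / rho t" using assms yt(2)[of t] unfolding unfolded_simps by auto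
  then have "conf (unfolded \<sigma> t) = (ca * k t - cb * u t) / rho t"
    unfolding conf_def by (simp only: unfolded_simps th_angle) (simp add: diff_divide_distrib)
  then show "conf (unfolded \<sigma> t) = 1 / rho t" by (simp add: uv_k)
  have "\<sigma>\<^sup>2 = 1" using assms by auto
  then have "(unfolded \<sigma> t 2)\<^sup>2 + (unfolded \<sigma> t 3)\<^sup>2 = (\<eta> * rho t)\<^sup>2"
    unfolding unfolded_simps using speed[of t] by algebra
  then show "nrm (unfolded \<sigma> t) = \<eta> * rho t" using eta_pos rho_pos[of t] by (simp add: nrm_def)
  show "sinh (unfolded \<sigma> t 1) = \<sigma> * (s t / rho t)" using assms yt(1)[of t] unfolding unfolded_simps by auto
qed

lemma unfolded_Ph:
  assumes "\<sigma> = 1 \<or> \<sigma> = -1" "\<sigma> * s t \<ge> 0"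
  shows "unfolded \<sigma> t \<in> Ph"
proof -
  have "nrm (unfolded \<sigma> t) > 0" using unfolded_conf(2)[OF assms(1)] eta_pos rho_pos by simp
  then have "unfolded \<sigma> t 2 \<noteq> 0 \<or> unfolded \<sigma> t 3 \<noteq> 0" by (auto simp: nrm_def)
  moreover have "sinh (unfolded \<sigma> t 1) \<ge> 0"
    using unfolded_conf(3)[OF assms(1)] assms(2) rho_pos[of t] by simp
  then have "unfolded \<sigma> t 1 \<ge> 0" by simp
  moreover have "unfolded \<sigma> t \<in> rspace 4" by (simp add: unfolded_def topspace_Euclidean_space)
  ultimately show ?thesis by (simp add: Ph_def)
qed

lemma unfolded_flow:
  assumes "\<sigma> = 1 \<or> \<sigma> = -1" "\<sigma> * s t \<ge> 0"
  shows "flow_at (unfolded \<sigma>) t A"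
  unfolding flow_at_def
proof (intro conjI)
  define R where "R = rho t"
  have R: "R > 0" using rho_pos by (simp add: R_def)
  show "unfolded \<sigma> t \<in> Ph" by (rule unfolded_Ph[OF assms])
  show "((\<lambda>s. unfolded \<sigma> s 0) has_real_derivative conf (unfolded \<sigma> t) * unfolded \<sigma> t 2 / nrm (unfolded \<sigma> t)) (at t within A)"
    unfolding unfolded_simps unfolded_conf[OF assms(1)]
    by (rule DERIV_cong[OF th(2)]) (use R eta_pos in \<open>simp add: om_def R_def[symmetric] power2_eq_square\<close>)
  show "((\<lambda>s. unfolded \<sigma> s 1) has_real_derivative conf (unfolded \<sigma> t) * unfolded \<sigma> t 3 / nrm (unfolded \<sigma> t)) (at t within A)"
    unfolding unfolded_simps unfolded_conf[OF assms(1)]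
    by (rule DERIV_cong[OF DERIV_cmult[OF yt_deriv]])
       (use R eta_pos in \<open>simp add: R_def[symmetric] power2_eq_square\<close>)
  show "((\<lambda>s. unfolded \<sigma> s 2) has_real_derivative - (cb * sin (unfolded \<sigma> t 0) * nrm (unfolded \<sigma> t))) (at t within A)"
    unfolding unfolded_simps unfolded_conf[OF assms(1)] th_angle
    by (rule DERIV_cong[OF DERIV_cmult[OF DERIV_diff[OF DERIV_mult[OF derivs(7) derivs(5)]
          DERIV_mult[OF DERIV_cmult[OF derivs(2)] derivs(4)]]]])
       (use R in \<open>simp add: R_def[symmetric] u_def algebra_simps\<close>)
  show "((\<lambda>s. unfolded \<sigma> s 3) has_real_derivative - (ca * sinh (unfolded \<sigma> t 1) * nrm (unfolded \<sigma> t))) (at t within A)"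
    unfolding unfolded_conf[OF assms(1)] unfolding unfolded_simps
    by (rule DERIV_cong[OF DERIV_cmult[OF DERIV_cmult[OF DERIV_diff[OF DERIV_mult[OF derivs(8) derivs(6)]
          DERIV_mult[OF DERIV_cmult[OF derivs(3)] derivs(4)]]]]])
       (use R in \<open>simp add: R_def[symmetric] k_def algebra_simps\<close>)
qed

lemma crd_lift_unfolded: "crd (lift (unfolded \<sigma> t)) = unfolded \<sigma> t"
  by (rule coord_lift) (simp add: unfolded_def topspace_Euclidean_space)

lemma unfolded_traj:
  assumes "\<sigma> = 1 \<or> \<sigma> = -1" "\<And>t. t \<in> A \<Longrightarrow> \<sigma> * s t \<ge> 0"
  shows "ham_traj hemi_cover (\<lambda>t. lift (unfolded \<sigma> t)) A"
  unfolding ham_traj_hemi_cover crd_lift_unfolded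
proof (intro conjI ballI)
  show "lift (unfolded \<sigma> t) \<in> cotan' hemi_cover" if "t \<in> A" for t
    by (rule lift_cotan[OF unfolded_Ph[OF assms(1) assms(2)[OF that]]])
  show "flow_at (unfolded \<sigma>) t A" if "t \<in> A" for t by (rule unfolded_flow[OF assms(1) assms(2)[OF that]])
  have "continuous_on A (\<lambda>t. fst (lift (unfolded \<sigma> t)))"
  proof (rule continuous_on_coordinatewise_then_product)
    fix i :: nat
    have 0: "continuous_on A th"
      by (rule DERIV_continuous_on) (rule th(2))
    have 1: "continuous_on A (\<lambda>t. \<sigma> * yt t)"
      by (intro continuous_intros DERIV_continuous_on) (rule yt_deriv)
    consider "i = 0" | "i = 1" | "i \<ge> 2" by linarith
    then show "continuous_on A (\<lambda>t. fst (lift (unfolded \<sigma> t)) i)"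
      using 0 1 by cases (simp_all add: fst_lift base_def unfolded_def)
  qed
  moreover have "fst (lift (unfolded \<sigma> t)) \<in> halfspace 2" if "t \<in> A" for t
    using unfolded_Ph[OF assms(1) assms(2)[OF that]] by (simp add: fst_lift base_halfspace Ph_def)
  ultimately show "continuous_map (top_of_set A) (top_of_set (halfspace 2)) (\<lambda>t. fst (lift (unfolded \<sigma> t)))"
    by (auto simp: continuous_map_in_subtopology)
qed

text \<open>
  The sign for which \<open>unfolded\<close> lies in the half-plane \<open>y \<ge> 0\<close>. At a hitting time, where \<open>s t = 0\<close>,
  it is the sign that is right for the arc that begins there; this makes the orbit right-continuous.
\<close>

definition side :: "real \<Rightarrow> real" where
  "side t = (if s t > 0 \<or> s t = 0 \<and> ds t > 0 then 1 else -1)"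

definition orbit :: "real \<Rightarrow> (nat \<Rightarrow> real) copoint" where
  "orbit t = lift (unfolded (side t) t)"

lemma side: "side t = 1 \<or> side t = -1" "side t * s t \<ge> 0" "s t = 0 \<Longrightarrow> side t * ds t > 0"
proof -
  have "(s t)\<^sup>2 + (ds t)\<^sup>2 = s0\<^sup>2 + ps\<^sup>2"
    unfolding s_def ds_def using sin_cos_squared_add[of t] by algebra
  then have nz: "s t = 0 \<Longrightarrow> ds t \<noteq> 0" using s0_pos by (auto simp: sum_power2_eq_zero_iff)
  show "side t = 1 \<or> side t = -1" "side t * s t \<ge> 0" "s t = 0 \<Longrightarrow> side t * ds t > 0"
    using nz by (auto simp: side_def)
qed

lemma sign_near:
  assumes "s t \<noteq> 0"
  shows "\<exists>d>0. \<forall>\<tau>. \<bar>\<tau> - t\<bar> < d \<longrightarrow> side t * s \<tau> > 0"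
proof -
  have "side t * s t > 0" using side(1,2)[of t] assms by auto
  moreover have "isCont (\<lambda>\<tau>. side t * s \<tau>) t"
    using DERIV_isCont[OF derivs(3)] by (intro continuous_intros)
  ultimately obtain d where d: "d > 0" "\<And>\<tau>. \<bar>\<tau> - t\<bar> < d \<Longrightarrow> side t * s \<tau> > 0"
    unfolding continuous_at_eps_delta dist_real_def
    by (metis abs_diff_less_iff diff_self)
  then show ?thesis by blast
qed

lemma forward_sign: "\<exists>e>0. \<forall>\<tau>\<in>{t<..t+e}. side t * s \<tau> > 0"
proof (cases "s t = 0")
  case True
  have "((\<lambda>\<tau>. side t * s \<tau>) has_real_derivative side t * ds t) (at t)"
    by (rule DERIV_cmult[OF derivs(3)])
  from DERIV_pos_inc_right[OF this side(3)[OF True]]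
  obtain d where d: "d > 0" "\<And>h. h > 0 \<Longrightarrow> h < d \<Longrightarrow> side t * s t < side t * s (t + h)" by blast
  have "side t * s \<tau> > 0" if "\<tau> \<in> {t<..t + d/2}" for \<tau>
    using d(2)[of "\<tau> - t"] that d(1) True by auto
  then show ?thesis using d(1) half_gt_zero by blast
next
  case False
  from sign_near[OF this] obtain d where d: "d > 0" "\<And>\<tau>. \<bar>\<tau> - t\<bar> < d \<Longrightarrow> side t * s \<tau> > 0" by blast
  have "side t * s \<tau> > 0" if "\<tau> \<in> {t<..t + d/2}" for \<tau>
    using d(2)[of \<tau>] that d(1) by auto
  then show ?thesis using d(1) half_gt_zero by blast
qed

lemma backward_sign: "\<exists>e>0. \<forall>\<tau>\<in>{t-e..<t}. (if s t = 0 then - side t else side t) * s \<tau> > 0"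
proof (cases "s t = 0")
  case True
  have "((\<lambda>\<tau>. side t * s \<tau>) has_real_derivative side t * ds t) (at t)"
    by (rule DERIV_cmult[OF derivs(3)])
  from DERIV_pos_inc_left[OF this side(3)[OF True]]
  obtain d where d: "d > 0" "\<And>h. h > 0 \<Longrightarrow> h < d \<Longrightarrow> side t * s (t - h) < side t * s t" by blast
  have "(if s t = 0 then - side t else side t) * s \<tau> > 0" if "\<tau> \<in> {t - d/2..<t}" for \<tau>
    using d(2)[of "t - \<tau>"] that d(1) True by auto
  then show ?thesis using d(1) half_gt_zero by blast
next
  case False
  from sign_near[OF this] obtain d where d: "d > 0" "\<And>\<tau>. \<bar>\<tau> - t\<bar> < d \<Longrightarrow> side t * s \<tau> > 0" by blast
  have "(if s t = 0 then - side t else side t) * s \<tau> > 0" if "\<tau> \<in> {t - d/2..<t}" for \<tau>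
    using d(2)[of \<tau>] that d(1) False by auto
  then show ?thesis using d(1) half_gt_zero by blast
qed

lemma side_eqI: "\<sigma> = 1 \<or> \<sigma> = -1 \<Longrightarrow> \<sigma> * s \<tau> > 0 \<Longrightarrow> side \<tau> = \<sigma>"
  by (auto simp: side_def)

lemma orbit_boundary: "fst (orbit t) \<in> mboundary hemi_cover \<longleftrightarrow> s t = 0"
proof -
  have "fst (orbit t) \<in> mboundary hemi_cover \<longleftrightarrow> unfolded (side t) t 1 = 0"
    unfolding orbit_def by (rule lift_boundary[OF unfolded_Ph[OF side(1,2)]])
  also have "\<dots> \<longleftrightarrow> sinh (unfolded (side t) t 1) = 0" by simp
  also have "\<dots> \<longleftrightarrow> s t = 0" using unfolded_conf(3)[OF side(1)] side(1)[of t] rho_pos[of t] by auto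
  finally show ?thesis .
qed

lemma ham_traj_cong:
  assumes "ham_traj hemi_cover \<gamma> A" "\<And>t. t \<in> A \<Longrightarrow> \<gamma> t = \<delta> t"
  shows "ham_traj hemi_cover \<delta> A"
proof -
  have "continuous_map (top_of_set A) (top_of_set (halfspace 2)) (\<lambda>t. fst (\<gamma> t))"
    using assms(1) unfolding ham_traj_hemi_cover by blast
  then have "continuous_map (top_of_set A) (top_of_set (halfspace 2)) (\<lambda>t. fst (\<delta> t))"
    by (rule continuous_map_eq) (simp add: assms(2))
  moreover have "flow_at (\<lambda>s. crd (\<delta> s)) t A" if "t \<in> A" for t
  proof -
    have fl: "flow_at (\<lambda>s. crd (\<gamma> s)) t A" using assms(1) that by (simp add: ham_traj_hemi_cover)
    have "((\<lambda>s. crd (\<delta> s) j) has_real_derivative D) (at t within A)"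
      if "((\<lambda>s. crd (\<gamma> s) j) has_real_derivative D) (at t within A)" for j D
      by (rule has_field_derivative_transform_within[OF that, of 1]) (use \<open>t \<in> A\<close> assms(2) in auto)
    then show ?thesis using fl assms(2)[OF that] by (simp add: flow_at_def)
  qed
  moreover have "\<delta> t \<in> cotan' hemi_cover" if "t \<in> A" for t
    using assms(1) that unfolding ham_traj_hemi_cover assms(2)[OF that, symmetric] by blast
  ultimately show ?thesis unfolding ham_traj_hemi_cover by blast
qed

text \<open>
  The orbit is composed of arcs of the two Hamiltonian trajectories \<open>unfolded 1\<close> and \<open>unfolded (-1)\<close>. They
  meet at the hitting times, where they differ by the sign of \<open>\<xi>\<^sub>y\<close> only, which is the law of reflection.
\<close>

lemma orbit_billiard: "billiard hemi_cover orbit T"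
  unfolding billiard_def
proof (intro conjI ballI)
  show "orbit 0 \<in> cotan' hemi_cover" unfolding orbit_def by (rule lift_cotan[OF unfolded_Ph[OF side(1,2)]])
  show "fst (orbit 0) \<notin> mboundary hemi_cover" using s0_pos by (simp add: orbit_boundary s_def)
next
  fix t assume "t \<in> {0..<T}"
  obtain e where e: "e > 0" "\<And>\<tau>. \<tau> \<in> {t<..t+e} \<Longrightarrow> side t * s \<tau> > 0" using forward_sign by blast
  have nn: "side t * s \<tau> \<ge> 0" if "\<tau> \<in> {t..t+e}" for \<tau>
    using e(2)[of \<tau>] side(2)[of t] that by (cases "\<tau> = t") auto
  have same: "side \<tau> = side t" if "\<tau> \<in> {t..t+e}" for \<tau>
    using side_eqI[OF side(1) e(2)[of \<tau>]] that by (cases "\<tau> = t") auto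
  have "ham_traj hemi_cover orbit {t..t+e}"
  proof (rule ham_traj_cong[OF unfolded_traj[OF side(1) nn]])
    show "lift (unfolded (side t) \<tau>) = orbit \<tau>" if "\<tau> \<in> {t..t+e}" for \<tau>
      unfolding orbit_def same[OF that] ..
  qed
  moreover have "fst (orbit \<tau>) \<notin> mboundary hemi_cover" if "\<tau> \<in> {t<..t+e}" for \<tau>
    using e(2)[OF that] by (auto simp: orbit_boundary)
  ultimately show "\<exists>\<epsilon>>0. ham_traj hemi_cover orbit {t..t+\<epsilon>} \<and> (\<forall>s\<in>{t<..t+\<epsilon>}. fst (orbit s) \<notin> mboundary hemi_cover)"
    using e(1) by blast
next
  fix t assume t: "t \<in> {0<..T}"
  \<comment> \<open>The arc that ends at a hitting time lies on the other side of the equator than the one that begins there.\<close>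
  define \<sigma> where "\<sigma> = (if s t = 0 then - side t else side t)"
  have \<sigma>: "\<sigma> = 1 \<or> \<sigma> = -1" using side(1)[of t] by (auto simp: \<sigma>_def)
  obtain e' where e': "e' > 0" "\<And>\<tau>. \<tau> \<in> {t-e'..<t} \<Longrightarrow> \<sigma> * s \<tau> > 0"
    using backward_sign[of t] unfolding \<sigma>_def by blast
  define e where "e = min e' t"
  have e: "e > 0" "e \<le> t" "\<And>\<tau>. \<tau> \<in> {t-e..<t} \<Longrightarrow> \<sigma> * s \<tau> > 0"
    using e' t by (auto simp: e_def)
  have nn: "\<sigma> * s \<tau> \<ge> 0" if "\<tau> \<in> {t-e..t}" for \<tau>
    using e(3)[of \<tau>] side(2)[of t] that by (cases "\<tau> = t") (auto simp: \<sigma>_def)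
  have same: "lift (unfolded \<sigma> \<tau>) = orbit \<tau>" if "\<tau> \<in> {t-e..<t}" for \<tau>
    using side_eqI[OF \<sigma> e(3)[OF that]] by (simp add: orbit_def)
  have nb: "fst (orbit \<tau>) \<notin> mboundary hemi_cover" if "\<tau> \<in> {t-e<..<t}" for \<tau>
    using e(3)[of \<tau>] that by (auto simp: orbit_boundary)
  have last: "lift (unfolded \<sigma> t) = orbit t \<and> fst (orbit t) \<notin> mboundary hemi_cover \<or> reflects hemi_cover (lift (unfolded \<sigma> t)) (orbit t)"
  proof (cases "s t = 0")
    case False
    then show ?thesis using orbit_boundary[of t] by (simp add: orbit_def \<sigma>_def)
  next
    case True
    have P: "unfolded \<sigma> t \<in> Ph" "unfolded (side t) t \<in> Ph"
      using True by (auto intro!: unfolded_Ph \<sigma> side(1))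
    have y0: "yt t = 0" by (simp add: yt_def True)
    have k3: "unfolded (side t) t 3 = \<eta> * (k t * (side t * ds t))" "unfolded \<sigma> t 3 = - (\<eta> * (k t * (side t * ds t)))"
      by (simp_all add: unfolded_def True \<sigma>_def)
    have "\<eta> * (k t * (side t * ds t)) > 0" using eta_pos k_pos[of t] side(3)[OF True] by simp
    then have s3: "unfolded (side t) t 3 > 0" "unfolded \<sigma> t 3 < 0" using k3 by auto
    have eq: "unfolded (side t) t i = unfolded \<sigma> t i" if "i < 3" for i
      using that y0 by (auto simp: unfolded_def)
    have hameq: "ham hemi_cover chart0 (unfolded (side t) t) = ham hemi_cover chart0 (unfolded \<sigma> t)"
      unfolding ham_hemi_cover unfolded_conf[OF \<sigma>] unfolded_conf[OF side(1)] ..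
    have x: "ham_xi hemi_cover chart0 1 (unfolded \<sigma> t) < 0" "ham_xi hemi_cover chart0 1 (unfolded (side t) t) > 0"
      unfolding ham_deriv(2)[OF P(1)] ham_deriv(2)[OF P(2)]
      using s3 scaled_sign[OF conf_pos nrm_pos[OF P(1)]] scaled_sign[OF conf_pos nrm_pos[OF P(2)]] by blast+
    have f: "fst (lift (unfolded (side t) t)) = fst (lift (unfolded \<sigma> t))"
      using eq by (auto simp: fst_lift base_def)
    have b: "fst (lift (unfolded \<sigma> t)) \<in> mboundary hemi_cover"
      using orbit_boundary[of t] True f by (simp add: orbit_def)
    have "reflects hemi_cover (lift (unfolded \<sigma> t)) (orbit t)"
      unfolding reflects_def orbit_def
      using lift_cotan[OF P(1)] lift_cotan[OF P(2)] b f eq hameq x by (auto simp: crd_lift_unfolded)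
    then show ?thesis by blast
  qed
  show "\<exists>\<epsilon>>0. \<epsilon> \<le> t \<and> (\<exists>\<delta>. ham_traj hemi_cover \<delta> {t-\<epsilon>..t} \<and>
        (\<forall>s\<in>{t-\<epsilon>..<t}. \<delta> s = orbit s) \<and> (\<forall>s\<in>{t-\<epsilon><..<t}. fst (orbit s) \<notin> mboundary hemi_cover) \<and>
        (\<delta> t = orbit t \<and> fst (orbit t) \<notin> mboundary hemi_cover \<or> reflects hemi_cover (\<delta> t) (orbit t)))"
    by (intro exI[of _ e] exI[of _ "\<lambda>t. lift (unfolded \<sigma> t)"] conjI e ballI unfolded_traj[OF \<sigma> nn] same nb last)
qed

text \<open>
  If the curve \<open>(u, v)\<close> stays in an open half-plane bounded by a line through the origin, its polar angle
  never differs by \<open>\<pi>\<close> from the initial one. The total change over a period is a multiple of \<open>2\<pi>\<close>, and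
  by the intermediate value theorem it must be zero.
\<close>

lemma no_winding:
  assumes pos: "\<And>t. u t + \<beta> * v t > 0"
  shows "th (2 * pi) = th 0"
proof (rule ccontr)
  assume ne: "th (2 * pi) \<noteq> th 0"
  have per: "u (2 * pi) = u 0" "v (2 * pi) = v 0" "rho (2 * pi) = rho 0"
    by (simp_all add: u_def v_def r_def rho_def)
  then have "sin (th (2 * pi)) = sin (th 0) \<and> cos (th (2 * pi)) = cos (th 0)"
    by (simp add: th_angle)
  then obtain n :: int where n: "th (2 * pi) = th 0 + 2 * pi * n"
    unfolding sin_cos_eq_iff by blast
  with ne have n0: "n \<noteq> 0" by auto
  have ct: "continuous_on {0..2 * pi} th" by (rule DERIV_continuous_on) (rule th(2))
  have opposite: False if "th t = th 0 + pi \<or> th t = th 0 - pi" for t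
  proof -
    have "cos (th t) = - cos (th 0)" "sin (th t) = - sin (th 0)"
      using that by (auto simp: cos_diff sin_diff)
    then have "u t / rho t + \<beta> * (v t / rho t) = - (u 0 / rho 0 + \<beta> * (v 0 / rho 0))"
      by (simp add: th_angle)
    then have "(u t + \<beta> * v t) / rho t = - ((u 0 + \<beta> * v 0) / rho 0)"
      by (simp add: add_divide_distrib)
    moreover have "(u t + \<beta> * v t) / rho t > 0" "(u 0 + \<beta> * v 0) / rho 0 > 0"
      using pos rho_pos by simp_all
    ultimately show False by linarith
  qed
  have "\<exists>t. th t = th 0 + pi \<or> th t = th 0 - pi"
  proof (cases "n > 0")
    case True
    then have "1 * pi \<le> 2 * real_of_int n * pi" by (intro mult_right_mono) auto
    then have "th 0 + pi \<le> th (2 * pi)" using n by (simp add: mult.commute mult.left_commute)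
    then show ?thesis using IVT'[of th 0 "th 0 + pi" "2 * pi"] ct by auto
  next
    case False
    then have "2 * real_of_int n * pi \<le> (-1) * pi" using n0 by (intro mult_right_mono) auto
    then have "th (2 * pi) \<le> th 0 - pi" using n by (simp add: mult.commute mult.left_commute)
    then show ?thesis using IVT2'[of th "2 * pi" "th 0 - pi" 0] ct by auto
  qed
  then show False using opposite by blast
qed

text \<open>
  The hypothesis says that the removed point lies outside the ellipse traced by \<open>(r, v)\<close>. A line that
  separates them gives the half-plane for \<open>no_winding\<close>.
\<close>

lemma orbit_closes:
  assumes "(ca * (r0 * pv - v0 * pr))\<^sup>2 < cb\<^sup>2 * (v0\<^sup>2 + pv\<^sup>2)"
  shows "orbit (2 * pi) = orbit 0"
proof -
  define N where "N = v0\<^sup>2 + pv\<^sup>2"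
  have N: "N > 0"
    using assms zero_le_power2[of "ca * (r0 * pv - v0 * pr)"] ca_cb(2)
    by (smt (verit) N_def mult_nonneg_nonpos zero_le_power2)
  \<comment> \<open>\<open>u + \<beta> v - cb\<close> oscillates with amplitude \<open>\<surd>(a\<^sup>2 + b\<^sup>2)\<close> for the \<open>a\<close>, \<open>b\<close> defined next;
    this \<open>\<beta>\<close> makes the amplitude minimal.\<close>
  define \<beta> where "\<beta> = - ca * (r0 * v0 + pr * pv) / N"
  have \<beta>: "\<beta> * N = - ca * (r0 * v0 + pr * pv)" using N by (simp add: \<beta>_def)
  define a b where "a = ca * r0 + \<beta> * v0" "b = ca * pr + \<beta> * pv"
  have "(a\<^sup>2 + b\<^sup>2) * N = (ca * (r0 * pv - v0 * pr))\<^sup>2"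
    using \<beta> unfolding a_b_def N_def by algebra
  also have "\<dots> < cb\<^sup>2 * N" using assms by (simp add: N_def)
  finally have ab: "a\<^sup>2 + b\<^sup>2 < cb\<^sup>2" using N by simp
  have "u t + \<beta> * v t > 0" for t
  proof -
    have "(a * cos t + b * sin t)\<^sup>2 + (a * sin t - b * cos t)\<^sup>2 = a\<^sup>2 + b\<^sup>2"
      using sin_cos_squared_add[of t] by algebra
    then have "(a * cos t + b * sin t)\<^sup>2 < cb\<^sup>2" using ab by (smt (verit) zero_le_power2)
    then have "\<bar>a * cos t + b * sin t\<bar> < cb"
      using ca_cb(2) by (intro power2_less_imp_less[of _ cb]) auto
    moreover have "u t + \<beta> * v t = cb + (a * cos t + b * sin t)"
      by (simp add: u_def r_def v_def a_b_def algebra_simps)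
    ultimately show ?thesis by linarith
  qed
  then have x: "th (2 * pi) = th 0" by (rule no_winding)
  have e: "r (2 * pi) = r 0" "v (2 * pi) = v 0" "s (2 * pi) = s 0" "dr (2 * pi) = dr 0"
    "dv (2 * pi) = dv 0" "ds (2 * pi) = ds 0"
    by (simp_all add: r_def v_def s_def dr_def dv_def ds_def)
  show ?thesis unfolding orbit_def unfolded_def side_def yt_def u_def k_def rho_def e x ..
qed

lemma two_hits: "finite {t \<in> {0<..<2 * pi}. s t = 0} \<and> card {t \<in> {0<..<2 * pi}. s t = 0} = 2"
proof -
  define a where "a = arctan (ps / s0)"
  define t1 where "t1 = pi / 2 + a"
  have a: "- (pi / 2) < a" "a < pi / 2" using arctan_bounded by (auto simp: a_def)
  have ca0: "cos a > 0" using a by (intro cos_gt_zero_pi) auto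
  have "tan a = ps / s0" unfolding a_def by (rule tan_arctan)
  then have "ps * cos a = s0 * sin a" using ca0 s0_pos by (simp add: tan_def field_simps)
  then have t1: "s t1 = 0" by (simp add: s_def t1_def cos_add sin_add)
  have t1b: "0 < t1" "t1 < pi" using a by (auto simp: t1_def)
  have "{t \<in> {0<..<2 * pi}. s t = 0} = {t1, t1 + pi}"
  proof (intro set_eqI iffI)
    fix t assume t: "t \<in> {t \<in> {0<..<2 * pi}. s t = 0}"
    have "s0 * sin (t - t1) = 0"
      using t t1 unfolding s_def sin_diff mem_Collect_eq
      by (smt (verit) mult.commute mult.left_commute right_diff_distrib' s0_pos sin_cos_squared_add) 
    then have "sin (t - t1) = 0" using s0_pos by simp
    then obtain i :: int where i: "t - t1 = real_of_int i * pi" by (auto simp: sin_zero_iff_int2)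
    have "(-1) * pi < real_of_int i * pi" "real_of_int i * pi < 2 * pi"
      using t t1b unfolding i[symmetric] by auto
    then have "-1 < real_of_int i" "real_of_int i < 2"
      using pi_ge_zero mult_right_less_imp_less[of _ pi] by blast+
    then have "i = 0 \<or> i = 1" by linarith
    then show "t \<in> {t1, t1 + pi}" using i by auto
  qed (use t1 t1b in \<open>auto simp: s_def\<close>)
  then show ?thesis by (simp add: card_insert_if)
qed

end

section \<open>Classification of periodic trajectories\<close>

text \<open>
  With \<open>J\<close> for the angular momentum \<open>Xr * Pv - Xv * Pr\<close> and \<open>N\<^sup>2 = Xv\<^sup>2 + Pv\<^sup>2\<close>, the ellipse traced by
  \<open>(r, v)\<close> cuts the axis \<open>v = 0\<close> at \<open>r = \<plusminus> J / N\<close>. The sign of \<open>clearance\<close> therefore tells whether the removed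
  point \<open>(- cb / ca, 0)\<close> lies outside this ellipse, on it or inside it. If \<open>N = 0\<close>, the ellipse degenerates
  to the diameter \<open>v = 0\<close>, which contains the removed point.
\<close>

definition clearance :: "(nat \<Rightarrow> real) \<Rightarrow> real" where
  "clearance \<zeta> = cb\<^sup>2 * ((Xv \<zeta>)\<^sup>2 + (Pv \<zeta>)\<^sup>2) - (ca * (Xr \<zeta> * Pv \<zeta> - Xv \<zeta> * Pr \<zeta>))\<^sup>2"

lemma great_circle_phase_point:
  assumes P: "\<zeta> \<in> Ph" and y: "\<zeta> 1 > 0" and d: "clearance \<zeta> \<noteq> 0"
  shows "great_circle (Xr \<zeta>) (Xv \<zeta>) (Xs \<zeta>) (Pr \<zeta>) (Pv \<zeta>) (Ps \<zeta>) (hm \<zeta>) (\<zeta> 0)"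
proof
  show "Xs \<zeta> > 0" using y conf_pos[of \<zeta>] by (simp add: Xs_def)
  have q: "sqrt ((ca * Xr \<zeta> + cb)\<^sup>2 + (Xv \<zeta>)\<^sup>2) = 1 / conf \<zeta>"
    unfolding uv_sq using conf_pos[of \<zeta>] by (simp add: real_sqrt_divide)
  show "ca * Xr \<zeta> + cb = sqrt ((ca * Xr \<zeta> + cb)\<^sup>2 + (Xv \<zeta>)\<^sup>2) * cos (\<zeta> 0)"
    unfolding q by (simp add: u_eq)
  show "Xv \<zeta> = sqrt ((ca * Xr \<zeta> + cb)\<^sup>2 + (Xv \<zeta>)\<^sup>2) * sin (\<zeta> 0)"
    unfolding q by (simp add: Xv_def)
  show "(ca * (Xr \<zeta> * cos t + Pr \<zeta> * sin t) + cb)\<^sup>2 + (Xv \<zeta> * cos t + Pv \<zeta> * sin t)\<^sup>2 \<noteq> 0" for t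
  proof
    assume "(ca * (Xr \<zeta> * cos t + Pr \<zeta> * sin t) + cb)\<^sup>2 + (Xv \<zeta> * cos t + Pv \<zeta> * sin t)\<^sup>2 = 0"
    then have z: "ca * (Xr \<zeta> * cos t + Pr \<zeta> * sin t) + cb = 0" "Xv \<zeta> * cos t + Pv \<zeta> * sin t = 0"
      by (simp_all add: sum_power2_eq_zero_iff)
    define D where "D = Pv \<zeta> * cos t - Xv \<zeta> * sin t"
    note sc = sin_cos_squared_add[of t]
    have "(Xv \<zeta>)\<^sup>2 + (Pv \<zeta>)\<^sup>2 = D\<^sup>2" using z(2) sc unfolding D_def by algebra
    moreover have "Xr \<zeta> * Pv \<zeta> - Xv \<zeta> * Pr \<zeta> = (Xr \<zeta> * cos t + Pr \<zeta> * sin t) * D"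
      using z(2) sc unfolding D_def by algebra
    ultimately have "clearance \<zeta> = 0" unfolding clearance_def using z(1) by algebra
    then show False using d by simp
  qed
qed (use X_unit XP_orth P_unit[OF P] hm_pos[OF P] in auto)

text \<open>
  Every covector over the interior with nonzero clearance is the initial value of one of the orbits
  constructed above.
\<close>

lemma orbit_start:
  assumes P: "\<zeta> \<in> Ph" and y: "\<zeta> 1 > 0" and d: "clearance \<zeta> \<noteq> 0"
  shows "great_circle.orbit (Xr \<zeta>) (Xv \<zeta>) (Xs \<zeta>) (Pr \<zeta>) (Pv \<zeta>) (Ps \<zeta>) (hm \<zeta>) (\<zeta> 0) 0 = lift \<zeta>"
proof -
  interpret G: great_circle "Xr \<zeta>" "Xv \<zeta>" "Xs \<zeta>" "Pr \<zeta>" "Pv \<zeta>" "Ps \<zeta>" "hm \<zeta>" "\<zeta> 0"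
    by (rule great_circle_phase_point[OF assms])
  have 0: "G.r 0 = Xr \<zeta>" "G.v 0 = Xv \<zeta>" "G.s 0 = Xs \<zeta>" "G.dr 0 = Pr \<zeta>" "G.dv 0 = Pv \<zeta>" "G.ds 0 = Ps \<zeta>"
    "G.u 0 = ca * Xr \<zeta> + cb" "G.k 0 = ca + cb * Xr \<zeta>"
    by (simp_all add: G.r_def G.v_def G.s_def G.dr_def G.dv_def G.ds_def G.u_def G.k_def)
  have rho: "G.rho 0 = 1 / conf \<zeta>"
    unfolding G.rho_def 0 uv_sq using conf_pos[of \<zeta>] by (simp add: real_sqrt_divide)
  have side: "G.side 0 = 1" using G.s0_pos by (simp add: G.side_def 0)
  have h: "hm \<zeta> \<noteq> 0" using hm_pos[OF P] by simp
  have "G.s 0 / G.rho 0 = sinh (\<zeta> 1)"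
    unfolding 0 rho using conf_pos[of \<zeta>] by (simp add: Xs_def)
  then have "G.yt 0 = \<zeta> 1" by (simp add: G.yt_def arsinh_sinh_real)
  then have "G.unfolded 1 0 = \<zeta>"
    using P h xi_recover[OF P]
    by (auto simp: G.unfolded_def G.th(1) 0 fun_eq_iff Ph_def topspace_Euclidean_space)
  then show ?thesis by (simp add: G.orbit_def side)
qed

lemma closed_orbit:
  assumes P: "\<zeta> \<in> Ph" and y: "\<zeta> 1 > 0" and d: "clearance \<zeta> > 0"
  shows "reaches hemi_cover (2 * pi) (lift \<zeta>) (lift \<zeta>)" "hits hemi_cover (2 * pi) 2 (lift \<zeta>)"
proof -
  have d': "clearance \<zeta> \<noteq> 0" using d by simp
  interpret G: great_circle "Xr \<zeta>" "Xv \<zeta>" "Xs \<zeta>" "Pr \<zeta>" "Pv \<zeta>" "Ps \<zeta>" "hm \<zeta>" "\<zeta> 0"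
    by (rule great_circle_phase_point[OF P y d'])
  note st = orbit_start[OF P y d']
  have "G.orbit (2 * pi) = lift \<zeta>"
    using G.orbit_closes d st by (simp add: clearance_def)
  then show "reaches hemi_cover (2 * pi) (lift \<zeta>) (lift \<zeta>)"
    unfolding reaches_def using G.orbit_billiard st by blast
  show "hits hemi_cover (2 * pi) 2 (lift \<zeta>)"
    unfolding hits_def using G.orbit_billiard st G.two_hits by (intro exI[of _ G.orbit]) (simp add: G.orbit_boundary)
qed

lemma infinite_orbit:
  assumes P: "\<zeta> \<in> Ph" and y: "\<zeta> 1 > 0" and d: "clearance \<zeta> \<noteq> 0"
  shows "\<exists>\<gamma>. (\<forall>T. billiard hemi_cover \<gamma> T) \<and> \<gamma> 0 = lift \<zeta>"
proof -
  interpret G: great_circle "Xr \<zeta>" "Xv \<zeta>" "Xs \<zeta>" "Pr \<zeta>" "Pv \<zeta>" "Ps \<zeta>" "hm \<zeta>" "\<zeta> 0"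
    by (rule great_circle_phase_point[OF assms])
  show ?thesis using G.orbit_billiard orbit_start[OF assms] by blast
qed

lemma shift_hemi_cover:
  assumes "T > 0" "reaches hemi_cover T z w"
  shows "shift hemi_cover T z = w"
  unfolding shift_def
proof (rule the_equality)
  show "reaches hemi_cover T z w" by (rule assms(2))
  fix w' assume "reaches hemi_cover T z w'"
  then show "w' = w" using assms billiard_unique unfolding reaches_def by metis
qed

text \<open>
  Since \<open>J\<close> is constant, the numerator of the angular velocity is \<open>cb * v' + ca * J\<close>, which cannot vanish if
  \<open>ca * \<bar>J\<bar>\<close> exceeds the amplitude \<open>cb * N\<close> of the first term. So \<open>x\<close> cannot return to its initial value.
\<close>

lemma not_periodic_winding:
  assumes P: "\<zeta> \<in> Ph" and d: "clearance \<zeta> < 0"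
  shows "\<not> periodic hemi_cover (lift \<zeta>)"
proof
  assume "periodic hemi_cover (lift \<zeta>)"
  then obtain T \<gamma> where T: "T > 0" and b: "billiard hemi_cover \<gamma> T" and g: "\<gamma> 0 = lift \<zeta>" "\<gamma> T = lift \<zeta>"
    by (auto simp: periodic_def T_periodic_def reaches_def)
  have c0: "crd (\<gamma> 0) = \<zeta>" "crd (\<gamma> T) = \<zeta>" using P g coord_lift by (auto simp: Ph_def)
  let ?D = "\<lambda>t. angvel (Xr (crd (\<gamma> t))) (Xv (crd (\<gamma> t))) (Pr (crd (\<gamma> t))) (Pv (crd (\<gamma> t)))"
  have "\<exists>t\<in>{0<..<T}. crd (\<gamma> T) 0 - crd (\<gamma> 0) 0 = ?D t * (T - 0)"
  proof (rule mvt_simple[OF T, where f' = "\<lambda>t. (*) (?D t)"])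
    fix t assume "0 \<le> t" "t \<le> T"
    then show "((\<lambda>s. crd (\<gamma> s) 0) has_derivative (*) (?D t)) (at t within {0..T})"
      using billiard_observables(6)[OF b T, of t] by (simp add: has_field_derivative_def)
  qed
  then obtain t where "t \<in> {0<..<T}" "?D t * T = 0" unfolding c0 by auto
  then have t: "t \<in> {0..T}" "?D t = 0" using T by auto
  define r v p q where "r = Xr \<zeta>" "v = Xv \<zeta>" "p = Pr \<zeta>" "q = Pv \<zeta>"
  define C S where "C = cos t" "S = sin t"
  have sc: "S\<^sup>2 + C\<^sup>2 = 1" by (simp add: C_S_def)
  note o = billiard_observables(2-5)[OF b T t(1), unfolded c0 r_v_p_q_def[symmetric] C_S_def[symmetric]]
  have "(ca * Xr (crd (\<gamma> t)) + cb)\<^sup>2 + (Xv (crd (\<gamma> t)))\<^sup>2 \<noteq> 0"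
    unfolding uv_sq using conf_pos[of "crd (\<gamma> t)"] by simp
  then have den: "(ca * (r * C + p * S) + cb)\<^sup>2 + (v * C + q * S)\<^sup>2 \<noteq> 0" unfolding o .
  have "(ca * (r * C + p * S) + cb) * (q * C - v * S) - ca * (v * C + q * S) * (p * C - r * S) = 0"
    using t(2) den unfolding angvel_def o divide_eq_0_iff by blast
  then have "cb * (q * C - v * S) = - (ca * (r * q - v * p))" using sc by algebra
  moreover have "(q * C - v * S)\<^sup>2 + (v * C + q * S)\<^sup>2 = v\<^sup>2 + q\<^sup>2" using sc by algebra
  ultimately have "(ca * (r * q - v * p))\<^sup>2 + cb\<^sup>2 * (v * C + q * S)\<^sup>2 = cb\<^sup>2 * (v\<^sup>2 + q\<^sup>2)" by algebra
  then have "clearance \<zeta> = cb\<^sup>2 * (v * C + q * S)\<^sup>2" by (simp add: clearance_def r_v_p_q_def)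
  moreover have "cb\<^sup>2 * (v * C + q * S)\<^sup>2 \<ge> 0" by simp
  ultimately show False using d by linarith
qed

text \<open>
  A closed trajectory has a period of at least \<open>2\<pi>\<close>, because already its projection to the disc does.
  Within this time it sweeps out the whole ellipse and in particular would reach the removed point,
  which does not lie on the surface.
\<close>

lemma not_periodic_puncture:
  assumes P: "\<zeta> \<in> Ph" and d: "clearance \<zeta> = 0"
  shows "\<not> periodic hemi_cover (lift \<zeta>)"
proof
  assume "periodic hemi_cover (lift \<zeta>)"
  then obtain T \<gamma> where T: "T > 0" and b: "billiard hemi_cover \<gamma> T" and g: "\<gamma> 0 = lift \<zeta>" "\<gamma> T = lift \<zeta>"
    by (auto simp: periodic_def T_periodic_def reaches_def)
  have c0: "crd (\<gamma> 0) = \<zeta>" "crd (\<gamma> T) = \<zeta>" using P g coord_lift by (auto simp: Ph_def)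
  define r v s p q w where "r = Xr \<zeta>" "v = Xv \<zeta>" "s = Xs \<zeta>" "p = Pr \<zeta>" "q = Pv \<zeta>" "w = Ps \<zeta>"
  note dd = this
  have on: "r\<^sup>2 + v\<^sup>2 + s\<^sup>2 = 1" "r * p + v * q + s * w = 0" "p\<^sup>2 + q\<^sup>2 + w\<^sup>2 = 1"
    using X_unit[of \<zeta>] XP_orth[of \<zeta>] P_unit[OF P] by (simp_all add: dd)
  have d0: "cb\<^sup>2 * (v\<^sup>2 + q\<^sup>2) = (ca * (r * q - v * p))\<^sup>2" using d by (simp add: clearance_def dd)
  note obs = billiard_observables(2-5)[OF b T, unfolded c0 dd[symmetric]]
  have "T \<ge> 2 * pi"
  proof -
    have tT: "T \<in> {0..T}" using T by simp
    have e: "r = r * cos T + p * sin T" "p = p * cos T - r * sin T" "v = v * cos T + q * sin T" "q = q * cos T - v * sin T"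
      using obs[OF tT] c0 by (simp_all add: dd)
    have "(r\<^sup>2 + p\<^sup>2 + v\<^sup>2 + q\<^sup>2) * (cos T - 1) = 0"
      using e by algebra
    moreover have "r\<^sup>2 + p\<^sup>2 + v\<^sup>2 + q\<^sup>2 \<noteq> 0"
    proof
      assume "r\<^sup>2 + p\<^sup>2 + v\<^sup>2 + q\<^sup>2 = 0"
      then have "r = 0" "p = 0" "v = 0" "q = 0"
        by (smt (verit) zero_le_power2 zero_eq_power2)+
      then show False using on by (auto simp: power2_eq_square)
    qed
    ultimately have "cos T = 1" by simp
    then obtain n :: int where n: "T = n * 2 * pi" by (auto simp: cos_one_2pi_int)
    then have "n > 0" using T by (simp add: zero_less_mult_iff)
    then have "1 * (2 * pi) \<le> real_of_int n * (2 * pi)" by (intro mult_right_mono) auto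
    then show ?thesis using n by simp
  qed
  have "\<exists>C S. C\<^sup>2 + S\<^sup>2 = 1 \<and> ca * (r * C + p * S) + cb = 0 \<and> v * C + q * S = 0"
  proof (cases "v\<^sup>2 + q\<^sup>2 = 0")
    case True
    then have vq: "v = 0" "q = 0" by (simp_all add: sum_power2_eq_zero_iff)
    have rp: "r\<^sup>2 + p\<^sup>2 = 1"
    proof -
      have "s\<^sup>2 = p\<^sup>2" using on vq by algebra
      then show ?thesis using on(1) vq by simp
    qed
    \<comment> \<open>The ellipse degenerates to the segment \<open>-1 \<le> r \<le> 1\<close>, \<open>v = 0\<close>; solve \<open>r = - B\<close> on it.\<close>
    define B where "B = cb / ca"
    have B: "ca * B = cb" using ca_cb(4) by (simp add: B_def)
    have "0 \<le> B" "B \<le> 1" using ca_cb by (simp_all add: B_def)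
    then have "B\<^sup>2 \<le> 1" by (simp add: power_le_one)
    define Q where "Q = sqrt (1 - B\<^sup>2)"
    have Q: "Q\<^sup>2 = 1 - B\<^sup>2" using \<open>B\<^sup>2 \<le> 1\<close> by (simp add: Q_def)
    show ?thesis
    proof (intro exI conjI)
      show "(- B * r - Q * p)\<^sup>2 + (- B * p + Q * r)\<^sup>2 = 1" using rp Q by algebra
      show "ca * (r * (- B * r - Q * p) + p * (- B * p + Q * r)) + cb = 0" using rp B by algebra
      show "v * (- B * r - Q * p) + q * (- B * p + Q * r) = 0" using vq by simp
    qed
  next
    case False
    then have "ca * (r * q - v * p) \<noteq> 0" using d0 ca_cb(2) by auto
    \<comment> \<open>The witnesses below are cosine and sine of one of the two times at which \<open>v = 0\<close>, namely
      the one with \<open>r = - cb / ca\<close>.\<close>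
    define i where "i = 1 / (ca * (r * q - v * p))"
    have i: "i * (ca * (r * q - v * p)) = 1"
      using \<open>ca * (r * q - v * p) \<noteq> 0\<close> by (simp add: i_def)
    show ?thesis
    proof (intro exI conjI)
      show "(- cb * q * i)\<^sup>2 + (cb * v * i)\<^sup>2 = 1" using d0 i by algebra
      show "ca * (r * (- cb * q * i) + p * (cb * v * i)) + cb = 0" using i by algebra
      show "v * (- cb * q * i) + q * (cb * v * i) = 0" by simp
    qed
  qed
  then obtain C S where CS: "C\<^sup>2 + S\<^sup>2 = 1" "ca * (r * C + p * S) + cb = 0" "v * C + q * S = 0" by blast
  obtain t where t: "0 \<le> t" "t < 2 * pi" "C = cos t" "S = sin t"
    using sincos_total_2pi[OF CS(1)] by metis
  have tT: "t \<in> {0..T}" using t \<open>T \<ge> 2 * pi\<close> by simp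
  have "(ca * Xr (crd (\<gamma> t)) + cb)\<^sup>2 + (Xv (crd (\<gamma> t)))\<^sup>2 = 0"
    unfolding obs[OF tT] using CS(2,3) t by simp
  then show False unfolding uv_sq using conf_pos[of "crd (\<gamma> t)"] by simp
qed

lemma periodic_iff:
  assumes "\<zeta> \<in> Ph" "\<zeta> 1 > 0"
  shows "periodic hemi_cover (lift \<zeta>) \<longleftrightarrow> clearance \<zeta> > 0"
proof
  assume "periodic hemi_cover (lift \<zeta>)"
  then show "clearance \<zeta> > 0"
    using not_periodic_winding[OF assms(1)] not_periodic_puncture[OF assms(1)] by (meson linorder_neqE_linordered_idom)
next
  assume "clearance \<zeta> > 0"
  then show "periodic hemi_cover (lift \<zeta>)"
    using closed_orbit(1)[OF assms] unfolding periodic_def T_periodic_def by (intro exI[of _ "2 * pi"]) auto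
qed

lemma clearance_continuous: "continuous_on {\<zeta>. nrm \<zeta> > 0} clearance"
proof -
  let ?S = "{\<zeta>. nrm \<zeta> > 0}"
  have c: "continuous_on ?S (\<lambda>x. x i)" for i
    by (rule continuous_on_subset[OF continuous_on_product_coordinates]) auto
  have n: "continuous_on ?S nrm" unfolding nrm_def by (intro continuous_intros c[unfolded nrm_def])
  have k: "continuous_on ?S conf" unfolding conf_def[abs_def] by (intro continuous_intros c)
  have k0: "\<forall>x\<in>?S. conf x \<noteq> 0" using conf_pos by (metis less_irrefl)
  have h0: "\<forall>x\<in>?S. conf x * nrm x \<noteq> 0" using k0 by auto
  show ?thesis
    unfolding clearance_def[abs_def] Xr_def Xv_def Pr_def Pv_def hm_def
    by (intro continuous_intros c n k k0 h0)
qed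

lemma open_nrm_pos: "open {\<zeta>. nrm \<zeta> > 0 \<and> \<zeta> 1 > 0}"
proof -
  have c: "continuous_on UNIV (\<lambda>x::nat\<Rightarrow>real. x i)" for i by simp
  have "continuous_on UNIV nrm" unfolding nrm_def[abs_def] by (intro continuous_intros c)
  then have "open {\<zeta>. nrm \<zeta> > 0}" by (intro open_Collect_less continuous_on_const)
  moreover have "open {\<zeta>::nat\<Rightarrow>real. \<zeta> 1 > 0}" by (intro open_Collect_less continuous_on_const c)
  ultimately show ?thesis by (simp add: open_Int Collect_conj_eq)
qed

lemma open_clearance:
  assumes "open U"
  shows "open {\<zeta>. nrm \<zeta> > 0 \<and> \<zeta> 1 > 0 \<and> clearance \<zeta> \<in> U}"
proof -
  have "open ({\<zeta>. nrm \<zeta> > 0 \<and> \<zeta> 1 > 0} \<inter> clearance -` U)"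
    by (rule continuous_open_preimage[OF continuous_on_subset[OF clearance_continuous] open_nrm_pos assms]) auto
  moreover have "{\<zeta>. nrm \<zeta> > 0 \<and> \<zeta> 1 > 0} \<inter> clearance -` U = {\<zeta>. nrm \<zeta> > 0 \<and> \<zeta> 1 > 0 \<and> clearance \<zeta> \<in> U}" by auto
  ultimately show ?thesis by simp
qed

lemma Ph_nrm: "\<zeta> \<in> Ph \<longleftrightarrow> \<zeta> \<in> rspace 4 \<and> \<zeta> 1 \<ge> 0 \<and> nrm \<zeta> > 0"
  using nrm_pos' by (auto simp: Ph_def nrm_def)

lemma coord_inv_hemi_cover: "\<zeta> \<in> Ph \<Longrightarrow> coord_inv hemi_cover chart0 \<zeta> = lift \<zeta>"
proof -
  assume z: "\<zeta> \<in> Ph"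
  let ?A = "{z \<in> cotan' hemi_cover. fst z \<in> fst chart0}"
  have inj: "inj_on crd ?A" by (rule inj_on_inverseI[where g = lift]) (simp add: lift_coord)
  have "lift \<zeta> \<in> ?A" using lift_cotan[OF z] by (auto simp: cotan'_def)
  from inv_into_f_f[OF inj this] show ?thesis
    using coord_lift z by (simp add: coord_inv_def Ph_def)
qed

text \<open>
  Positive clearance is an open condition, so the shift by \<open>2\<pi>\<close> is the identity in a neighbourhood.
\<close>

lemma abs_periodic_hemi_cover:
  assumes P: "\<zeta> \<in> Ph" and y: "\<zeta> 1 > 0" and d: "clearance \<zeta> > 0"
  shows "abs_periodic hemi_cover (2 * pi) (lift \<zeta>)"
proof -
  define W where "W = {\<xi> \<in> Ph. \<xi> 1 > 0 \<and> clearance \<xi> > 0}"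
  have W_eq: "W = rspace 4 \<inter> {\<xi>. nrm \<xi> > 0 \<and> \<xi> 1 > 0 \<and> clearance \<xi> \<in> {0<..}}"
    by (auto simp: W_def Ph_nrm)
  have W: "openin (Euclidean_space 4) W"
  proof -
    have "openin (Euclidean_space 4) (rspace 4 \<inter> U)" if "open U" for U
      using that by (auto simp: Euclidean_space_def openin_subtopology euclidean_product_topology)
    then show ?thesis unfolding W_eq using open_clearance[of "{0<..}"] by simp
  qed
  have inW: "crd (lift \<zeta>) \<in> W" using assms coord_lift by (simp add: W_def Ph_def)
  have sub: "W \<subseteq> crd ` {z \<in> cotan' hemi_cover. fst z \<in> fst chart0 - mboundary hemi_cover}"
  proof
    fix \<xi> assume x: "\<xi> \<in> W"
    then have xP: "\<xi> \<in> Ph" "\<xi> 1 > 0" by (auto simp: W_def)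
    have "\<xi> = crd (lift \<xi>)" using coord_lift xP by (simp add: Ph_def)
    moreover have "lift \<xi> \<in> {z \<in> cotan' hemi_cover. fst z \<in> fst chart0 - mboundary hemi_cover}"
      using lift_cotan[OF xP(1)] lift_boundary[OF xP(1)] xP(2) by (auto simp: cotan'_def)
    ultimately show "\<xi> \<in> crd ` {z \<in> cotan' hemi_cover. fst z \<in> fst chart0 - mboundary hemi_cover}" by blast
  qed
  have re: "reaches hemi_cover (2 * pi) (coord_inv hemi_cover chart0 \<xi>) (lift \<xi>)" if "\<xi> \<in> W" for \<xi>
    using that closed_orbit(1) coord_inv_hemi_cover by (simp add: W_def)
  have flat: "flat_zero (2 * mdim hemi_cover) W
      (\<lambda>\<xi>. \<Sum>i<2 * mdim hemi_cover. (crd (shift hemi_cover (2 * pi) (coord_inv hemi_cover chart0 \<xi>)) i - \<xi> i)\<^sup>2) (crd (lift \<zeta>))"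
  proof (rule flat_zero_vanishing)
    fix \<xi> assume x: "\<xi> \<in> W"
    have "shift hemi_cover (2 * pi) (coord_inv hemi_cover chart0 \<xi>) = lift \<xi>"
      by (rule shift_hemi_cover[OF _ re[OF x]]) simp
    moreover have "crd (lift \<xi>) = \<xi>" using x coord_lift by (simp add: W_def Ph_def)
    ultimately show "(\<Sum>i<2 * mdim hemi_cover. (crd (shift hemi_cover (2 * pi) (coord_inv hemi_cover chart0 \<xi>)) i - \<xi> i)\<^sup>2) = 0" by simp
  qed (use W inW in auto)
  have hp: "fst (lift \<xi>) \<in> halfspace 2" if "\<xi> \<in> Ph" for \<xi>
    using lift_cotan[OF that] by (auto simp: cotan'_def)
  have T: "T_periodic hemi_cover (2 * pi) (lift \<zeta>)"
    using closed_orbit(1)[OF assms] by (simp add: T_periodic_def)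
  have ex: "\<forall>\<xi>\<in>W. \<exists>w. reaches hemi_cover (2 * pi) (coord_inv hemi_cover chart0 \<xi>) w \<and> fst w \<in> fst chart0"
  proof
    fix \<xi> assume "\<xi> \<in> W"
    then show "\<exists>w. reaches hemi_cover (2 * pi) (coord_inv hemi_cover chart0 \<xi>) w \<and> fst w \<in> fst chart0"
      using re hp[of \<xi>] by (intro exI[of _ "lift \<xi>"]) (simp add: W_def)
  qed
  show ?thesis
    unfolding abs_periodic_def
  proof (intro conjI T bexI[of _ chart0] exI[of _ W])
    show "fst (lift \<zeta>) \<in> fst chart0" using hp[OF P] by simp
  qed (use W sub ex flat in simp_all)
qed

text \<open>
  The two sets of interest coincide exactly, not only up to null sets, with a set given by continuous
  functions. This settles their measurability.
\<close>

lemma Per_hemi_cover: "Per hemi_cover = {z \<in> cosphere hemi_cover. crd z 1 > 0 \<and> clearance (crd z) > 0}"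
  and AbsPer_hemi_cover: "AbsPer hemi_cover (2 * pi) 2 = {z \<in> cosphere hemi_cover. crd z 1 > 0 \<and> clearance (crd z) > 0}"
proof -
  have z: "crd z \<in> Ph \<and> lift (crd z) = z \<and> (fst z \<notin> mboundary hemi_cover \<longleftrightarrow> crd z 1 > 0)" if "z \<in> cosphere hemi_cover" for z
  proof -
    have c: "z \<in> cotan' hemi_cover" using that by (simp add: cosphere_def)
    have P: "crd z \<in> Ph" by (rule coord_Ph[OF c])
    have l: "lift (crd z) = z" by (rule lift_coord[OF c])
    show ?thesis using P l lift_boundary[OF P] by (auto simp: Ph_def)
  qed
  show "Per hemi_cover = {z \<in> cosphere hemi_cover. crd z 1 > 0 \<and> clearance (crd z) > 0}"
    unfolding Per_def using z periodic_iff by (smt (verit) Collect_cong)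
  show "AbsPer hemi_cover (2 * pi) 2 = {z \<in> cosphere hemi_cover. crd z 1 > 0 \<and> clearance (crd z) > 0}"
  proof (intro set_eqI iffI)
    fix x assume x: "x \<in> AbsPer hemi_cover (2 * pi) 2"
    then have s: "x \<in> cosphere hemi_cover" "fst x \<notin> mboundary hemi_cover" "periodic hemi_cover x"
      by (auto simp: AbsPer_def abs_periodic_def periodic_def)
    then show "x \<in> {z \<in> cosphere hemi_cover. crd z 1 > 0 \<and> clearance (crd z) > 0}"
      using z[OF s(1)] periodic_iff[of "crd x"] by simp
  next
    fix x assume "x \<in> {z \<in> cosphere hemi_cover. crd z 1 > 0 \<and> clearance (crd z) > 0}"
    then have s: "x \<in> cosphere hemi_cover" "crd x 1 > 0" "clearance (crd x) > 0" by auto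
    from z[OF s(1)] have P: "crd x \<in> Ph" and l: "lift (crd x) = x" and b: "fst x \<notin> mboundary hemi_cover"
      using s(2) by auto
    have "abs_periodic hemi_cover (2 * pi) x" using abs_periodic_hemi_cover[OF P s(2,3)] by (simp only: l)
    moreover have "hits hemi_cover (2 * pi) 2 x" using closed_orbit(2)[OF P s(2,3)] by (simp only: l)
    ultimately show "x \<in> AbsPer hemi_cover (2 * pi) 2" using s(1) b by (simp add: AbsPer_def)
  qed
qed

section \<open>The natural measure\<close>

definition embed :: "nat \<Rightarrow> (nat \<Rightarrow> real) \<Rightarrow> nat \<Rightarrow> real" where
  "embed n f = (\<lambda>i. if i < n then f i else 0)"

lemma embed_measurable: "embed n \<in> measurable (Pi\<^sub>M {..<n} (\<lambda>_. lborel)) borel"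
proof (rule measurable_coordinatewise_then_product)
  fix i
  show "(\<lambda>f. embed n f i) \<in> borel_measurable (Pi\<^sub>M {..<n} (\<lambda>_. lborel))"
  proof (cases "i < n")
    case True
    then have "(\<lambda>f. f i) \<in> measurable (Pi\<^sub>M {..<n} (\<lambda>_. lborel :: real measure)) lborel"
      by (intro measurable_component_singleton) auto
    then show ?thesis using True by (simp add: embed_def)
  qed (simp add: embed_def)
qed

lemma leb_embed: "leb n = distr (Pi\<^sub>M {..<n} (\<lambda>_. lborel)) borel (embed n)"
  by (simp add: leb_def embed_def[abs_def])

lemma sets_leb [simp]: "sets (leb n) = sets borel" and space_leb [simp]: "space (leb n) = UNIV"
  by (simp_all add: leb_embed)

text \<open>
  A neighbourhood in the product topology contains a box that restricts finitely many coordinates; in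
  the coordinates from \<open>n\<close> on the points of \<open>\<real>\<^sup>n\<close> agree with \<open>\<zeta>\<close>.
\<close>

lemma leb_open_pos:
  assumes G: "open G" and z: "\<zeta> \<in> G" "\<zeta> \<in> rspace n" and S: "S \<in> sets borel" and sub: "G \<inter> rspace n \<subseteq> S"
  shows "emeasure (leb n) S > 0"
proof -
  interpret product_sigma_finite "\<lambda>_::nat. lborel :: real measure" ..
  have "openin (product_topology (\<lambda>_. euclidean) UNIV) G"
    using G by (simp add: euclidean_product_topology)
  from product_topology_open_contains_basis[OF this z(1)]
  obtain X where X: "\<zeta> \<in> (\<Pi>\<^sub>E i\<in>UNIV. X i)" "\<And>i. open (X i)" "(\<Pi>\<^sub>E i\<in>UNIV. X i) \<subseteq> G" by auto
  have zX: "\<zeta> i \<in> X i" for i using X(1) by auto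
  have "\<exists>e>0. ball (\<zeta> i) e \<subseteq> X i" for i using X(2) zX by (meson openE)
  then obtain e where e: "\<And>i. e i > 0" "\<And>i. ball (\<zeta> i) (e i) \<subseteq> X i" by metis
  let ?B = "\<Pi>\<^sub>E i\<in>{..<n}. {\<zeta> i - e i<..<\<zeta> i + e i}"
  let ?P = "Pi\<^sub>M {..<n} (\<lambda>_. lborel :: real measure)"
  have "emeasure ?P ?B = (\<Prod>i<n. emeasure lborel {\<zeta> i - e i<..<\<zeta> i + e i})"
    by (rule emeasure_PiM) auto
  also have "\<dots> = (\<Prod>i<n. ennreal (2 * e i))" using e(1) by (intro prod.cong) (auto simp: less_imp_le)
  also have "\<dots> = ennreal (\<Prod>i<n. 2 * e i)" using e(1) by (intro prod_ennreal) (auto simp: less_imp_le)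
  finally have pos: "emeasure ?P ?B > 0" using e(1) by (simp add: prod_pos)
  have "?B \<subseteq> embed n -` S \<inter> space ?P"
  proof
    fix f assume f: "f \<in> ?B"
    have "embed n f i \<in> X i" for i
    proof (cases "i < n")
      case True
      then have "\<zeta> i - e i < f i" "f i < \<zeta> i + e i" using f by (auto simp: PiE_iff)
      then have "f i \<in> ball (\<zeta> i) (e i)" by (auto simp: dist_real_def abs_less_iff)
      from subsetD[OF e(2) this] show ?thesis using True by (simp add: embed_def)
    next
      case False
      then show ?thesis using zX[of i] z(2) by (simp add: embed_def topspace_Euclidean_space)
    qed
    then have "embed n f \<in> G" using X(3) by auto
    moreover have "embed n f \<in> rspace n" by (simp add: embed_def topspace_Euclidean_space)
    ultimately show "f \<in> embed n -` S \<inter> space ?P" using sub f by (auto simp: space_PiM PiE_iff)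
  qed
  moreover have "embed n -` S \<inter> space ?P \<in> sets ?P" using embed_measurable S by (rule measurable_sets)
  ultimately have "emeasure ?P ?B \<le> emeasure ?P (embed n -` S \<inter> space ?P)" by (rule emeasure_mono)
  also have "\<dots> = emeasure (leb n) S" unfolding leb_embed by (rule emeasure_distr[symmetric, OF embed_measurable S])
  finally show ?thesis using pos by simp
qed

definition unit_cov :: "(nat \<Rightarrow> real) \<Rightarrow> nat \<Rightarrow> real" where
  "unit_cov \<zeta> = (\<lambda>i. if i < 2 then \<zeta> i else \<zeta> i / hm \<zeta>)"

definition ball_phase :: "(nat \<Rightarrow> real) set" where
  "ball_phase = {\<zeta> \<in> Ph. hm \<zeta> \<le> 1}"

text \<open>
  Radial projection of covectors to the unit cosphere bundle.
\<close>

definition to_cosphere :: "(nat \<Rightarrow> real) \<Rightarrow> (nat \<Rightarrow> real) copoint" where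
  "to_cosphere \<zeta> = lift (unit_cov \<zeta>)"

lemma continuous_hm: "continuous_on UNIV hm" and continuous_nrm: "continuous_on UNIV nrm"
proof -
  have c: "continuous_on UNIV (\<lambda>x::nat\<Rightarrow>real. x i)" for i by simp
  show n: "continuous_on UNIV nrm" unfolding nrm_def[abs_def] by (intro continuous_intros c)
  have k: "continuous_on UNIV conf" unfolding conf_def[abs_def] by (intro continuous_intros c)
  show "continuous_on UNIV hm" unfolding hm_def[abs_def] by (intro continuous_intros n k)
qed

lemma hm_measurable [measurable]: "hm \<in> borel_measurable borel"
  by (rule borel_measurable_continuous_onI[OF continuous_hm])

lemma unit_cov_measurable: "unit_cov \<in> borel_measurable borel"
proof (rule measurable_coordinatewise_then_product)
  fix i
  show "(\<lambda>\<zeta>. unit_cov \<zeta> i) \<in> borel_measurable borel"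
    by (cases "i < 2") (simp_all add: unit_cov_def)
qed

lemma Ph_borel: "Ph \<in> sets borel"
proof -
  have 1: "closed (rspace 4)"
    using closedin_Euclidean_space[of 4] by (simp add: euclidean_product_topology)
  have 2: "closed {\<zeta>::nat\<Rightarrow>real. 0 \<le> \<zeta> 1}" by (intro closed_Collect_le continuous_on_const) simp
  have 3: "open {\<zeta>. 0 < nrm \<zeta>}" by (intro open_Collect_less continuous_on_const continuous_nrm)
  have 4: "Ph = rspace 4 \<inter> {\<zeta>. 0 \<le> \<zeta> 1} \<inter> {\<zeta>. 0 < nrm \<zeta>}" by (auto simp: Ph_nrm)
  show ?thesis unfolding 4 by (rule sets.Int[OF sets.Int[OF borel_closed[OF 1] borel_closed[OF 2]] borel_open[OF 3]])
qed

lemma ball_phase_borel: "ball_phase \<in> sets borel"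
proof -
  have 1: "closed {\<zeta>. hm \<zeta> \<le> 1}" by (intro closed_Collect_le continuous_on_const continuous_hm)
  have 2: "ball_phase = Ph \<inter> {\<zeta>. hm \<zeta> \<le> 1}" by (auto simp: ball_phase_def)
  show ?thesis unfolding 2 by (rule sets.Int[OF Ph_borel borel_closed[OF 1]])
qed

lemma cosphere_hemi_cover: "z \<in> cosphere hemi_cover \<longleftrightarrow> z \<in> cotan' hemi_cover \<and> hm (crd z) = 1"
  by (auto simp: cosphere_def ham_hemi_cover hm_def cotan'_def)

lemma crd_cosphere: "crd ` cosphere hemi_cover = {\<zeta> \<in> Ph. hm \<zeta> = 1}"
proof (intro set_eqI iffI)
  fix \<zeta> assume "\<zeta> \<in> {\<zeta> \<in> Ph. hm \<zeta> = 1}"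
  then have "lift \<zeta> \<in> cosphere hemi_cover" "crd (lift \<zeta>) = \<zeta>"
    using lift_cotan coord_lift by (auto simp: cosphere_hemi_cover Ph_def)
  then show "\<zeta> \<in> crd ` cosphere hemi_cover" by (metis imageI)
qed (use coord_Ph in \<open>auto simp: cosphere_hemi_cover\<close>)

lemma crd_cosphere_borel: "crd ` cosphere hemi_cover \<in> sets borel"
proof -
  have 1: "closed {\<zeta>. hm \<zeta> = 1}" by (intro closed_Collect_eq continuous_on_const continuous_hm)
  have 2: "crd ` cosphere hemi_cover = Ph \<inter> {\<zeta>. hm \<zeta> = 1}" by (auto simp: crd_cosphere)
  show ?thesis unfolding 2 by (rule sets.Int[OF Ph_borel borel_closed[OF 1]])
qed

lemma unit_cov_facts:
  assumes "\<zeta> \<in> Ph"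
  shows "unit_cov \<zeta> \<in> Ph" "hm (unit_cov \<zeta>) = 1" "conf (unit_cov \<zeta>) = conf \<zeta>"
    "nrm (unit_cov \<zeta>) = nrm \<zeta> / hm \<zeta>" "to_cosphere \<zeta> \<in> cosphere hemi_cover" "crd (to_cosphere \<zeta>) = unit_cov \<zeta>"
proof -
  have h: "hm \<zeta> > 0" by (rule hm_pos[OF assms])
  show P: "unit_cov \<zeta> \<in> Ph" using assms h by (auto simp: Ph_def unit_cov_def topspace_Euclidean_space)
  show c: "conf (unit_cov \<zeta>) = conf \<zeta>" by (simp add: conf_def unit_cov_def)
  have "(\<zeta> 2 / hm \<zeta>)\<^sup>2 + (\<zeta> 3 / hm \<zeta>)\<^sup>2 = ((\<zeta> 2)\<^sup>2 + (\<zeta> 3)\<^sup>2) / (hm \<zeta>)\<^sup>2"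
    by (simp add: power_divide add_divide_distrib)
  then show n: "nrm (unit_cov \<zeta>) = nrm \<zeta> / hm \<zeta>"
    using h by (simp add: nrm_def unit_cov_def real_sqrt_divide)
  have "hm (unit_cov \<zeta>) = hm \<zeta> / hm \<zeta>" unfolding hm_def[of "unit_cov \<zeta>"] c n by (simp add: hm_def)
  then show h1: "hm (unit_cov \<zeta>) = 1" using h by simp
  show cl: "crd (to_cosphere \<zeta>) = unit_cov \<zeta>" using coord_lift P by (simp add: to_cosphere_def Ph_def)
  show "to_cosphere \<zeta> \<in> cosphere hemi_cover" using lift_cotan[OF P] h1 cl by (simp add: cosphere_hemi_cover to_cosphere_def)
qed

text \<open>
  The truncated cone over \<open>A\<close> consists of the covectors of length at most \<open>1\<close> that are projected radially
  into \<open>A\<close>. So the measure of cones is an image measure, and in particular countably additive in \<open>A\<close>.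
\<close>

lemma cone_hemi_cover:
  assumes A: "A \<subseteq> cosphere hemi_cover"
  shows "cone hemi_cover chart0 A = {\<zeta> \<in> ball_phase. to_cosphere \<zeta> \<in> A}"
proof (intro set_eqI iffI)
  fix \<zeta> assume "\<zeta> \<in> cone hemi_cover chart0 A"
  then obtain r z where r: "0 < r" "r \<le> 1" and z: "z \<in> A"
    and eq: "\<zeta> = (\<lambda>i. if i < 2 then crd z i else r * crd z i)"
    by (auto simp: cone_def)
  define w where "w = crd z"
  have zc: "z \<in> cotan' hemi_cover" and hw: "hm w = 1" using A z by (auto simp: cosphere_hemi_cover w_def)
  have wP: "w \<in> Ph" using coord_Ph[OF zc] by (simp add: w_def)
  have i: "\<zeta> 0 = w 0" "\<zeta> 1 = w 1" "\<zeta> 2 = r * w 2" "\<zeta> 3 = r * w 3" by (simp_all add: eq w_def)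
  have "(r * w 2)\<^sup>2 + (r * w 3)\<^sup>2 = r\<^sup>2 * ((w 2)\<^sup>2 + (w 3)\<^sup>2)" by algebra
  then have n: "nrm \<zeta> = r * nrm w" using r by (simp add: nrm_def i real_sqrt_mult)
  have "conf \<zeta> = conf w" by (simp only: conf_def i)
  then have h: "hm \<zeta> = r" using n hw by (simp add: hm_def)
  have "\<zeta> j = 0" if "j \<ge> 4" for j
    using fun_cong[OF eq, of j] wP that by (simp add: Ph_def topspace_Euclidean_space w_def)
  then have "\<zeta> \<in> rspace 4" by (simp add: topspace_Euclidean_space)
  moreover have "\<zeta> 1 \<ge> 0" unfolding i using wP by (simp only: Ph_def mem_Collect_eq)
  moreover have "nrm \<zeta> > 0" unfolding n using r nrm_pos[OF wP] by simp
  ultimately have zP: "\<zeta> \<in> Ph" unfolding Ph_nrm by blast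
  have "unit_cov \<zeta> = w"
  proof
    fix i show "unit_cov \<zeta> i = w i"
      using r(1) fun_cong[OF eq, of i] by (cases "i < 2") (simp_all add: unit_cov_def h w_def)
  qed
  then have "to_cosphere \<zeta> = z" using lift_coord[OF zc] by (simp add: to_cosphere_def w_def)
  then show "\<zeta> \<in> {\<zeta> \<in> ball_phase. to_cosphere \<zeta> \<in> A}" using zP h r z by (simp add: ball_phase_def)
next
  fix \<zeta> assume "\<zeta> \<in> {\<zeta> \<in> ball_phase. to_cosphere \<zeta> \<in> A}"
  then have P: "\<zeta> \<in> Ph" and h: "hm \<zeta> \<le> 1" and a: "to_cosphere \<zeta> \<in> A" by (auto simp: ball_phase_def)
  have h0: "hm \<zeta> > 0" by (rule hm_pos[OF P])
  have "\<zeta> = (\<lambda>(r, z) i. if i < mdim hemi_cover then crd z i else r * crd z i) (hm \<zeta>, to_cosphere \<zeta>)"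
  proof
    fix i show "\<zeta> i = (\<lambda>(r, z) i. if i < mdim hemi_cover then crd z i else r * crd z i) (hm \<zeta>, to_cosphere \<zeta>) i"
      using h0 by (simp add: unit_cov_facts(6)[OF P]) (simp add: unit_cov_def)
  qed
  moreover have "(hm \<zeta>, to_cosphere \<zeta>) \<in> {0<..1} \<times> A" using h0 h a by simp
  ultimately show "\<zeta> \<in> cone hemi_cover chart0 A" unfolding cone_def by (rule image_eqI)
qed

text \<open>
  The factor \<open>2\<close> is the dimension of the surface.
\<close>

definition liouville :: "(nat \<Rightarrow> real) copoint measure" where
  "liouville = distr (scale_measure 2 (restrict_space (leb 4) ball_phase)) (vimage_algebra (cosphere hemi_cover) crd borel) to_cosphere"

lemma inj_crd: "inj_on crd (cosphere hemi_cover)"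
  by (rule inj_on_inverseI[where g = lift]) (simp add: cosphere_hemi_cover lift_coord)

lemma sets_liouville: "sets liouville = {A. A \<subseteq> cosphere hemi_cover \<and> crd ` A \<in> sets borel}"
proof -
  have "sets liouville = {crd -` B \<inter> cosphere hemi_cover | B. B \<in> sets borel}"
    unfolding liouville_def sets_distr by (rule sets_vimage_algebra2) simp
  also have "\<dots> = {A. A \<subseteq> cosphere hemi_cover \<and> crd ` A \<in> sets borel}"
  proof (intro set_eqI iffI)
    fix A assume "A \<in> {crd -` B \<inter> cosphere hemi_cover | B. B \<in> sets borel}"
    then obtain B where B: "A = crd -` B \<inter> cosphere hemi_cover" "B \<in> sets borel" by blast
    have "crd ` A = B \<inter> crd ` cosphere hemi_cover" using B(1) by blast
    then show "A \<in> {A. A \<subseteq> cosphere hemi_cover \<and> crd ` A \<in> sets borel}"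
      using B crd_cosphere_borel by (simp add: sets.Int)
  next
    fix A assume A: "A \<in> {A. A \<subseteq> cosphere hemi_cover \<and> crd ` A \<in> sets borel}"
    then have "A = crd -` (crd ` A) \<inter> cosphere hemi_cover"
      using inj_crd by (auto simp: inj_on_def)
    then show "A \<in> {crd -` B \<inter> cosphere hemi_cover | B. B \<in> sets borel}" using A by blast
  qed
  finally show ?thesis .
qed

lemma space_liouville: "space liouville = cosphere hemi_cover"
  by (simp add: liouville_def)

lemma to_cosphere_measurable:
  "to_cosphere \<in> measurable (scale_measure 2 (restrict_space (leb 4) ball_phase)) (vimage_algebra (cosphere hemi_cover) crd borel)"
proof (rule measurable_vimage_algebra2)
  show "to_cosphere \<in> space (scale_measure 2 (restrict_space (leb 4) ball_phase)) \<rightarrow> cosphere hemi_cover"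
    using unit_cov_facts(5) by (auto simp: space_scale_measure space_restrict_space ball_phase_def)
  have "(borel_measurable (leb 4) :: ((nat \<Rightarrow> real) \<Rightarrow> nat \<Rightarrow> real) set) = borel_measurable borel"
    by (rule measurable_cong_sets[OF sets_leb refl])
  then have "unit_cov \<in> borel_measurable (leb 4)" using unit_cov_measurable by simp
  then have "unit_cov \<in> borel_measurable (restrict_space (leb 4) ball_phase)"
    by (rule measurable_restrict_space1)
  then have "(\<lambda>x. crd (to_cosphere x)) \<in> borel_measurable (restrict_space (leb 4) ball_phase)"
    by (rule measurable_cong[THEN iffD2, rotated])
       (simp add: space_restrict_space ball_phase_def unit_cov_facts(6))
  moreover have "(borel_measurable (scale_measure 2 (restrict_space (leb 4) ball_phase)) ::
      ((nat \<Rightarrow> real) \<Rightarrow> nat \<Rightarrow> real) set) = borel_measurable (restrict_space (leb 4) ball_phase)"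
    by (rule measurable_cong_sets[OF sets_scale_measure refl])
  ultimately show "(\<lambda>x. crd (to_cosphere x)) \<in> borel_measurable (scale_measure 2 (restrict_space (leb 4) ball_phase))"
    by simp
qed

lemma to_cosphere_preimage:
  "to_cosphere -` A \<inter> space (scale_measure 2 (restrict_space (leb 4) ball_phase)) = {\<zeta> \<in> ball_phase. to_cosphere \<zeta> \<in> A}"
  by (auto simp: space_scale_measure space_restrict_space)

lemma cone_borel:
  assumes "A \<in> sets liouville"
  shows "{\<zeta> \<in> ball_phase. to_cosphere \<zeta> \<in> A} \<in> sets borel"
proof -
  have "to_cosphere -` A \<inter> space (scale_measure 2 (restrict_space (leb 4) ball_phase))
      \<in> sets (scale_measure 2 (restrict_space (leb 4) ball_phase))"
    by (rule measurable_sets[OF to_cosphere_measurable]) (use assms in \<open>simp add: liouville_def\<close>)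
  then show ?thesis
    unfolding to_cosphere_preimage using ball_phase_borel by (simp add: sets_restrict_space_iff)
qed

lemma emeasure_liouville:
  assumes "A \<in> sets liouville"
  shows "emeasure liouville A = 2 * emeasure (leb 4) {\<zeta> \<in> ball_phase. to_cosphere \<zeta> \<in> A}"
proof -
  have "emeasure liouville A = emeasure (scale_measure 2 (restrict_space (leb 4) ball_phase)) {\<zeta> \<in> ball_phase. to_cosphere \<zeta> \<in> A}"
    unfolding liouville_def to_cosphere_preimage[symmetric]
    by (rule emeasure_distr[OF to_cosphere_measurable]) (use assms in \<open>simp add: liouville_def\<close>)
  also have "\<dots> = 2 * emeasure (leb 4) {\<zeta> \<in> ball_phase. to_cosphere \<zeta> \<in> A}"
    using ball_phase_borel by (subst emeasure_scale_measure, subst emeasure_restrict_space) auto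
  finally show ?thesis .
qed

lemma natural_measure_liouville: "natural_measure hemi_cover liouville"
proof -
  have f: "{z \<in> A. fst z \<in> halfspace 2} = A" if "A \<subseteq> cosphere hemi_cover" for A
    using that by (auto simp: cosphere_hemi_cover cotan'_def)
  have 1: "sets liouville = {A. A \<subseteq> cosphere hemi_cover \<and>
        (\<forall>c\<in>atlas hemi_cover. coord hemi_cover c ` {z \<in> A. fst z \<in> fst c} \<in> sets borel)}"
    unfolding sets_liouville using f by auto
  have 2: "emeasure liouville A = of_nat (mdim hemi_cover) * emeasure (leb (2 * mdim hemi_cover)) (cone hemi_cover c A)"
    if c: "c \<in> atlas hemi_cover" and A: "A \<in> sets liouville" for A c
  proof -
    have "A \<subseteq> cosphere hemi_cover" using A by (simp add: sets_liouville)
    moreover have "c = chart0" using c by simp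
    ultimately show ?thesis unfolding emeasure_liouville[OF A] by (simp only: cone_hemi_cover) simp
  qed
  show ?thesis
    unfolding natural_measure_def
  proof (intro conjI ballI impI)
    show "space liouville = cosphere hemi_cover" by (rule space_liouville)
  qed (fact 1, erule (1) 2)
qed

text \<open>
  Positions and velocities on the sphere depend only on the direction of the covector.
\<close>

lemma clearance_unit_cov:
  assumes "\<zeta> \<in> Ph"
  shows "clearance (unit_cov \<zeta>) = clearance \<zeta>"
proof -
  have i: "unit_cov \<zeta> 0 = \<zeta> 0" "unit_cov \<zeta> 1 = \<zeta> 1" "unit_cov \<zeta> 2 = \<zeta> 2 / hm \<zeta>" "unit_cov \<zeta> 3 = \<zeta> 3 / hm \<zeta>"
    by (simp_all add: unit_cov_def)
  have X: "Xr (unit_cov \<zeta>) = Xr \<zeta>" "Xv (unit_cov \<zeta>) = Xv \<zeta>"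
    by (simp_all only: Xr_def Xv_def i unit_cov_facts(3)[OF assms])
  have "Pr (unit_cov \<zeta>) = Pr \<zeta>"
    unfolding Pr_def i unit_cov_facts(2)[OF assms] div_by_1 times_divide_eq_right
    by (simp only: add_divide_distrib[symmetric] diff_divide_distrib[symmetric] minus_divide_left)
  moreover have "Pv (unit_cov \<zeta>) = Pv \<zeta>"
    unfolding Pv_def i unit_cov_facts(2)[OF assms] div_by_1 times_divide_eq_right
    by (simp only: add_divide_distrib[symmetric] diff_divide_distrib[symmetric] minus_divide_left)
  ultimately show ?thesis by (simp only: clearance_def X)
qed

text \<open>
  The cone over such a set contains the open set of all covectors over the interior that satisfy the
  same condition and have length less than \<open>1\<close>.
\<close>

lemma clearance_set_measure:
  assumes U: "open U" and P: "\<zeta> \<in> Ph" "\<zeta> 1 > 0" "hm \<zeta> < 1" "clearance \<zeta> \<in> U"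
  shows "{z \<in> cosphere hemi_cover. crd z 1 > 0 \<and> clearance (crd z) \<in> U} \<in> sets liouville"
    and "emeasure liouville {z \<in> cosphere hemi_cover. crd z 1 > 0 \<and> clearance (crd z) \<in> U} > 0"
proof -
  let ?A = "{z \<in> cosphere hemi_cover. crd z 1 > 0 \<and> clearance (crd z) \<in> U}"
  let ?D = "{\<zeta>. nrm \<zeta> > 0 \<and> \<zeta> 1 > 0 \<and> clearance \<zeta> \<in> U}"
  have "nrm (crd z) > 0" if "z \<in> cosphere hemi_cover" for z
    using that by (simp add: cosphere_hemi_cover coord_Ph nrm_pos)
  then have "crd ` ?A = crd ` cosphere hemi_cover \<inter> ?D" by blast
  then have "crd ` ?A \<in> sets borel"
    using crd_cosphere_borel open_clearance[OF U] by (simp add: borel_open sets.Int)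
  then show A: "?A \<in> sets liouville" by (auto simp: sets_liouville)
  let ?G = "?D \<inter> {\<zeta>. hm \<zeta> < 1}"
  have "open ?G" using open_clearance[OF U] by (intro open_Int open_Collect_less continuous_on_const continuous_hm)
  moreover have "\<zeta> \<in> ?G" "\<zeta> \<in> rspace 4" using P nrm_pos by (auto simp: Ph_def)
  moreover have "?G \<inter> rspace 4 \<subseteq> {\<zeta> \<in> ball_phase. to_cosphere \<zeta> \<in> ?A}"
  proof
    fix \<xi> assume x: "\<xi> \<in> ?G \<inter> rspace 4"
    then have xP: "\<xi> \<in> Ph" by (auto simp: Ph_nrm)
    have "unit_cov \<xi> 1 = \<xi> 1" by (simp add: unit_cov_def)
    then show "\<xi> \<in> {\<zeta> \<in> ball_phase. to_cosphere \<zeta> \<in> ?A}"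
      using x xP unit_cov_facts(5,6)[OF xP] clearance_unit_cov[OF xP] by (auto simp: ball_phase_def)
  qed
  ultimately have "emeasure (leb 4) {\<zeta> \<in> ball_phase. to_cosphere \<zeta> \<in> ?A} > 0"
    using cone_borel[OF A] by (intro leb_open_pos[of ?G \<zeta> 4])
  then show "emeasure liouville ?A > 0" unfolding emeasure_liouville[OF A] by (simp add: ennreal_zero_less_mult_iff)
qed

section \<open>Existence of the billiard\<close>

definition mk4 :: "real \<Rightarrow> real \<Rightarrow> real \<Rightarrow> real \<Rightarrow> nat \<Rightarrow> real" where
  "mk4 x y a b = (\<lambda>i. if i = 0 then x else if i = 1 then y else if i = 2 then a else if i = 3 then b else 0)"

lemma mk4_simps: "mk4 x y a b 0 = x" "mk4 x y a b 1 = y" "mk4 x y a b 2 = a" "mk4 x y a b 3 = b"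
  by (simp_all add: mk4_def)

lemma mk4_rspace: "mk4 x y a b \<in> rspace 4"
  by (simp add: mk4_def topspace_Euclidean_space)

text \<open>
  At \<open>x = \<pi> / 2\<close> the point \<open>(r, v)\<close> lies on the line \<open>r = - cb / ca\<close> through the removed point. A covector
  in the \<open>y\<close>-direction moves it along this line, which is thus a tangent of the ellipse, and a point on a
  tangent is outside.
\<close>

lemma periodic_point: "\<exists>\<zeta>\<in>Ph. \<zeta> 1 > 0 \<and> hm \<zeta> < 1 \<and> clearance \<zeta> > 0"
proof -
  define K where "K = ca * cosh 1"
  have K: "K > 0" using ca_cb cosh_real_pos[of 1] by (simp add: K_def)
  define \<zeta> where "\<zeta> = mk4 (pi / 2) 1 0 (1 / (2 * K))"
  note s = mk4_simps[of "pi / 2" 1 0 "1 / (2 * K)", folded \<zeta>_def]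
  have c: "conf \<zeta> = K" unfolding conf_def s by (simp add: K_def)
  have n: "nrm \<zeta> = 1 / (2 * K)" unfolding nrm_def s using K by simp
  have h: "hm \<zeta> = 1 / 2" unfolding hm_def c n using K by simp
  have P: "\<zeta> \<in> Ph" using mk4_rspace[of "pi / 2" 1 0 "1 / (2 * K)", folded \<zeta>_def] s K by (simp add: Ph_nrm n)
  have "Xr \<zeta> = - cb * cosh 1 / K" unfolding Xr_def c s by simp
  then have r: "ca * Xr \<zeta> = - cb" using ca_cb cosh_real_pos[of 1] by (simp add: K_def)
  have v: "Xv \<zeta> = 1 / K" unfolding Xv_def c s by simp
  have p: "Pr \<zeta> = 0" unfolding Pr_def s by simp
  have "clearance \<zeta> = cb\<^sup>2 * (1 / K)\<^sup>2"
    unfolding clearance_def using r by (simp add: v p algebra_simps power_mult_distrib)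
       (metis mult.assoc mult.commute power2_minus power_mult_distrib)
  then have "clearance \<zeta> > 0" using K ca_cb by simp
  then show ?thesis using P h s by (intro bexI[of _ \<zeta>]) auto
qed

text \<open>
  At \<open>x = \<pi>\<close> the point \<open>(r, v)\<close> lies on the axis \<open>v = 0\<close> beyond the removed point. A covector in the
  \<open>x\<close>-direction moves it at right angles to the axis, so the axis meets the ellipse in \<open>\<plusminus> r\<close>, and the
  removed point is between.
\<close>

lemma nonperiodic_point: "\<exists>\<zeta>\<in>Ph. \<zeta> 1 > 0 \<and> hm \<zeta> < 1 \<and> clearance \<zeta> < 0"
proof -
  define K where "K = ca * cosh 1 + cb"
  have ch: "cosh (1::real) > 0" by (rule cosh_real_pos)
  have K: "K > 0" using ca_cb ch by (simp add: K_def add_pos_pos)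
  define \<zeta> where "\<zeta> = mk4 pi 1 (1 / (2 * K)) 0"
  note s = mk4_simps[of pi 1 "1 / (2 * K)" 0, folded \<zeta>_def]
  have c: "conf \<zeta> = K" unfolding conf_def s by (simp add: K_def)
  have n: "nrm \<zeta> = 1 / (2 * K)" unfolding nrm_def s using K by simp
  have h: "hm \<zeta> = 1 / 2" unfolding hm_def c n using K by simp
  have P: "\<zeta> \<in> Ph" using mk4_rspace[of pi 1 "1 / (2 * K)" 0, folded \<zeta>_def] s K by (simp add: Ph_nrm n)
  have r: "Xr \<zeta> = - (ca + cb * cosh 1) / K" unfolding Xr_def c s by simp
  have v: "Xv \<zeta> = 0" unfolding Xv_def c s by simp
  have "Pv \<zeta> = - K * (1 / (2 * K)) / (1 / 2)" unfolding Pv_def s h by (simp add: K_def)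
  then have q: "Pv \<zeta> = - 1" using K by simp
  have "cb * K < ca * (ca + cb * cosh 1)"
    using ca_cb(1,2) by (simp add: K_def algebra_simps power2_eq_square)
  then have "cb < ca * (ca + cb * cosh 1) / K" using K by (simp add: pos_less_divide_eq)
  then have "cb\<^sup>2 < (ca * (ca + cb * cosh 1) / K)\<^sup>2" using ca_cb(2) by (intro power_strict_mono) auto
  moreover have e: "ca * (Xr \<zeta> * Pv \<zeta> - Xv \<zeta> * Pr \<zeta>) = ca * (ca + cb * cosh 1) / K"
    unfolding r v q using K by (simp add: field_simps)
  have "clearance \<zeta> = cb\<^sup>2 - (ca * (ca + cb * cosh 1) / K)\<^sup>2"
    unfolding clearance_def e unfolding v q by simp
  ultimately have "clearance \<zeta> < 0" by simp
  then show ?thesis using P h s by (intro bexI[of _ \<zeta>]) auto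
qed

theorem theorem4p8:
  fixes m :: "nat \<Rightarrow> real"
  assumes "carleman_weight m"
    and "\<not> quasianalytic m"
  shows "\<exists>(M :: (nat \<Rightarrow> real) rmanifold) \<sigma>.
    riemannian_carleman_manifold m M \<and> mboundary M \<noteq> {} \<and> natural_measure M \<sigma> \<and>
    convex_billiard M \<and> (\<forall>c\<in>atlas M. \<forall>\<zeta>\<in>bdry_phase M c. ham_curvature M c \<zeta> = 0) \<and>
    (\<exists>T>0. \<exists>l. emeasure (completion \<sigma>) (AbsPer M T l) > 0) \<and>
    (\<exists>\<gamma>. (\<forall>T>0. billiard M \<gamma> T) \<and> \<not> periodic M (\<gamma> 0)) \<and>
    emeasure (completion \<sigma>) (cosphere M - Per M) > 0"
proof -
  have compl: "emeasure (completion liouville) A = emeasure liouville A" if "A \<in> sets liouville" for A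
    using that by (simp add: main_part_sets)
  obtain \<zeta> where z: "\<zeta> \<in> Ph" "\<zeta> 1 > 0" "hm \<zeta> < 1" "clearance \<zeta> > 0" using periodic_point by blast
  obtain \<xi> where x: "\<xi> \<in> Ph" "\<xi> 1 > 0" "hm \<xi> < 1" "clearance \<xi> < 0" using nonperiodic_point by blast
  have "clearance \<zeta> \<in> {0<..}" "clearance \<xi> \<in> {..<0}" using z(4) x(4) by auto
  note pos = clearance_set_measure[OF open_greaterThan z(1-3) this(1), unfolded greaterThan_iff]
    and neg = clearance_set_measure[OF open_lessThan x(1-3) this(2), unfolded lessThan_iff]
  have 1: "emeasure (completion liouville) (AbsPer hemi_cover (2 * pi) 2) > 0"
    unfolding AbsPer_hemi_cover using pos by (simp add: compl)
  have "cosphere hemi_cover \<in> sets liouville" using sets.top[of liouville] by (simp add: space_liouville)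
  then have diff: "cosphere hemi_cover - Per hemi_cover \<in> sets liouville" unfolding Per_hemi_cover using pos(1) by (rule sets.Diff)
  have "0 < emeasure liouville {z \<in> cosphere hemi_cover. crd z 1 > 0 \<and> clearance (crd z) < 0}" by (rule neg(2))
  also have "\<dots> \<le> emeasure liouville (cosphere hemi_cover - Per hemi_cover)"
    by (rule emeasure_mono[OF _ diff]) (auto simp: Per_hemi_cover)
  finally have 2: "emeasure (completion liouville) (cosphere hemi_cover - Per hemi_cover) > 0" by (simp add: compl[OF diff])
  have 3: "\<exists>\<gamma>. (\<forall>T>0. billiard hemi_cover \<gamma> T) \<and> \<not> periodic hemi_cover (\<gamma> 0)"
  proof -
    obtain \<gamma> where "\<And>T. billiard hemi_cover \<gamma> T" "\<gamma> 0 = lift \<xi>" using infinite_orbit[OF x(1,2)] x(4) by auto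
    then show ?thesis using not_periodic_winding[OF x(1,4)] by (intro exI[of _ \<gamma>]) simp
  qed
  have "(\<lambda>_. 0) \<in> mboundary hemi_cover" by (simp add: mboundary_hemi_cover halfspace2)
  then have 4: "mboundary hemi_cover \<noteq> {}" by blast
  have 5: "\<exists>T>0. \<exists>l. emeasure (completion liouville) (AbsPer hemi_cover T l) > 0"
    by (intro exI[of _ "2 * pi"] exI[of _ 2] conjI 1) simp
  show ?thesis
    by (intro exI[of _ hemi_cover] exI[of _ liouville] conjI riemannian_hemi_cover[OF assms(1)] 4 natural_measure_liouville
        convex_hemi_cover[THEN conjunct1] convex_hemi_cover[THEN conjunct2] 5 3 2)
qed

end
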